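(* Let $u,v\in S_n$ and $k\in[n]$, and let $\pi_k:\mathrm{Fl}_n\to\mathrm{Gr}(k,n)$, $F_\bullet\mapsto F_k$. Then $\Pi_{u,v}:=\pi_k(\mathcal{T}_{u,v})$ is a positroid variety.
   Context: $\mathrm{Fl}_n$ is the variety of complete flags in $\mathbb{C}^n$ (a flag represented by a matrix whose first $k$ columns span $F_k$; $\mathrm{rank}_S(F_k)$ is the rank of its submatrix with rows $S$ and first $k$ columns). Positroid varieties in $\mathrm{Gr}(k,n)$ are those of Knutson–Lam–Speyer; equivalently, they are exactly the images $\pi_k(\mathcal{R}_{x,y})$ of Richardson varieties $\mathcal{R}_{x,y}=\overline{BvB/B}\cap\overline{B_-xB/B}$ for $x\le y$ in Bruhat order. Tilted Richardson variety: with $w[k]:=\{w_1,\dots,w_k\}$, cyclic intervals $[a,b)_c$ ($\{a,\dots,b-1\}$ if $a\le b$, empty if $a=b$; $\{a,\dots,n\}\cup\{1,\dots,b-1\}$ if $a>b$), shifted orders $<_r$ ($r<_r\cdots<_rn<_r1<_r\cdots<_rr-1$), and shifted Gale order ($A\le_rB$ for $k$-subsets iff their $i$-th smallest elements under $<_r$ satisfy $a_i\le_rb_i$), choose $\mathbf{a}\in[n]^n$ with $u[k]\le_{a_k}v[k]$ for all $k$ (always possible); $\mathcal{T}_{u,v}:=\{F_\bullet:\mathrm{rank}_{[a_k,i)_c}(F_k)\le|u[k]\cap[a_k,i)_c|,\ \mathrm{rank}_{[i,a_k)_c}(F_k)\le|v[k]\cap[i,a_k)_c|\ \forall i,k\in[n]\}$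 (independent of $\mathbf{a}$). *)

theory Defs
  imports "HOL-Analysis.Analysis"
begin

text \<open>The ordered set $[n]$ is a finite linearly ordered type \<open>'n\<close>, so that \<open>CARD('n)\<close> is $n$ and
  the integer $k \in [n]$ is the cardinality of \<open>{..k}\<close>. Permutations are functions
  \<open>w\<close> with \<open>w permutes UNIV\<close>, with one-line notation \<open>w 1\<close>, \<open>w 2\<close>, \dots\<close>

section \<open>Cyclic intervals and shifted Gale orders\<close>

definition cyc_interval :: "'n::linorder \<Rightarrow> 'n \<Rightarrow> 'n set"
  where "cyc_interval a b = (if a \<le> b then {a..<b} else {a..} \<union> {..<b})"

definition shifted_le :: "'n::linorder \<Rightarrow> 'n \<Rightarrow> 'n \<Rightarrow> bool"
  where "shifted_le r x y \<longleftrightarrow>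
    (if r \<le> x \<longleftrightarrow> r \<le> y then x \<le> y else r \<le> x)"

text \<open>The elements of \<open>A\<close>, increasing with respect to \<open>shifted_le r\<close>.\<close>

definition shifted_list :: "'n::linorder \<Rightarrow> 'n set \<Rightarrow> 'n list"
  where "shifted_list r A =
    sorted_list_of_set (A \<inter> {r..}) @ sorted_list_of_set (A \<inter> {..<r})"

definition gale_le :: "'n::linorder \<Rightarrow> 'n set \<Rightarrow> 'n set \<Rightarrow> bool"
  where "gale_le r A B \<longleftrightarrow> list_all2 (shifted_le r) (shifted_list r A) (shifted_list r B)"

lemma shifted_list:
  fixes A :: "'n::{finite,linorder} set"
  shows "set (shifted_list r A) = A" "length (shifted_list r A) = card A"
    and "sorted_wrt (\<lambda>x y. x \<in> cyc_interval r y) (shifted_list r A)"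
proof -
  show s: "set (shifted_list r A) = A" by (auto simp: shifted_list_def)
  have "distinct (shifted_list r A)" by (auto simp: shifted_list_def)
  with s show "length (shifted_list r A) = card A" by (metis distinct_card)
  have *: "sorted_wrt (\<lambda>x y. x \<in> cyc_interval r y) (sorted_list_of_set X)"
    if "X \<subseteq> {r..} \<or> X \<subseteq> {..<r}" for X
    by (rule sorted_wrt_mono_rel[OF _ strict_sorted_list_of_set])
      (use that in \<open>auto simp: cyc_interval_def subset_iff\<close>)
  show "sorted_wrt (\<lambda>x y. x \<in> cyc_interval r y) (shifted_list r A)"
    unfolding shifted_list_def sorted_wrt_append
    by (intro conjI * ballI) (auto simp: cyc_interval_def)
qed

lemma cyc_interval_trans: "x \<in> cyc_interval r y \<Longrightarrow> y \<in> cyc_interval r z \<Longrightarrow> x \<in> cyc_interval r z"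
  by (auto simp: cyc_interval_def split: if_splits)

lemma not_shifted_le: "\<not> shifted_le r x y \<longleftrightarrow> y \<in> cyc_interval r x"
  by (auto simp: cyc_interval_def shifted_le_def split: if_splits)

lemma gale_leI:
  fixes A B :: "'n::{finite,linorder} set"
  assumes "card A = card B"
    and le: "\<And>x. card (B \<inter> cyc_interval r x) \<le> card (A \<inter> cyc_interval r x)"
  shows "gale_le r A B"
  unfolding gale_le_def list_all2_conv_all_nth
proof (intro conjI allI impI)
  let ?a = "shifted_list r A" and ?b = "shifted_list r B"
  show len: "length ?a = length ?b" using assms(1) by (simp add: shifted_list)
  fix i assume i: "i < length ?a"
  show "shifted_le r (?a ! i) (?b ! i)"
  proof (rule ccontr)
    assume "\<not> ?thesis"
    then have lt: "?b ! i \<in> cyc_interval r (?a ! i)" by (simp add: not_shifted_le)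
    have "A \<inter> cyc_interval r (?a ! i) \<subseteq> set (take i ?a)"
    proof
      fix x assume x: "x \<in> A \<inter> cyc_interval r (?a ! i)"
      then obtain j where j: "j < length ?a" "x = ?a ! j"
        by (metis IntD1 in_set_conv_nth shifted_list(1))
      have "\<not> i \<le> j"
      proof
        assume "i \<le> j"
        then have "i = j \<or> ?a ! i \<in> cyc_interval r (?a ! j)"
          using shifted_list(3)[of r A] j(1) by (auto simp: sorted_wrt_iff_nth_less order_le_less)
        with x j(2) have "x \<in> cyc_interval r x" using cyc_interval_trans[of x r "?a ! i" x] by auto
        then show False by (auto simp: cyc_interval_def split: if_splits)
      qed
      then show "x \<in> set (take i ?a)" using j by (auto simp: in_set_conv_nth)
    qed
    then have "card (A \<inter> cyc_interval r (?a ! i)) \<le> i"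
      by (metis List.finite_set card_length card_mono length_take min.cobounded2 order_trans)
    moreover have "set (take (Suc i) ?b) \<subseteq> B \<inter> cyc_interval r (?a ! i)"
    proof
      fix x assume "x \<in> set (take (Suc i) ?b)"
      then obtain j where j: "j \<le> i" "x = ?b ! j" "j < length ?b"
        by (auto simp: in_set_conv_nth less_Suc_eq_le)
      then have "j = i \<or> ?b ! j \<in> cyc_interval r (?b ! i)"
        using shifted_list(3)[of r B] i len by (auto simp: sorted_wrt_iff_nth_less order_le_less)
      with j lt cyc_interval_trans[of x r "?b ! i" "?a ! i"] show "x \<in> B \<inter> cyc_interval r (?a ! i)"
        by (metis IntI nth_mem shifted_list(1))
    qed
    moreover have "distinct ?b" by (auto simp: shifted_list_def)
    then have "card (set (take (Suc i) ?b)) = Suc i"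
      using i len by (simp add: distinct_card)
    ultimately show False
      using le[of "?a ! i"] card_mono[of "B \<inter> cyc_interval r (?a ! i)" "set (take (Suc i) ?b)"]
      by simp
  qed
qed

lemma ex_gale_le:
  fixes A B :: "'n::{finite,linorder} set"
  assumes "card A = card B"
  shows "\<exists>r. gale_le r A B"
proof -
  define d where "d x = int (card (A \<inter> {..<x})) - int (card (B \<inter> {..<x}))" for x
  obtain r where r: "\<And>x. d r \<le> d x"
    using arg_min_if_finite(2)[of UNIV d] by (metis UNIV_I UNIV_not_empty finite not_less)
  have "card (B \<inter> cyc_interval r x) \<le> card (A \<inter> cyc_interval r x)" for x
  proof (cases "r \<le> x")
    case True
    have "card (C \<inter> {..<x}) = card (C \<inter> {..<r}) + card (C \<inter> {r..<x})" for C :: "'n set"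
      using True by (subst card_Un_disjoint[symmetric]) (auto intro!: arg_cong[where f = card])
    with r[of x] True show ?thesis by (simp add: d_def cyc_interval_def)
  next
    case False
    have 1: "card C = card (C \<inter> {..<r}) + card (C \<inter> {r..})" for C :: "'n set"
      by (subst card_Un_disjoint[symmetric]) (auto intro!: arg_cong[where f = card])
    have 2: "card (C \<inter> ({r..} \<union> {..<x})) = card (C \<inter> {r..}) + card (C \<inter> {..<x})" for C :: "'n set"
      using False by (subst card_Un_disjoint[symmetric]) (auto intro!: arg_cong[where f = card])
    from r[of x] False assms 1[of A] 1[of B] show ?thesis by (simp add: d_def cyc_interval_def 2)
  qed
  with assms show ?thesis using gale_leI by blast
qed

definition initial_set :: "('n::linorder \<Rightarrow> 'n) \<Rightarrow> 'n \<Rightarrow> 'n set"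
  where "initial_set w k = w ` {..k}"

section \<open>Bruhat order on the symmetric group\<close>

definition inversions :: "('n::linorder \<Rightarrow> 'n) \<Rightarrow> ('n \<times> 'n) set"
  where "inversions w = {(i, j). i < j \<and> w j < w i}"

definition bruhat_step :: "('n::{finite,linorder} \<Rightarrow> 'n) \<Rightarrow> ('n \<Rightarrow> 'n) \<Rightarrow> bool"
  where "bruhat_step x y \<longleftrightarrow>
    (\<exists>i j. i \<noteq> j \<and> y = x \<circ> Transposition.transpose i j) \<and>
    card (inversions x) < card (inversions y)"

definition bruhat_le :: "('n::{finite,linorder} \<Rightarrow> 'n) \<Rightarrow> ('n \<Rightarrow> 'n) \<Rightarrow> bool"
  where "bruhat_le = bruhat_step\<^sup>*\<^sup>*"

section \<open>Flags\<close>

type_synonym 'n cvec = "(complex, 'n) vec"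
type_synonym 'n cmat = "((complex, 'n) vec, 'n) vec"
type_synonym 'n flag = "'n \<Rightarrow> 'n cvec set"

definition Grassmannian :: "'n::{finite,linorder} \<Rightarrow> 'n cvec set set"
  where "Grassmannian k = {V. vec.subspace V \<and> vec.dim V = card {..k}}"

definition Fl :: "'n::{finite,linorder} flag set"
  where "Fl = {F. (\<forall>k. F k \<in> Grassmannian k) \<and> (\<forall>j k. j \<le> k \<longrightarrow> F j \<subseteq> F k)}"

definition flag_of :: "'n cmat \<Rightarrow> 'n::{finite,linorder} flag"
  where "flag_of M = (\<lambda>k. vec.span {column j M | j. j \<le> k})"

definition proj_Gr :: "'n::{finite,linorder} \<Rightarrow> 'n flag \<Rightarrow> 'n cvec set"
  where "proj_Gr k F = F k"

text \<open>The submatrix with rows in \<open>S\<close> and columns in \<open>K\<close>, padded with zeros (which does not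
  affect its rank).\<close>

definition submat :: "'n cmat \<Rightarrow> 'n::finite set \<Rightarrow> 'n set \<Rightarrow> 'n cmat"
  where "submat M S K = (\<chi> i j. if i \<in> S \<and> j \<in> K then M $ i $ j else 0)"

lemma rank_le_dim_columns:
  fixes A :: "'n::finite cmat"
  shows "vec.dim (rows A) \<le> vec.dim (columns A)"
proof -
  obtain B where B: "B \<subseteq> columns A" "vec.independent B" "columns A \<subseteq> vec.span B"
      "card B = vec.dim (columns A)"
    using vec.basis_exists by blast
  have fB: "finite B" using B(2) vec.independent_bound_general by blast
  have "\<exists>r. column j A = (\<Sum>b\<in>B. r b *s b)" for j
    using B(3) vec.span_finite[OF fB] by (force simp: columns_def)
  then obtain r where r: "\<And>j. column j A = (\<Sum>b\<in>B. r j b *s b)" by metis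
  have row: "row i A = (\<Sum>b\<in>B. b $ i *s (\<chi> j. r j b))" for i
  proof -
    have "A $ i $ j = (\<Sum>b\<in>B. b $ i * r j b)" for j
      using arg_cong[OF r[of j], of "\<lambda>x. x $ i"] by (simp add: column_def mult.commute)
    then show ?thesis by (simp add: vec_eq_iff row_def)
  qed
  have "row i A \<in> vec.span ((\<lambda>b. \<chi> j. r j b) ` B)" for i
    unfolding row by (intro vec.span_sum vec.span_scale vec.span_base imageI)
  then have "rows A \<subseteq> vec.span ((\<lambda>b. \<chi> j. r j b) ` B)"
    unfolding rows_def by blast
  then have "vec.dim (rows A) \<le> card ((\<lambda>b. \<chi> j. r j b) ` B)"
    using fB by (intro vec.dim_le_card) auto
  also have "\<dots> \<le> card B" using fB by (rule card_image_le)
  finally show ?thesis using B(4) by simp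
qed

lemma rank_eq_dim_columns:
  fixes A :: "'n::finite cmat"
  shows "rank A = vec.dim (columns A)"
  using rank_le_dim_columns[of A] rank_le_dim_columns[of "transpose A"]
  by (simp add: row_rank_def_gen rows_transpose columns_transpose)

lemma rank_submat:
  fixes M :: "'n::{finite,linorder} cmat"
  shows "rank (submat M S {..k}) =
    vec.dim ((\<lambda>x. \<chi> i. if i \<in> S then x $ i else 0) ` flag_of M k)"
proof -
  let ?p = "\<lambda>x :: 'n cvec. \<chi> i. if i \<in> S then x $ i else 0"
  have lin: "Vector_Spaces.linear (*s) (*s) ?p"
    by unfold_locales (auto simp: vec_eq_iff algebra_simps)
  have "?p ` flag_of M k = vec.span (?p ` {column j M | j. j \<le> k})"
    unfolding flag_of_def by (rule vec.linear_span_image[OF lin, symmetric])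
  moreover have "vec.span (columns (submat M S {..k})) = vec.span (?p ` {column j M | j. j \<le> k})"
  proof -
    have c: "column j (submat M S {..k}) = (if j \<le> k then ?p (column j M) else 0)" for j
      by (auto simp: column_def submat_def vec_eq_iff)
    have "columns (submat M S {..k}) - {0} = ?p ` {column j M | j. j \<le> k} - {0}"
    proof -
      define q where "q j = ?p (column j M)" for j
      have "columns (submat M S {..k}) = range (\<lambda>j. if j \<le> k then q j else 0)"
        unfolding columns_def c q_def by auto
      moreover have "?p ` {column j M | j. j \<le> k} = q ` {..k}"
        unfolding q_def by auto
      ultimately show ?thesis by (simp only:) auto
    qed
    then show ?thesis using vec.span_delete_0[of "columns (submat M S {..k})"]
        vec.span_delete_0[of "?p ` {column j M | j. j \<le> k}"] by argo
  qed
  ultimately show ?thesis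
    using vec.dim_span[of "columns (submat M S {..k})"]
      vec.dim_span[of "?p ` {column j M | j. j \<le> k}"]
    by (simp add: rank_eq_dim_columns)
qed

section \<open>Tilted Richardson varieties\<close>

definition admissible_tilt ::
    "('n::{finite,linorder} \<Rightarrow> 'n) \<Rightarrow> ('n \<Rightarrow> 'n) \<Rightarrow> ('n \<Rightarrow> 'n) \<Rightarrow> bool"
  where "admissible_tilt u v a \<longleftrightarrow> (\<forall>k. gale_le (a k) (initial_set u k) (initial_set v k))"

lemma ex_admissible_tilt:
  assumes "u permutes UNIV" "v permutes UNIV"
  shows "\<exists>a. admissible_tilt u v a"
proof -
  have "card (initial_set u k) = card (initial_set v k)" for k
    using assms by (simp add: initial_set_def card_image permutes_inj_on)
  then show ?thesis unfolding admissible_tilt_def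
    by (intro choice allI ex_gale_le)
qed

text \<open>The ranks below depend only on the flag and not on the representing matrix \<open>M\<close>; see
  \<open>rank_submat\<close>.\<close>

definition tilted_richardson ::
    "('n::{finite,linorder} \<Rightarrow> 'n) \<Rightarrow> ('n \<Rightarrow> 'n) \<Rightarrow> ('n \<Rightarrow> 'n) \<Rightarrow> 'n flag set"
  where "tilted_richardson a u v = {F \<in> Fl. \<exists>M. flag_of M = F \<and> (\<forall>i k.
      rank (submat M (cyc_interval (a k) i) {..k}) \<le> card (initial_set u k \<inter> cyc_interval (a k) i) \<and>
      rank (submat M (cyc_interval i (a k)) {..k}) \<le> card (initial_set v k \<inter> cyc_interval i (a k)))}"

section \<open>Richardson varieties and positroid varieties\<close>

text \<open>Polynomial functions in the matrix entries.\<close>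

inductive_set poly_fun :: "('n::finite cmat \<Rightarrow> complex) set"
  where
    const: "(\<lambda>M. c) \<in> poly_fun"
  | entry: "(\<lambda>M. M $ i $ j) \<in> poly_fun"
  | add: "p \<in> poly_fun \<Longrightarrow> q \<in> poly_fun \<Longrightarrow> (\<lambda>M. p M + q M) \<in> poly_fun"
  | mult: "p \<in> poly_fun \<Longrightarrow> q \<in> poly_fun \<Longrightarrow> (\<lambda>M. p M * q M) \<in> poly_fun"

text \<open>The flag variety carries the quotient Zariski topology of $GL_n/B$: a set of flags is closed
  iff its preimage in $GL_n$ is the zero locus of polynomials.\<close>

definition zariski_closed :: "'n::{finite,linorder} flag set \<Rightarrow> bool"
  where "zariski_closed Z \<longleftrightarrow> Z \<subseteq> Fl \<and>
    (\<exists>P \<subseteq> poly_fun. \<forall>M. invertible M \<longrightarrow> (flag_of M \<in> Z \<longleftrightarrow> (\<forall>p\<in>P. p M = 0)))"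

definition zariski_closure :: "'n::{finite,linorder} flag set \<Rightarrow> 'n flag set"
  where "zariski_closure C = \<Inter> {Z. zariski_closed Z \<and> C \<subseteq> Z}"

definition borel_upper :: "'n::{finite,linorder} cmat set"
  where "borel_upper = {M. invertible M \<and> (\<forall>i j. j < i \<longrightarrow> M $ i $ j = 0)}"

definition borel_lower :: "'n::{finite,linorder} cmat set"
  where "borel_lower = {M. invertible M \<and> (\<forall>i j. i < j \<longrightarrow> M $ i $ j = 0)}"

text \<open>Column \<open>j\<close> of the permutation matrix of \<open>w\<close> is the basis vector with index \<open>w j\<close>.\<close>

definition perm_matrix :: "('n::finite \<Rightarrow> 'n) \<Rightarrow> 'n cmat"
  where "perm_matrix w = (\<chi> i j. if i = w j then 1 else 0)"

definition schubert_cell :: "('n::{finite,linorder} \<Rightarrow> 'n) \<Rightarrow> 'n flag set"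
  where "schubert_cell w =
    {flag_of (b ** perm_matrix w ** c) | b c. b \<in> borel_upper \<and> c \<in> borel_upper}"

definition opposite_schubert_cell :: "('n::{finite,linorder} \<Rightarrow> 'n) \<Rightarrow> 'n flag set"
  where "opposite_schubert_cell w =
    {flag_of (b ** perm_matrix w ** c) | b c. b \<in> borel_lower \<and> c \<in> borel_upper}"

definition richardson ::
    "('n::{finite,linorder} \<Rightarrow> 'n) \<Rightarrow> ('n \<Rightarrow> 'n) \<Rightarrow> 'n flag set"
  where "richardson x y =
    zariski_closure (schubert_cell y) \<inter> zariski_closure (opposite_schubert_cell x)"

text \<open>Positroid varieties of Knutson, Lam and Speyer, in their description as projected Richardson
  varieties.\<close>

definition positroid_variety ::
    "'n::{finite,linorder} \<Rightarrow> 'n cvec set set \<Rightarrow> bool"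
  where "positroid_variety k X \<longleftrightarrow>
    (\<exists>x y. x permutes UNIV \<and> y permutes UNIV \<and> bruhat_le x y \<and> X = proj_Gr k ` richardson x y)"

end

(*
At a fixed level the condition does not depend on the choice of the tilt, and two consecutive levels
always admit a common tilt. If r is a tilt at the levels j - 1 and j + 1 and it is not the case that u has
a descent and v an ascent (with respect to the order shifted by r) at position j, then the flags obtained
by forgetting level j are described by the conditions at the other levels alone. Hence u or v or both may be
multiplied on the right by s_j for j \<noteq> k, without changing the image at level k, as long as the
excluded configuration is avoided before and after. Sorting v in this way below and above k makes all tilts
equal. A common tilt is then lowered to its predecessor c: the only obstruction is that c lies in v[k] but
not in u[k]; after sorting, c = v_k = u_{k+1}, the condition at level k is redundant both for (u, v) with
the old tilt and for (u s_k, v s_k) with tilt c, so that the two tilted varieties coincide. With the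
smallest element of [n] as the only tilt, the variety is an ordinary Richardson variety.

That the closure of a Schubert cell is cut out by rank conditions is proved by induction on the length as
in the Bott-Samelson resolution: a flag in the rank variety of w is moved at one level into the rank
variety of w s_j, and the set of flags all of whose modifications at that level lie in a closed set Z is
again closed.
*)

theory Submission
  imports Defs
begin

section \<open>Coordinate subspaces\<close>

text \<open>The rank bounds are turned into lower bounds for the dimensions of intersections with
  coordinate subspaces; these dimensions are supermodular in the set of coordinates and grow by at
  most one between consecutive levels. A tilt is a maximum point of one integer function, the number
  of elements of v[k] below i minus that of u[k], which changes little from level to level. The
  obstacle is a simultaneous descent of u and ascent of v: the bounds at level j come in two chains,
  the intervals starting at r, governed by v, and those ending at r, governed by u. Either chain can
  be met by a suitable F_j between its neighbours, but one choice need not serve both. If u ascends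
  or v descends at j, one chain is implied by the neighbouring levels and the choice is left for the
  other. Sorting v equalizes tilts because an increasing v fills [r, s) as early as possible, while
  the tilt r forbids u to have fewer elements there; if the counts agree at both ends of a range of
  levels, they agree in between, and s is a tilt throughout.\<close>

definition coord :: "'n::finite set \<Rightarrow> 'n cvec set"
  where "coord T = {x. \<forall>i. i \<notin> T \<longrightarrow> x $ i = 0}"

definition cdim :: "'n::finite cvec set \<Rightarrow> 'n set \<Rightarrow> nat"
  where "cdim V T = vec.dim (V \<inter> coord T)"

lemma subspace_coord: "vec.subspace (coord T)"
  by (auto simp: vec.subspace_def coord_def)

lemma dim_coord: "vec.dim (coord T) = card T"
  unfolding coord_def by (rule dim_substandard_cart)

lemma coord_mono: "S \<subseteq> T \<Longrightarrow> coord S \<subseteq> coord T"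
  by (auto simp: coord_def)

lemma coord_Int: "coord S \<inter> coord T = coord (S \<inter> T)"
  by (auto simp: coord_def)

lemma coord_UNIV: "coord UNIV = UNIV"
  by (auto simp: coord_def)

lemma coord_empty: "coord {} = {0}"
  by (auto simp: coord_def vec_eq_iff)

lemma cdim_empty: "cdim V {} = 0"
  unfolding cdim_def coord_empty by (simp add: vec.dim_eq_0)

lemma cdim_UNIV: "cdim V UNIV = vec.dim V"
  by (simp add: cdim_def coord_UNIV)

lemma cdim_mono: "U \<subseteq> V \<Longrightarrow> cdim U T \<le> cdim V T"
  unfolding cdim_def by (rule vec.dim_subset) auto

text \<open>The modular law for \<open>V \<inter> coord S\<close> and
  \<open>V \<inter> coord T\<close>: their sum lies in
  \<open>V \<inter> coord (S \<union> T)\<close>, and they meet in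
  \<open>V \<inter> coord (S \<inter> T)\<close>.\<close>

lemma cdim_supermodular:
  assumes "vec.subspace V"
  shows "cdim V S + cdim V T \<le> cdim V (S \<union> T) + cdim V (S \<inter> T)"
proof -
  let ?A = "V \<inter> coord S" and ?B = "V \<inter> coord T"
  have sub: "vec.subspace ?A" "vec.subspace ?B"
    using assms subspace_coord by (auto intro: vec.subspace_inter)
  have "{x + y |x y. x \<in> ?A \<and> y \<in> ?B} \<subseteq> V \<inter> coord (S \<union> T)"
    using assms by (auto simp: coord_def intro: vec.subspace_add)
  then have "vec.dim {x + y |x y. x \<in> ?A \<and> y \<in> ?B} \<le> cdim V (S \<union> T)"
    unfolding cdim_def by (rule vec.dim_subset)
  moreover have "?A \<inter> ?B = V \<inter> coord (S \<inter> T)"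
    by (auto simp: coord_Int[symmetric])
  ultimately show ?thesis
    using vec.dim_sums_Int[OF sub] by (simp add: cdim_def)
qed

lemma cdim_disjoint_Un:
  assumes "vec.subspace V" "S \<inter> T = {}"
  shows "cdim V S + cdim V T \<le> cdim V (S \<union> T)"
  using cdim_supermodular[OF assms(1), of S T] assms(2) by (simp add: cdim_empty)

lemma dim_sums_le:
  assumes "vec.subspace S" "vec.subspace T" "S \<subseteq> W" "T \<subseteq> W" "vec.subspace (W :: 'n::finite cvec set)"
  shows "vec.dim S + vec.dim T \<le> vec.dim W + vec.dim (S \<inter> T)"
proof -
  have "{x + y |x y. x \<in> S \<and> y \<in> T} \<subseteq> W"
    using assms by (auto intro: vec.subspace_add)
  then have "vec.dim {x + y |x y. x \<in> S \<and> y \<in> T} \<le> vec.dim W" by (rule vec.dim_subset)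
  then show ?thesis using vec.dim_sums_Int[OF assms(1,2)] by linarith
qed

text \<open>A hyperplane of W meets every subspace of W in codimension at most one.\<close>

lemma cdim_hyperplane:
  assumes "vec.subspace V" "vec.subspace W" "V \<subseteq> W" "vec.dim W = Suc (vec.dim V)"
  shows "cdim W T \<le> Suc (cdim V T)"
proof -
  have "vec.dim (W \<inter> coord T) + vec.dim V \<le> vec.dim W + vec.dim ((W \<inter> coord T) \<inter> V)"
    using assms subspace_coord by (intro dim_sums_le) (auto intro: vec.subspace_inter)
  moreover have "(W \<inter> coord T) \<inter> V = V \<inter> coord T" using assms(3) by auto
  ultimately show ?thesis using assms(4) by (simp add: cdim_def)
qed

text \<open>Rank-nullity for the coordinate projection to S, whose kernel on V is
  \<open>V \<inter> coord (- S)\<close>. Both V and its projection have the same sum with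
  \<open>coord (- S)\<close>, and the projection meets \<open>coord (- S)\<close> only in 0, so
  comparing the two dimension formulas gives the claim.\<close>

lemma rank_plus_cdim:
  fixes V :: "'n::finite cvec set"
  assumes V: "vec.subspace V"
  shows "vec.dim ((\<lambda>x. \<chi> i. if i \<in> S then x $ i else 0) ` V) + cdim V (- S) = vec.dim V"
proof -
  let ?p = "\<lambda>x :: 'n cvec. \<chi> i. if i \<in> S then x $ i else 0"
  have lin: "Vector_Spaces.linear (*s) (*s) ?p"
    by unfold_locales (auto simp: vec_eq_iff algebra_simps)
  have P: "vec.subspace (?p ` V)" by (rule vec.linear_subspace_image[OF lin V])
  let ?C = "coord (- S)"
  have c: "x - ?p x \<in> ?C" for x by (auto simp: coord_def)
  have sums: "{x + y |x y. x \<in> V \<and> y \<in> ?C} = {x + y |x y. x \<in> ?p ` V \<and> y \<in> ?C}"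
  proof (intro set_eqI iffI; clarsimp)
    fix x y assume "x \<in> V" "y \<in> ?C"
    then show "\<exists>x' y'. x + y = x' + y' \<and> x' \<in> ?p ` V \<and> y' \<in> ?C"
      using c[of x] vec.subspace_add[OF subspace_coord, of "x - ?p x" "- S" y]
      by (intro exI[of _ "?p x"] exI[of _ "x - ?p x + y"]) (auto simp: algebra_simps)
  next
    fix x y assume "x \<in> V" "y \<in> ?C"
    then show "\<exists>x' y'. ?p x + y = x' + y' \<and> x' \<in> V \<and> y' \<in> ?C"
      using c[of x] vec.subspace_diff[OF subspace_coord, of y "- S" "x - ?p x"]
      by (intro exI[of _ x] exI[of _ "y - (x - ?p x)"]) (auto simp: algebra_simps)
  qed
  have "?p ` V \<inter> ?C \<subseteq> {0}"
    by (auto simp: coord_def vec_eq_iff)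
  then have "vec.dim (?p ` V \<inter> ?C) = 0" by (simp add: vec.dim_eq_0)
  then show ?thesis
    using vec.dim_sums_Int[OF V subspace_coord, of "- S", unfolded sums]
      vec.dim_sums_Int[OF P subspace_coord, of "- S"] unfolding cdim_def by linarith
qed

text \<open>The new subspace is \<open>U\<close> extended by a vector of \<open>W - U\<close> whose support lies in the smallest
  possible member of the chain.\<close>

lemma ex_intermediate_subspace:
  fixes U W :: "'n::finite cvec set"
  assumes U: "vec.subspace U" and W: "vec.subspace W" and UW: "U \<subseteq> W"
    and dW: "vec.dim W = Suc (Suc (vec.dim U))"
    and chain: "\<And>S T. S \<in> C \<Longrightarrow> T \<in> C \<Longrightarrow> S \<subseteq> T \<or> T \<subseteq> S"
  obtains V where "vec.subspace V" "U \<subseteq> V" "V \<subseteq> W" "vec.dim V = Suc (vec.dim U)"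
    "\<And>T. T \<in> C \<Longrightarrow> Suc (cdim U T) \<le> cdim V T \<or> cdim W T \<le> cdim V T"
proof -
  \<comment> \<open>For the members of the chain outside of D the second alternative is automatic,
    since \<open>W \<inter> coord T\<close> already lies in U. The vector x is taken from the
    smallest member of D and hence serves all of D.\<close>
  define D where "D = {T \<in> C. \<not> W \<inter> coord T \<subseteq> U}"
  obtain x where x: "x \<in> W" "x \<notin> U" "\<And>T. T \<in> D \<Longrightarrow> x \<in> coord T"
  proof (cases "D = {}")
    case True
    have "\<not> W \<subseteq> U" using dW UW by auto
    with True that show thesis by auto
  next
    case False
    then obtain T where T: "T \<in> D" "\<And>S. S \<in> D \<Longrightarrow> \<not> S \<subset> T"
      using finite_has_minimal[of D] by (metis finite psubset_eq)
    then obtain x where "x \<in> W" "x \<in> coord T" "x \<notin> U" by (auto simp: D_def)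
    moreover have "x \<in> coord S" if "S \<in> D" for S
    proof -
      have "T \<subseteq> S" using chain[of S T] that T by (auto simp: D_def)
      then show ?thesis using \<open>x \<in> coord T\<close> coord_mono by blast
    qed
    ultimately show thesis using that by blast
  qed
  let ?V = "vec.span (insert x U)"
  have sU: "vec.span U = U" using U by simp
  have UV: "U \<subseteq> ?V" by (meson order_trans subset_insertI vec.span_superset)
  have VW: "?V \<subseteq> W" using UW x W by (simp add: vec.span_minimal)
  have "Suc (cdim U T) \<le> cdim ?V T \<or> cdim W T \<le> cdim ?V T" if "T \<in> C" for T
  proof (cases "T \<in> D")
    case True
    let ?I = "U \<inter> coord T"
    have "vec.span ?I \<subseteq> U" using U by (intro vec.span_minimal) auto
    then have "vec.dim (insert x ?I) = Suc (vec.dim ?I)"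
      using x(2) by (auto simp: vec.dim_insert)
    moreover have "insert x ?I \<subseteq> ?V \<inter> coord T"
      using UV x(3)[OF True] by (auto intro: vec.span_base)
    ultimately show ?thesis
      using vec.dim_subset[of "insert x ?I" "?V \<inter> coord T"] by (simp add: cdim_def)
  next
    case False
    then have "W \<inter> coord T \<subseteq> ?V \<inter> coord T" using that UV by (auto simp: D_def)
    then show ?thesis unfolding cdim_def using vec.dim_subset by blast
  qed
  moreover have "vec.dim ?V = Suc (vec.dim U)"
    using x(2) unfolding vec.dim_span vec.dim_insert sU by simp
  ultimately show thesis using that[of ?V] UV VW by simp
qed

section \<open>Tilts\<close>

definition pot :: "'n::{finite,linorder} set \<Rightarrow> 'n set \<Rightarrow> 'n \<Rightarrow> int"
  where "pot A B i = int (card (B \<inter> {..<i})) - int (card (A \<inter> {..<i}))"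

text \<open>For sets of equal size this is the shifted Gale order \<open>gale_le r A B\<close> in
  counting form: each initial segment of the order shifted by r has at least as many elements in A
  as in B. As a maximum condition it allows tilts at different places to be compared through a
  single function.\<close>

definition tilt :: "'n::{finite,linorder} \<Rightarrow> 'n set \<Rightarrow> 'n set \<Rightarrow> bool"
  where "tilt r A B \<longleftrightarrow> (\<forall>i. pot A B i \<le> pot A B r)"

lemma cyc_interval_Un:
  assumes "s \<in> cyc_interval r i \<or> s = i"
  shows "cyc_interval r i = cyc_interval r s \<union> cyc_interval s i"
    and "cyc_interval r s \<inter> cyc_interval s i = {}"
  using assms by (auto simp: cyc_interval_def split: if_splits)

lemma cyc_interval_compl: "r \<noteq> s \<Longrightarrow> - cyc_interval r s = cyc_interval s r"
  by (auto simp: cyc_interval_def split: if_splits)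

lemma cyc_interval_self [simp]: "cyc_interval r r = {}"
  by (simp add: cyc_interval_def)

lemma cyc_interval_total: "x = y \<or> x \<in> cyc_interval r y \<or> y \<in> cyc_interval r x"
  by (auto simp: cyc_interval_def)

lemma cyc_interval_chain:
  "cyc_interval r x \<subseteq> cyc_interval r y \<or> cyc_interval r y \<subseteq> cyc_interval r x"
  using cyc_interval_total[of x y r] cyc_interval_trans[of _ r] by blast

lemma cyc_interval_not_self: "x \<notin> cyc_interval r x"
  by (auto simp: cyc_interval_def)

lemma card_split: "card (C :: 'n::finite set) = card (C \<inter> S) + card (C - S)"
  by (metis Diff_disjoint Int_Diff_Un Int_Diff_disjoint card_Un_disjoint finite)

lemma card_Int_disjoint_Un:
  assumes "S \<inter> T = {}"
  shows "card (C \<inter> (S \<union> T)) = card (C \<inter> S) + card (C \<inter> T :: 'n::finite set)"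
  unfolding Int_Un_distrib using assms by (intro card_Un_disjoint) auto

text \<open>For an interval that wraps around, the count is taken over the complement {i..<r};
  equality of the cardinalities makes the total of the two differences zero.\<close>

lemma pot_cyc_interval:
  assumes "card A = card B"
  shows "int (card (B \<inter> cyc_interval r i)) - int (card (A \<inter> cyc_interval r i)) = pot A B i - pot A B r"
proof -
  have le: "card (C \<inter> {..<y}) = card (C \<inter> {..<x}) + card (C \<inter> {x..<y})" if "x \<le> y" for x y :: 'a and C
    using that by (subst card_Int_disjoint_Un[symmetric]) (auto intro!: arg_cong[where f = card])
  show ?thesis
  proof (cases "r \<le> i")
    case True
    with le[OF True, of A] le[OF True, of B] show ?thesis
      by (simp add: pot_def cyc_interval_def)
  next
    case False
    then have "i \<le> r" and c: "cyc_interval r i = - {i..<r}" by (auto simp: cyc_interval_def)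
    have "card (C \<inter> cyc_interval r i) + card (C \<inter> {i..<r}) = card C" for C
      using card_split[of C "{i..<r}"] by (simp add: c Diff_eq)
    from this[of A] this[of B] show ?thesis
      using le[OF \<open>i \<le> r\<close>, of A] le[OF \<open>i \<le> r\<close>, of B] assms by (simp add: pot_def)
  qed
qed

lemma tilt_iff:
  assumes "card A = card B"
  shows "tilt r A B \<longleftrightarrow> (\<forall>i. card (B \<inter> cyc_interval r i) \<le> card (A \<inter> cyc_interval r i))"
proof -
  have "pot A B i \<le> pot A B r \<longleftrightarrow> card (B \<inter> cyc_interval r i) \<le> card (A \<inter> cyc_interval r i)" for i
    using pot_cyc_interval[OF assms, of r i] by linarith
  then show ?thesis by (simp add: tilt_def)
qed

lemma tilt_eq_pot: "tilt r A B \<Longrightarrow> tilt s A B \<longleftrightarrow> pot A B s = pot A B r"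
  unfolding tilt_def by (metis order_antisym)

text \<open>Maximum points of \<open>pot\<close> share one value, so a second tilt is recognized by
  equal counts on the interval between the two.\<close>

lemma tilt_eq_card:
  assumes "card A = card B" "tilt r A B"
  shows "tilt s A B \<longleftrightarrow> card (B \<inter> cyc_interval r s) = card (A \<inter> cyc_interval r s)"
  using tilt_eq_pot[OF assms(2), of s] pot_cyc_interval[OF assms(1), of r s] by linarith

text \<open>If x precedes y in the shifted order, then an initial segment containing y contains x;
  summing over the paired entries of the two lists compares the counts.\<close>

lemma gale_le_imp_tilt:
  fixes A B :: "'n::{finite,linorder} set"
  assumes "card A = card B" "gale_le r A B"
  shows "tilt r A B"
proof -
  have "card (B \<inter> cyc_interval r i) \<le> card (A \<inter> cyc_interval r i)" for i
  proof -
    have "list_all2 (shifted_le r) xs ys \<Longrightarrow>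
        length (filter (\<lambda>x. x \<in> cyc_interval r i) ys) \<le> length (filter (\<lambda>x. x \<in> cyc_interval r i) xs)" for xs ys
    proof (induction rule: list_all2_induct)
      case (Cons x xs y ys)
      have "y \<in> cyc_interval r i \<Longrightarrow> x \<in> cyc_interval r i"
        using Cons(1) by (auto simp: shifted_le_def cyc_interval_def split: if_splits)
      with Cons show ?case by auto
    qed simp
    moreover have "length (filter (\<lambda>x. x \<in> cyc_interval r i) (shifted_list r C)) = card (C \<inter> cyc_interval r i)" for C
    proof -
      have "distinct (shifted_list r C)" by (auto simp: shifted_list_def)
      then have "length (filter (\<lambda>x. x \<in> cyc_interval r i) (shifted_list r C))
          = card (set (filter (\<lambda>x. x \<in> cyc_interval r i) (shifted_list r C)))"
        by (metis distinct_card distinct_filter)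
      also have "set (filter (\<lambda>x. x \<in> cyc_interval r i) (shifted_list r C)) = C \<inter> cyc_interval r i"
        by (auto simp: shifted_list(1))
      finally show ?thesis .
    qed
    ultimately show ?thesis using assms(2) by (metis gale_le_def)
  qed
  then show ?thesis using tilt_iff[OF assms(1)] by blast
qed

lemma ex_tilt: "\<exists>r. tilt r A B"
proof -
  let ?r = "arg_min_on (\<lambda>i. - pot A B i) UNIV"
  have "\<not> - pot A B i < - pot A B ?r" for i
    using arg_min_if_finite(2)[of UNIV "\<lambda>i. - pot A B i"] by auto
  then show ?thesis unfolding tilt_def by (metis neg_less_iff_less not_le)
qed

lemma pot_insert:
  assumes "a \<notin> A" "b \<notin> B"
  shows "pot (insert a A) (insert b B) i =
    pot A B i + (if b < i then 1 else 0) - (if a < i then 1 else 0)"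
proof -
  have "card (insert c C \<inter> {..<i}) = card (C \<inter> {..<i}) + (if c < i then 1 else 0)" if "c \<notin> C" for c C
    using that by (simp add: Int_insert_left)
  with assms show ?thesis by (simp add: pot_def)
qed

text \<open>The change of \<open>pot\<close> is a difference of two step functions and takes values
  in {0, 1} or in {-1, 0}. If r were strictly better than s for the old function and s strictly
  better than r for the new one, the changes at s and r would differ by at least 2.\<close>

lemma tilt_adjacent:
  assumes AB: "card A = card B" "a \<notin> A" "b \<notin> B"
    and r: "tilt r A B" and s: "tilt s (insert a A) (insert b B)"
  shows "tilt r (insert a A) (insert b B) \<or> tilt s A B"
proof -
  let ?p = "pot A B" and ?q = "pot (insert a A) (insert b B)"
  have "\<bar>(?q i - ?p i) - (?q j - ?p j)\<bar> \<le> 1" for i j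
    using AB by (auto simp: pot_insert)
  from this[of r s] have "?q s = ?q r \<or> ?p s = ?p r"
    using r s unfolding tilt_def by (smt (verit))
  then show ?thesis using r s unfolding tilt_def by metis
qed

text \<open>The rank bounds in terms of intersections with coordinate subspaces: a bound
  $\mathrm{rank}_S(V) \le |A \cap S|$ says that \<open>card (A \<inter> - S) \<le> cdim V (- S)\<close>, and the complement of
  \<open>cyc_interval r i\<close> is \<open>cyc_interval i r\<close>.\<close>

definition cond :: "'n::{finite,linorder} \<Rightarrow> 'n set \<Rightarrow> 'n set \<Rightarrow> 'n cvec set \<Rightarrow> bool"
  where "cond r A B V \<longleftrightarrow> (\<forall>i. card (B \<inter> cyc_interval r i) \<le> cdim V (cyc_interval r i) \<and>
    card (A \<inter> cyc_interval i r) \<le> cdim V (cyc_interval i r))"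

text \<open>Let P = [r, s) and Q = [s, r). As r and s are both tilts, A and B have equally many
  elements in P and equally many in Q. An interval with end point s arises from one with end point r
  either by adding P or Q, where superadditivity suffices, or by removing P or Q, where
  supermodularity is applied to two sets that cover all coordinates.\<close>

lemma cond_tilt_independent:
  assumes V: "vec.subspace V" "vec.dim V = card A" and AB: "card A = card B"
    and r: "tilt r A B" and s: "tilt s A B" and c: "cond r A B V"
  shows "cond s A B V"
proof (cases "r = s")
  case False
  let ?P = "cyc_interval r s" and ?Q = "cyc_interval s r"
  have PQ: "?P \<inter> ?Q = {}" "?P \<union> ?Q = UNIV"
    using cyc_interval_compl[OF False] by auto
  have P: "card (B \<inter> ?P) = card (A \<inter> ?P)" using tilt_eq_card[OF AB r] s by simp
  have split: "card C = card (C \<inter> ?P) + card (C \<inter> ?Q)" for C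
    using card_Int_disjoint_Un[OF PQ(1), of C] PQ(2) by simp
  have Q: "card (B \<inter> ?Q) = card (A \<inter> ?Q)" using P split[of A] split[of B] AB by simp
  have cP: "card (B \<inter> ?P) \<le> cdim V ?P" and cQ: "card (A \<inter> ?Q) \<le> cdim V ?Q"
    using c by (auto simp: cond_def)
  have sup: "cdim V S + cdim V T \<le> card A + cdim V (S \<inter> T)" if "S \<union> T = UNIV" for S T
    using cdim_supermodular[OF V(1), of S T] that V(2) by (simp add: cdim_UNIV)
  have B: "card (B \<inter> cyc_interval s i) \<le> cdim V (cyc_interval s i)" for i
  proof (cases "s \<in> cyc_interval r i \<or> s = i")
    case True
    note u = cyc_interval_Un[OF True]
    have "cyc_interval r i \<inter> ?Q = cyc_interval s i" "cyc_interval r i \<union> ?Q = UNIV"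
      using u PQ True by (auto simp: cyc_interval_def split: if_splits)
    then have "cdim V (cyc_interval r i) + cdim V ?Q \<le> card A + cdim V (cyc_interval s i)"
      using sup[of "cyc_interval r i" ?Q] by simp
    moreover have "card (B \<inter> cyc_interval r i) \<le> cdim V (cyc_interval r i)"
      using c by (auto simp: cond_def)
    moreover have "card (B \<inter> cyc_interval r i) = card (B \<inter> ?P) + card (B \<inter> cyc_interval s i)"
      using card_Int_disjoint_Un[OF u(2), of B] u(1) by simp
    ultimately show ?thesis using cQ split[of A] P by linarith
  next
    case F: False
    then have "r \<in> cyc_interval s i \<or> r = i"
      using cyc_interval_total[of s i r] False by (auto simp: cyc_interval_def split: if_splits)
    note u = cyc_interval_Un[OF this]
    have "card (B \<inter> cyc_interval s i) = card (B \<inter> ?Q) + card (B \<inter> cyc_interval r i)"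
      using card_Int_disjoint_Un[OF u(2), of B] u(1) by simp
    moreover have "card (B \<inter> cyc_interval r i) \<le> cdim V (cyc_interval r i)"
      using c by (auto simp: cond_def)
    ultimately show ?thesis
      using cQ Q cdim_disjoint_Un[OF V(1) u(2), folded u(1)] by linarith
  qed
  have A: "card (A \<inter> cyc_interval i s) \<le> cdim V (cyc_interval i s)" for i
  proof (cases "s \<in> cyc_interval i r")
    case True
    note u = cyc_interval_Un[of s i r]
    have "cyc_interval i r \<inter> ?P = cyc_interval i s" "cyc_interval i r \<union> ?P = UNIV"
      using True False by (auto simp: cyc_interval_def split: if_splits)
    then have "cdim V (cyc_interval i r) + cdim V ?P \<le> card A + cdim V (cyc_interval i s)"
      using sup[of "cyc_interval i r" ?P] by simp
    moreover have "card (A \<inter> cyc_interval i r) \<le> cdim V (cyc_interval i r)"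
      using c by (auto simp: cond_def)
    moreover have "card (A \<inter> cyc_interval i r) = card (A \<inter> ?Q) + card (A \<inter> cyc_interval i s)"
      using card_Int_disjoint_Un[OF u(2), of A] u(1) True by simp
    ultimately show ?thesis using cP split[of A] P by linarith
  next
    case F: False
    show ?thesis
    proof (cases "i = s")
      case False
      then have "r \<in> cyc_interval i s \<or> r = s"
        using F \<open>r \<noteq> s\<close> by (auto simp: cyc_interval_def split: if_splits)
      note u = cyc_interval_Un[OF this]
      have "card (A \<inter> cyc_interval i s) = card (A \<inter> cyc_interval i r) + card (A \<inter> ?P)"
        using card_Int_disjoint_Un[OF u(2), of A] u(1) by simp
      moreover have "card (A \<inter> cyc_interval i r) \<le> cdim V (cyc_interval i r)"
        using c by (auto simp: cond_def)
      ultimately show ?thesis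
        using cP P cdim_disjoint_Un[OF V(1) u(2), folded u(1)] by linarith
    qed (simp add: cdim_empty)
  qed
  show ?thesis using A B by (simp add: cond_def)
qed (use c in simp)

section \<open>Tilts and bounds at a level between two others\<close>

lemma card_insert_Int:
  assumes "c \<notin> C"
  shows "card (insert c C \<inter> S) = card (C \<inter> S) + of_bool (c \<in> (S :: 'n::finite set))"
  using assms by (simp add: Int_insert_left)

lemma cyc_interval_chain':
  "cyc_interval x r \<subseteq> cyc_interval y r \<or> cyc_interval y r \<subseteq> cyc_interval x r"
proof (cases "x = r \<or> y = r")
  case False
  then show ?thesis
    using cyc_interval_chain[of r x y] cyc_interval_compl[of r x] cyc_interval_compl[of r y] by blast
qed auto

lemma cyc_interval_step:
  assumes "a1 \<noteq> a2" "a2 \<notin> cyc_interval r a1"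
  shows "a1 \<in> cyc_interval i r \<Longrightarrow> a2 \<in> cyc_interval i r" "a2 \<in> cyc_interval r i \<Longrightarrow> a1 \<in> cyc_interval r i"
  using assms by (auto simp: cyc_interval_def split: if_splits)

text \<open>In terms of the order shifted by r, the last hypothesis excludes a descent from a1 to a2
  together with an ascent from b1 to b2. For each initial segment, the inequality in the middle then
  follows from the lower or from the upper one, depending on which of the new elements it
  contains.\<close>

lemma tilt_intermediate:
  assumes a: "a1 \<notin> A" "a2 \<notin> insert a1 A" and b: "b1 \<notin> B" "b2 \<notin> insert b1 B" and AB: "card A = card B"
    and t: "tilt r A B" "tilt r (insert a2 (insert a1 A)) (insert b2 (insert b1 B))"
    and n: "\<not> (a2 \<in> cyc_interval r a1 \<and> b1 \<in> cyc_interval r b2)"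
  shows "tilt r (insert a1 A) (insert b1 B)"
proof -
  have c: "card (insert a1 A) = card (insert b1 B)"
    "card (insert a2 (insert a1 A)) = card (insert b2 (insert b1 B))"
    using a b AB by auto
  have "card (insert b1 B \<inter> cyc_interval r i) \<le> card (insert a1 A \<inter> cyc_interval r i)" for i
  proof -
    let ?S = "cyc_interval r i"
    have 1: "card (B \<inter> ?S) \<le> card (A \<inter> ?S)"
      using t(1) tilt_iff[OF AB] by blast
    have 2: "card (insert b2 (insert b1 B) \<inter> ?S) \<le> card (insert a2 (insert a1 A) \<inter> ?S)"
      using t(2) tilt_iff[OF c(2)] by blast
    have "(a2 \<in> ?S \<longrightarrow> a1 \<in> ?S) \<or> (b1 \<in> ?S \<longrightarrow> b2 \<in> ?S)"
      using n cyc_interval_step(2)[of a1 a2 r i] cyc_interval_step(2)[of b2 b1 r i] a b by auto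
    with 1 2 show ?thesis
      unfolding card_insert_Int[OF a(2)] card_insert_Int[OF b(2)] card_insert_Int[OF a(1)]
        card_insert_Int[OF b(1)] by (auto simp: of_bool_def split: if_splits)
  qed
  then show ?thesis using tilt_iff[OF c(1)] by blast
qed

text \<open>If a1 lies in T, so does a2, and the bound for W drops by one just as the dimension
  drops by at most one; otherwise the bound is that for U.\<close>

lemma cdim_ge_redundant:
  assumes a: "a1 \<notin> A" "a2 \<notin> insert a1 A" and step: "a1 \<in> T \<Longrightarrow> a2 \<in> T"
    and V: "vec.subspace V" "vec.subspace W" "U \<subseteq> V" "V \<subseteq> W" "vec.dim W = Suc (vec.dim V)"
    and U: "card (A \<inter> T) \<le> cdim U T" and W: "card (insert a2 (insert a1 A) \<inter> T) \<le> cdim W T"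
  shows "card (insert a1 A \<inter> T) \<le> cdim V T"
proof (cases "a1 \<in> T")
  case True
  then show ?thesis
    using W cdim_hyperplane[of V W T] V card_insert_Int[OF a(2), of T] step by simp
next
  case False
  then show ?thesis
    using U cdim_mono[OF V(3), of T] by (simp add: card_insert_Int[OF a(1)])
qed

text \<open>The required number is at most one more than the bound for U and at most the bound for
  W, so either alternative for V is enough.\<close>

lemma cdim_ge_intermediate:
  assumes a: "a1 \<notin> A" "a2 \<notin> insert a1 A"
    and U: "card (A \<inter> T) \<le> cdim U T" and W: "card (insert a2 (insert a1 A) \<inter> T) \<le> cdim W T"
    and V: "Suc (cdim U T) \<le> cdim V T \<or> cdim W T \<le> cdim V T"
  shows "card (insert a1 A \<inter> T) \<le> cdim V T"
  using U W V by (auto simp: card_insert_Int[OF a(1)] card_insert_Int[OF a(2)] split: if_splits)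

lemma cond_redundant:
  assumes a: "a1 \<notin> A" "a2 \<notin> insert a1 A" and b: "b1 \<notin> B" "b2 \<notin> insert b1 B"
    and V: "vec.subspace V" "vec.subspace W" "U \<subseteq> V" "V \<subseteq> W" "vec.dim W = Suc (vec.dim V)"
    and U: "cond r A B U" and W: "cond r (insert a2 (insert a1 A)) (insert b2 (insert b1 B)) W"
    and n: "a2 \<notin> cyc_interval r a1" "b1 \<notin> cyc_interval r b2"
  shows "cond r (insert a1 A) (insert b1 B) V"
  unfolding cond_def
proof (intro allI conjI)
  fix i
  show "card (insert b1 B \<inter> cyc_interval r i) \<le> cdim V (cyc_interval r i)"
    using U W cyc_interval_step(2)[of b2 b1 r i] n(2) b
    by (intro cdim_ge_redundant[OF b _ V]) (auto simp: cond_def)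
  show "card (insert a1 A \<inter> cyc_interval i r) \<le> cdim V (cyc_interval i r)"
    using U W cyc_interval_step(1)[of a1 a2 r i] n(1) a
    by (intro cdim_ge_redundant[OF a _ V]) (auto simp: cond_def)
qed

text \<open>One family of bounds follows from the neighbours U and W for every V between them. The
  other family belongs to a chain of intervals, and V is chosen along that chain. Which family is
  which depends on whether a2 precedes a1.\<close>

lemma cond_intermediate:
  assumes a: "a1 \<notin> A" "a2 \<notin> insert a1 A" and b: "b1 \<notin> B" "b2 \<notin> insert b1 B"
    and UW: "vec.subspace U" "vec.subspace W" "U \<subseteq> W" "vec.dim W = Suc (Suc (vec.dim U))"
    and U: "cond r A B U" and W: "cond r (insert a2 (insert a1 A)) (insert b2 (insert b1 B)) W"
    and n: "\<not> (a2 \<in> cyc_interval r a1 \<and> b1 \<in> cyc_interval r b2)"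
  obtains V where "vec.subspace V" "U \<subseteq> V" "V \<subseteq> W" "vec.dim V = Suc (vec.dim U)"
    "cond r (insert a1 A) (insert b1 B) V"
proof (cases "a2 \<in> cyc_interval r a1")
  case False
  obtain V where V: "vec.subspace V" "U \<subseteq> V" "V \<subseteq> W" "vec.dim V = Suc (vec.dim U)"
    "\<And>T. T \<in> range (cyc_interval r) \<Longrightarrow> Suc (cdim U T) \<le> cdim V T \<or> cdim W T \<le> cdim V T"
    by (rule ex_intermediate_subspace[OF UW, of "range (cyc_interval r)"]) (use cyc_interval_chain in blast)+
  have "card (insert b1 B \<inter> cyc_interval r i) \<le> cdim V (cyc_interval r i)" for i
    using U W V(5)[OF rangeI] by (intro cdim_ge_intermediate[OF b, of _ U W]) (auto simp: cond_def)
  moreover have "card (insert a1 A \<inter> cyc_interval i r) \<le> cdim V (cyc_interval i r)" for i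
    using U W V UW cyc_interval_step(1)[of a1 a2 r i] False a
    by (intro cdim_ge_redundant[OF a, of _ V W U]) (auto simp: cond_def)
  ultimately show thesis using that V by (auto simp: cond_def)
next
  case True
  obtain V where V: "vec.subspace V" "U \<subseteq> V" "V \<subseteq> W" "vec.dim V = Suc (vec.dim U)"
    "\<And>T. T \<in> range (\<lambda>i. cyc_interval i r) \<Longrightarrow> Suc (cdim U T) \<le> cdim V T \<or> cdim W T \<le> cdim V T"
    by (rule ex_intermediate_subspace[OF UW, of "range (\<lambda>i. cyc_interval i r)"])
      (use cyc_interval_chain' in blast)+
  have "card (insert a1 A \<inter> cyc_interval i r) \<le> cdim V (cyc_interval i r)" for i
    using U W V(5)[OF rangeI] by (intro cdim_ge_intermediate[OF a, of _ U W]) (auto simp: cond_def)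
  moreover have "card (insert b1 B \<inter> cyc_interval r i) \<le> cdim V (cyc_interval r i)" for i
    using U W V UW cyc_interval_step(2)[of b2 b1 r i] True n b
    by (intro cdim_ge_redundant[OF b, of _ V W U]) (auto simp: cond_def)
  ultimately show thesis using that V by (auto simp: cond_def)
qed

section \<open>Tilted Richardson varieties indexed by natural numbers\<close>

text \<open>Level \<open>m\<close> of a flag has dimension \<open>m\<close>, starting at \<open>0\<close>, whereas the entries of a sequence are
  numbered from \<open>0\<close>: swapping the entries \<open>i\<close> and \<open>Suc i\<close> affects level \<open>Suc i\<close> only.\<close>

definition nat_flags :: "(nat \<Rightarrow> 'n::finite cvec set) set"
  where "nat_flags = {G. (\<forall>m\<le>CARD('n). vec.subspace (G m) \<and> vec.dim (G m) = m) \<and>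
    (\<forall>m<CARD('n). G m \<subseteq> G (Suc m))}"

definition is_seq :: "(nat \<Rightarrow> 'n::finite) \<Rightarrow> bool"
  where "is_seq w \<longleftrightarrow> bij_betw w {..<CARD('n)} UNIV"

text \<open>All tilts are quantified over, so that no choice of a tilt enters the sets of flags
  below; \<open>level_condI\<close> recovers the condition from any single tilt.\<close>

definition level_cond ::
    "(nat \<Rightarrow> 'n::{finite,linorder}) \<Rightarrow> (nat \<Rightarrow> 'n) \<Rightarrow> nat \<Rightarrow> 'n cvec set \<Rightarrow> bool"
  where "level_cond u v m V \<longleftrightarrow>
    (\<forall>r. tilt r (u ` {..<m}) (v ` {..<m}) \<longrightarrow> cond r (u ` {..<m}) (v ` {..<m}) V)"

definition tilted :: "(nat \<Rightarrow> 'n::{finite,linorder}) \<Rightarrow> (nat \<Rightarrow> 'n) \<Rightarrow> (nat \<Rightarrow> 'n cvec set) set"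
  where "tilted u v = {G \<in> nat_flags. \<forall>m\<le>CARD('n). level_cond u v m (G m)}"

definition swap_adj :: "(nat \<Rightarrow> 'a) \<Rightarrow> nat \<Rightarrow> nat \<Rightarrow> 'a"
  where "swap_adj w i = w \<circ> Transposition.transpose i (Suc i)"

lemma swap_adj_simps [simp]: "swap_adj w i i = w (Suc i)" "swap_adj w i (Suc i) = w i" "swap_adj (swap_adj w i) i = w"
  by (auto simp: swap_adj_def fun_eq_iff)

lemma swap_image:
  assumes "m \<noteq> Suc i" shows "swap_adj w i ` {..<m} = w ` {..<m}"
proof -
  have "Transposition.transpose i (Suc i) ` {..<m} = {..<m}"
    using assms by (auto simp: image_iff Transposition.transpose_def intro!: bexI[of _ "Transposition.transpose i (Suc i) x" for x])
  then show ?thesis by (metis swap_adj_def image_comp)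
qed

lemma is_seq_swap:
  assumes "is_seq (w :: nat \<Rightarrow> 'n::finite)" "Suc i < CARD('n)"
  shows "is_seq (swap_adj w i)"
proof -
  have "bij_betw (Transposition.transpose i (Suc i)) {..<CARD('n)} {..<CARD('n)}"
    using assms(2) by (intro bij_betw_byWitness[where f' = "Transposition.transpose i (Suc i)"])
      (auto simp: Transposition.transpose_def)
  then show ?thesis
    using assms(1) unfolding is_seq_def swap_adj_def by (rule bij_betw_trans)
qed

lemma is_seq_inj: "is_seq (w :: nat \<Rightarrow> 'n::finite) \<Longrightarrow> inj_on w {..<CARD('n)}"
  by (simp add: is_seq_def bij_betw_def)

lemma is_seq_card: "is_seq (w :: nat \<Rightarrow> 'n::finite) \<Longrightarrow> m \<le> CARD('n) \<Longrightarrow> card (w ` {..<m}) = m"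
  by (metis card_image card_lessThan inj_on_subset is_seq_inj lessThan_subset_iff)

lemma is_seq_notin: "is_seq (w :: nat \<Rightarrow> 'n::finite) \<Longrightarrow> m \<le> i \<Longrightarrow> i < CARD('n) \<Longrightarrow> w i \<notin> w ` {..<m}"
  by (auto dest!: is_seq_inj simp: inj_on_eq_iff)

lemma image_lessThan_Suc: "w ` {..<Suc m} = insert (w m) (w ` {..<m})"
  by (auto simp: lessThan_Suc)

lemma level_condI:
  fixes u v :: "nat \<Rightarrow> 'n::{finite,linorder}"
  assumes "is_seq u" "is_seq v" "m \<le> CARD('n)" "vec.subspace V" "vec.dim V = m"
    and "tilt r (u ` {..<m}) (v ` {..<m})" "cond r (u ` {..<m}) (v ` {..<m}) V"
  shows "level_cond u v m V"
  unfolding level_cond_def using assms is_seq_card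
  by (metis cond_tilt_independent)

lemma tilted_extend:
  fixes u v :: "nat \<Rightarrow> 'n::{finite,linorder}"
  assumes s: "is_seq u" "is_seq v" and i: "Suc i < CARD('n)"
    and t: "tilt r (u ` {..<i}) (v ` {..<i})" "tilt r (u ` {..<Suc (Suc i)}) (v ` {..<Suc (Suc i)})"
    and n: "\<not> (u (Suc i) \<in> cyc_interval r (u i) \<and> v i \<in> cyc_interval r (v (Suc i)))"
    and G: "G \<in> nat_flags" "\<And>m. m \<le> CARD('n) \<Longrightarrow> m \<noteq> Suc i \<Longrightarrow> level_cond u v m (G m)"
  obtains V where "G(Suc i := V) \<in> tilted u v"
proof -
  let ?A = "u ` {..<i}" and ?B = "v ` {..<i}"
  have a: "u i \<notin> ?A" "u (Suc i) \<notin> insert (u i) ?A" and b: "v i \<notin> ?B" "v (Suc i) \<notin> insert (v i) ?B"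
    using i is_seq_notin[OF s(1), of i i] is_seq_notin[OF s(1), of "Suc i" "Suc i"]
      is_seq_notin[OF s(2), of i i] is_seq_notin[OF s(2), of "Suc i" "Suc i"]
    by (simp_all add: image_lessThan_Suc)
  have U: "vec.subspace (G i)" "vec.subspace (G (Suc (Suc i)))" "G i \<subseteq> G (Suc (Suc i))"
     "vec.dim (G (Suc (Suc i))) = Suc (Suc (vec.dim (G i)))"
    using G(1) i by (auto simp: nat_flags_def) (meson Suc_lessD subsetD)
  have c: "cond r ?A ?B (G i)"
    "cond r (insert (u (Suc i)) (insert (u i) ?A)) (insert (v (Suc i)) (insert (v i) ?B)) (G (Suc (Suc i)))"
    using G(2)[of i] G(2)[of "Suc (Suc i)"] t i unfolding level_cond_def by (auto simp: image_lessThan_Suc)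
  obtain V where V: "vec.subspace V" "G i \<subseteq> V" "V \<subseteq> G (Suc (Suc i))" "vec.dim V = Suc (vec.dim (G i))"
    "cond r (insert (u i) ?A) (insert (v i) ?B) V"
    by (rule cond_intermediate[OF a b U c n])
  have "tilt r (insert (u i) ?A) (insert (v i) ?B)"
    using t s i is_seq_card[of u i] is_seq_card[of v i]
    by (intro tilt_intermediate[OF a b _ _ _ n]) (auto simp: image_lessThan_Suc)
  then have "level_cond u v (Suc i) V"
    using V G(1) i by (intro level_condI[OF s, of _ _ r]) (auto simp: nat_flags_def image_lessThan_Suc)
  moreover have "G(Suc i := V) \<in> nat_flags"
    using V G(1) i by (auto simp: nat_flags_def)
  ultimately have "G(Suc i := V) \<in> tilted u v" using G(2) by (auto simp: tilted_def)
  then show thesis by (rule that)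
qed

section \<open>Inversions and sorting by adjacent transpositions\<close>

text \<open>The window D of positions and the order L of the values are parameters, because
  inversions are counted for shifted orders within a window of levels, for both row orders of
  Schubert cells, and for the Bruhat order.\<close>

definition inv_set :: "'p::linorder set \<Rightarrow> ('a \<Rightarrow> 'a \<Rightarrow> bool) \<Rightarrow> ('p \<Rightarrow> 'a) \<Rightarrow> ('p \<times> 'p) set"
  where "inv_set D L w = {(p, q). p \<in> D \<and> q \<in> D \<and> p < q \<and> L (w q) (w p)}"

lemma finite_inv_set: "finite D \<Longrightarrow> finite (inv_set D L w)"
  by (rule finite_subset[of _ "D \<times> D"]) (auto simp: inv_set_def)

lemma card_inv_set_transpose:
  assumes D: "finite D" "i \<in> D" "j \<in> D" and ij: "i < j" "L (w i) (w j)"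
    and L: "\<And>x y z. L x y \<Longrightarrow> L y z \<Longrightarrow> L x z" "\<And>x. \<not> L x x"
  shows "card (inv_set D L w) < card (inv_set D L (w \<circ> Transposition.transpose i j))"
proof -
  let ?t = "Transposition.transpose i j" and ?v = "w \<circ> Transposition.transpose i j"
  \<comment> \<open>An injection from old to new inversions: a pair is carried along by the
    transposition if its positions remain in order, and otherwise kept, which is an inversion again
    by transitivity through w i and w j. The new inversion (i, j) is missed.\<close>
  define f where "f = (\<lambda>(p, q). if ?t p < ?t q then (?t p, ?t q) else (p, q))"
  have t: "?t i = j" "?t j = i" "\<And>x. x \<noteq> i \<Longrightarrow> x \<noteq> j \<Longrightarrow> ?t x = x" "\<And>x. ?t (?t x) = x"
    by (auto simp: Transposition.transpose_def)
  have tD: "x \<in> D \<Longrightarrow> ?t x \<in> D" for x using D by (auto simp: Transposition.transpose_def)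
  have nij: "\<not> L (w j) (w i)" using L ij(2) by blast
  have "f ` inv_set D L w \<subseteq> inv_set D L ?v"
  proof clarsimp
    fix p q assume "(p, q) \<in> inv_set D L w"
    then have pq: "p \<in> D" "q \<in> D" "p < q" "L (w q) (w p)" by (auto simp: inv_set_def)
    show "f (p, q) \<in> inv_set D L ?v"
    proof (cases "?t p < ?t q")
      case True
      then show ?thesis using pq tD t(4) by (auto simp: f_def inv_set_def)
    next
      case False
      then have "p = i \<and> q < j \<or> q = j \<and> i < p"
        using pq(3,4) ij(1) nij by (auto simp: Transposition.transpose_def split: if_splits)
      then have "L (w (?t q)) (w (?t p))"
      proof
        assume *: "p = i \<and> q < j"
        then have "?t q = q" using pq by (intro t(3)) auto
        then show ?thesis using * pq ij t L(1)[of "w q" "w i" "w j"] by simp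
      next
        assume *: "q = j \<and> i < p"
        then have "?t p = p" using pq by (intro t(3)) auto
        then show ?thesis using * pq ij t L(1)[of "w i" "w j" "w p"] by simp
      qed
      then show ?thesis using False pq by (auto simp: f_def inv_set_def)
    qed
  qed
  moreover have "(i, j) \<in> inv_set D L ?v" using D ij t by (simp add: inv_set_def)
  moreover have "(i, j) \<notin> f ` inv_set D L w"
  proof
    assume "(i, j) \<in> f ` inv_set D L w"
    then obtain p q where pq: "f (p, q) = (i, j)" "p < q" "L (w q) (w p)" by (auto simp: inv_set_def)
    show False
    proof (cases "?t p < ?t q")
      case True
      then have "?t p = i" "?t q = j" using pq by (auto simp: f_def)
      then have "p = j" "q = i" using t by metis+
      then show False using pq ij by auto
    next
      case False
      then have "p = i" "q = j" using pq(1) by (auto simp: f_def)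
      then show False using pq(3) ij L by blast
    qed
  qed
  moreover have "inj_on f (inv_set D L w)"
  proof (rule inj_onI, clarsimp)
    fix p q p' q' assume *: "(p, q) \<in> inv_set D L w" "(p', q') \<in> inv_set D L w" "f (p, q) = f (p', q')"
    then have "p < q" "p' < q'" by (auto simp: inv_set_def)
    with *(3) show "p = p' \<and> q = q'"
      unfolding f_def prod.case by (metis Pair_inject order_less_asym t(4))
  qed
  ultimately have "f ` inv_set D L w \<subset> inv_set D L ?v" by blast
  then have "card (f ` inv_set D L w) < card (inv_set D L ?v)"
    by (intro psubset_card_mono finite_inv_set D)
  then show ?thesis using card_image[OF \<open>inj_on f _\<close>] by simp
qed

text \<open>Both sequences are swapped at a descent of the second one if the first one also has a descent
  there; otherwise only the second one is swapped.\<close>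

lemma adjacent_sort:
  fixes R :: "(nat \<Rightarrow> 'a) \<Rightarrow> (nat \<Rightarrow> 'a) \<Rightarrow> bool"
  assumes L: "\<And>x y z. L x y \<Longrightarrow> L y z \<Longrightarrow> L x z" "\<And>x. \<not> L x x" "\<And>x y. x \<noteq> y \<Longrightarrow> L x y \<or> L y x"
    and inj: "\<And>u v. R u v \<Longrightarrow> inj_on v {l..<h}"
    and step: "\<And>u v u' v' i. R u v \<Longrightarrow> l \<le> i \<Longrightarrow> Suc i < h \<Longrightarrow> u' \<in> {u, swap_adj u i} \<Longrightarrow> v' \<in> {v, swap_adj v i} \<Longrightarrow>
      \<not> (L (u (Suc i)) (u i) \<and> L (v i) (v (Suc i))) \<Longrightarrow>
      \<not> (L (u' (Suc i)) (u' i) \<and> L (v' i) (v' (Suc i))) \<Longrightarrow> R u' v'"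
    and R: "R u v"
  shows "\<exists>u' v'. R u' v' \<and> (\<forall>i. l \<le> i \<longrightarrow> Suc i < h \<longrightarrow> L (v' i) (v' (Suc i)))"
  using R
proof (induction "card (inv_set {l..<h} L v)" arbitrary: u v rule: less_induct)
  case less
  show ?case
  proof (cases "\<forall>i. l \<le> i \<longrightarrow> Suc i < h \<longrightarrow> L (v i) (v (Suc i))")
    case True
    then show ?thesis using less.prems by blast
  next
    case False
    then obtain i where i: "l \<le> i" "Suc i < h" "\<not> L (v i) (v (Suc i))" by blast
    have "v i \<noteq> v (Suc i)"
      using inj_onD[OF inj[OF less.prems], of i "Suc i"] i by auto
    then have d: "L (v (Suc i)) (v i)" using L(3) i by blast
    define u' where "u' = (if L (u (Suc i)) (u i) then swap_adj u i else u)"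
    have "R u' (swap_adj v i)"
      by (rule step[OF less.prems i(1,2)]) (use i(3) d L in \<open>auto simp: u'_def\<close>)
    moreover have "card (inv_set {l..<h} L (swap_adj v i)) < card (inv_set {l..<h} L v)"
    proof -
      have "card (inv_set {l..<h} L (swap_adj v i)) < card (inv_set {l..<h} L (swap_adj (swap_adj v i) i))"
        unfolding swap_adj_def[of "swap_adj v i"]
        by (rule card_inv_set_transpose) (use i d L in auto)
      then show ?thesis by simp
    qed
    ultimately show ?thesis using less.hyps by blast
  qed
qed

section \<open>Moves preserving the projection\<close>

definition level_image :: "nat \<Rightarrow> (nat \<Rightarrow> 'n::{finite,linorder}) \<Rightarrow> (nat \<Rightarrow> 'n) \<Rightarrow> 'n cvec set set"
  where "level_image k u v = (\<lambda>G. G k) ` tilted u v"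

lemma level_image_subset:
  fixes u v :: "nat \<Rightarrow> 'n::{finite,linorder}"
  assumes s: "is_seq u'" "is_seq v'" and i: "Suc i < CARD('n)" and k: "k \<noteq> Suc i"
    and e: "\<And>m. m \<noteq> Suc i \<Longrightarrow> u' ` {..<m} = u ` {..<m}" "\<And>m. m \<noteq> Suc i \<Longrightarrow> v' ` {..<m} = v ` {..<m}"
    and t: "tilt r (u ` {..<i}) (v ` {..<i})" "tilt r (u ` {..<Suc (Suc i)}) (v ` {..<Suc (Suc i)})"
    and n: "\<not> (u' (Suc i) \<in> cyc_interval r (u' i) \<and> v' i \<in> cyc_interval r (v' (Suc i)))"
  shows "level_image k u v \<subseteq> level_image k u' v'"
proof
  fix X assume "X \<in> level_image k u v"
  then obtain G where G: "G \<in> tilted u v" "X = G k" by (auto simp: level_image_def)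
  have "G \<in> nat_flags" using G by (simp add: tilted_def)
  moreover have "level_cond u' v' m (G m)" if "m \<le> CARD('n)" "m \<noteq> Suc i" for m
    using G(1) that e by (simp add: tilted_def level_cond_def)
  moreover have "tilt r (u' ` {..<i}) (v' ` {..<i})" "tilt r (u' ` {..<Suc (Suc i)}) (v' ` {..<Suc (Suc i)})"
    using t e by simp_all
  ultimately obtain V where "G(Suc i := V) \<in> tilted u' v'"
    using tilted_extend[OF s i _ _ n] by blast
  then show "X \<in> level_image k u' v'"
    unfolding level_image_def using G(2) k by (intro image_eqI[of _ _ "G(Suc i := V)"]) auto
qed

lemma tilt_middle:
  fixes u v :: "nat \<Rightarrow> 'n::{finite,linorder}"
  assumes s: "is_seq u" "is_seq v" and i: "Suc i < CARD('n)"
    and t: "tilt r (u ` {..<i}) (v ` {..<i})" "tilt r (u ` {..<Suc (Suc i)}) (v ` {..<Suc (Suc i)})"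
    and n: "\<not> (u (Suc i) \<in> cyc_interval r (u i) \<and> v i \<in> cyc_interval r (v (Suc i)))"
  shows "tilt r (u ` {..<Suc i}) (v ` {..<Suc i})"
  unfolding image_lessThan_Suc
proof (rule tilt_intermediate[OF _ _ _ _ _ _ _ n])
  show "u i \<notin> u ` {..<i}" "v i \<notin> v ` {..<i}" "u (Suc i) \<notin> insert (u i) (u ` {..<i})"
    "v (Suc i) \<notin> insert (v i) (v ` {..<i})"
    using s i is_seq_notin[OF s(1), of "Suc i" "Suc i"] is_seq_notin[OF s(2), of "Suc i" "Suc i"]
      is_seq_notin[OF s(1), of i i] is_seq_notin[OF s(2), of i i]
    by (simp_all add: image_lessThan_Suc)
qed (use s i t is_seq_card[OF s(1), of i] is_seq_card[OF s(2), of i] in \<open>simp_all add: image_lessThan_Suc\<close>)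

text \<open>Only prefixes of length strictly between l and h may change as sets. Work in one window
  therefore leaves intact the tilts found outside of it and at its two ends.\<close>

definition reduces ::
    "nat \<Rightarrow> nat \<Rightarrow> nat \<Rightarrow> (nat \<Rightarrow> 'n::{finite,linorder}) \<Rightarrow> (nat \<Rightarrow> 'n) \<Rightarrow> (nat \<Rightarrow> 'n) \<Rightarrow> (nat \<Rightarrow> 'n) \<Rightarrow> bool"
  where "reduces k l h u v u' v' \<longleftrightarrow> is_seq u' \<and> is_seq v' \<and> level_image k u' v' = level_image k u v \<and>
    (\<forall>m. m \<le> l \<or> h \<le> m \<longrightarrow> u' ` {..<m} = u ` {..<m} \<and> v' ` {..<m} = v ` {..<m})"

definition common_tilt :: "nat \<Rightarrow> nat \<Rightarrow> 'n::{finite,linorder} \<Rightarrow> (nat \<Rightarrow> 'n) \<Rightarrow> (nat \<Rightarrow> 'n) \<Rightarrow> bool"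
  where "common_tilt l h r u v \<longleftrightarrow> (\<forall>m. l \<le> m \<and> m \<le> h \<longrightarrow> tilt r (u ` {..<m}) (v ` {..<m}))"

lemma reduces_step:
  fixes u v :: "nat \<Rightarrow> 'n::{finite,linorder}"
  assumes R: "reduces k l h u0 v0 u v" "common_tilt l h r u v" and h: "h \<le> CARD('n)" and k: "\<not> (l < k \<and> k < h)"
    and i: "l \<le> i" "Suc i < h" and u': "u' \<in> {u, swap_adj u i}" and v': "v' \<in> {v, swap_adj v i}"
    and n: "\<not> (u (Suc i) \<in> cyc_interval r (u i) \<and> v i \<in> cyc_interval r (v (Suc i)))"
    and n': "\<not> (u' (Suc i) \<in> cyc_interval r (u' i) \<and> v' i \<in> cyc_interval r (v' (Suc i)))"
  shows "reduces k l h u0 v0 u' v' \<and> common_tilt l h r u' v'"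
proof -
  have iN: "Suc i < CARD('n)" and ki: "k \<noteq> Suc i" using h i k by auto
  have s: "is_seq u" "is_seq v" using R by (auto simp: reduces_def)
  have s': "is_seq u'" "is_seq v'" using is_seq_swap[OF _ iN] s u' v' by auto
  have e: "m \<noteq> Suc i \<Longrightarrow> u' ` {..<m} = u ` {..<m}" "m \<noteq> Suc i \<Longrightarrow> v' ` {..<m} = v ` {..<m}" for m
    using u' v' swap_image by (metis empty_iff insert_iff)+
  have t: "tilt r (u ` {..<i}) (v ` {..<i})" "tilt r (u ` {..<Suc (Suc i)}) (v ` {..<Suc (Suc i)})"
    using R(2) i by (auto simp: common_tilt_def)
  have t': "tilt r (u' ` {..<i}) (v' ` {..<i})" "tilt r (u' ` {..<Suc (Suc i)}) (v' ` {..<Suc (Suc i)})"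
    using t e by simp_all
  have "level_image k u v = level_image k u' v'"
    using level_image_subset[OF s' iN ki e t n'] level_image_subset[OF s iN ki e[symmetric] t' n] by blast
  moreover have "tilt r (u' ` {..<Suc i}) (v' ` {..<Suc i})"
    by (rule tilt_middle[OF s' iN t' n'])
  then have "common_tilt l h r u' v'"
    using R(2) e unfolding common_tilt_def by metis
  moreover have "u' ` {..<m} = u0 ` {..<m} \<and> v' ` {..<m} = v0 ` {..<m}" if "m \<le> l \<or> h \<le> m" for m
  proof -
    have "m \<noteq> Suc i" using that i by linarith
    then show ?thesis using R(1) e[of m] that unfolding reduces_def by metis
  qed
  ultimately show ?thesis using s' R(1) by (simp add: reduces_def)
qed

lemma reduces_refl: "is_seq u \<Longrightarrow> is_seq v \<Longrightarrow> reduces k l h u v u v"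
  by (simp add: reduces_def)

section \<open>Sorting one sequence inside a window\<close>

lemma sort_second:
  fixes u v :: "nat \<Rightarrow> 'n::{finite,linorder}"
  assumes s: "is_seq u" "is_seq v" and h: "h \<le> CARD('n)" and k: "\<not> (l < k \<and> k < h)" and t: "common_tilt l h r u v"
  obtains u' v' where "reduces k l h u v u' v'" "common_tilt l h r u' v'"
    "\<And>i. l \<le> i \<Longrightarrow> Suc i < h \<Longrightarrow> v' i \<in> cyc_interval r (v' (Suc i))"
proof -
  let ?R = "\<lambda>u' v'. reduces k l h u v u' v' \<and> common_tilt l h r u' v'"
  let ?L = "\<lambda>x y. x \<in> cyc_interval r y"
  have "\<exists>u' v'. ?R u' v' \<and> (\<forall>i. l \<le> i \<longrightarrow> Suc i < h \<longrightarrow> ?L (v' i) (v' (Suc i)))"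
  proof (rule adjacent_sort[where L = ?L and R = ?R and l = l and h = h])
    show "?L x z" if "?L x y" "?L y z" for x y z using cyc_interval_trans that .
    show "\<not> ?L x x" for x by (rule cyc_interval_not_self)
    show "?L x y \<or> ?L y x" if "x \<noteq> y" for x y using cyc_interval_total that by blast
    show "inj_on v' {l..<h}" if "?R u' v'" for u' v'
      using that h by (auto simp: reduces_def intro: inj_on_subset[OF is_seq_inj])
    show "?R u v" using reduces_refl[OF s] t by blast
    show "?R x' y'" if "?R x y" "l \<le> i" "Suc i < h" "x' \<in> {x, swap_adj x i}" "y' \<in> {y, swap_adj y i}"
      "\<not> (?L (x (Suc i)) (x i) \<and> ?L (y i) (y (Suc i)))"
      "\<not> (?L (x' (Suc i)) (x' i) \<and> ?L (y' i) (y' (Suc i)))" for x y x' y' i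
      using that(1) reduces_step[OF _ _ h k that(2-7)] by blast
  qed
  then show thesis using that by blast
qed

text \<open>Exchanging the two sequences and reversing the shifted order maps the excluded
  configuration to itself. Hence the same sorting procedure applies with the roles exchanged and
  makes the first sequence decreasing.\<close>

lemma sort_first:
  fixes u v :: "nat \<Rightarrow> 'n::{finite,linorder}"
  assumes s: "is_seq u" "is_seq v" and h: "h \<le> CARD('n)" and k: "\<not> (l < k \<and> k < h)" and t: "common_tilt l h r u v"
  obtains u' v' where "reduces k l h u v u' v'" "common_tilt l h r u' v'"
    "\<And>i. l \<le> i \<Longrightarrow> Suc i < h \<Longrightarrow> u' (Suc i) \<in> cyc_interval r (u' i)"
proof -
  let ?R = "\<lambda>v' u'. reduces k l h u v u' v' \<and> common_tilt l h r u' v'"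
  let ?L = "\<lambda>x y. y \<in> cyc_interval r x"
  have "\<exists>v' u'. ?R v' u' \<and> (\<forall>i. l \<le> i \<longrightarrow> Suc i < h \<longrightarrow> ?L (u' i) (u' (Suc i)))"
  proof (rule adjacent_sort[where L = ?L and R = ?R and l = l and h = h])
    show "?L x z" if "?L x y" "?L y z" for x y z using cyc_interval_trans that(2,1) .
    show "\<not> ?L x x" for x by (rule cyc_interval_not_self)
    show "?L x y \<or> ?L y x" if "x \<noteq> y" for x y using cyc_interval_total that by blast
    show "inj_on u' {l..<h}" if "?R v' u'" for u' v'
      using that h by (auto simp: reduces_def intro: inj_on_subset[OF is_seq_inj])
    show "?R v u" using reduces_refl[OF s] t by blast
    show "?R y' x'" if R: "?R y x" and i: "l \<le> i" "Suc i < h" and w: "y' \<in> {y, swap_adj y i}" "x' \<in> {x, swap_adj x i}"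
      and n: "\<not> (?L (y (Suc i)) (y i) \<and> ?L (x i) (x (Suc i)))"
      "\<not> (?L (y' (Suc i)) (y' i) \<and> ?L (x' i) (x' (Suc i)))" for x y x' y' i
    proof -
      have "\<not> (x (Suc i) \<in> cyc_interval r (x i) \<and> y i \<in> cyc_interval r (y (Suc i)))"
        "\<not> (x' (Suc i) \<in> cyc_interval r (x' i) \<and> y' i \<in> cyc_interval r (y' (Suc i)))"
        using n by blast+
      from reduces_step[OF _ _ h k i w(2,1) this] R show ?thesis by blast
    qed
  qed
  then show thesis using that by blast
qed

section \<open>Replacing tilts by a common one\<close>

lemma tilt_self: "tilt r A A"
  by (simp add: tilt_def pot_def)

lemma is_seq_UNIV: "is_seq (w :: nat \<Rightarrow> 'n::finite) \<Longrightarrow> w ` {..<CARD('n)} = UNIV"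
  by (simp add: is_seq_def bij_betw_def)

lemma reduces_trans:
  assumes "reduces k l1 h1 u v u' v'" "reduces k l2 h2 u' v' u'' v''"
    and "l \<le> l1" "l \<le> l2" "h1 \<le> h" "h2 \<le> h"
  shows "reduces k l h u v u'' v''"
proof -
  have "u'' ` {..<m} = u ` {..<m} \<and> v'' ` {..<m} = v ` {..<m}" if "m \<le> l \<or> h \<le> m" for m
  proof -
    have "m \<le> l1 \<or> h1 \<le> m" "m \<le> l2 \<or> h2 \<le> m" using that assms(3-) by linarith+
    then show ?thesis using assms(1,2) unfolding reduces_def by metis
  qed
  then show ?thesis using assms(1,2) by (simp add: reduces_def)
qed

text \<open>In the window the entries lying in P precede all others. The count thus grows by one at
  each step until P is exhausted and then stays at its final value.\<close>

lemma prefix_count: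
  fixes v :: "nat \<Rightarrow> 'n::finite"
  assumes v: "is_seq v" and i: "l \<le> i" "i \<le> h" "h \<le> CARD('n)"
    and sorted: "\<And>p. l \<le> p \<Longrightarrow> Suc p < h \<Longrightarrow> v (Suc p) \<in> P \<Longrightarrow> v p \<in> P"
  shows "card (v ` {..<i} \<inter> P) = card (v ` {..<l} \<inter> P) + (i - l) \<or>
    card (v ` {..<i} \<inter> P) = card (v ` {..<h} \<inter> P)"
proof (cases "\<forall>p. l \<le> p \<and> p < i \<longrightarrow> v p \<in> P")
  case True
  have "v ` {..<i} \<inter> P = (v ` {..<l} \<inter> P) \<union> v ` {l..<i}"
    using True i(1) by (auto simp: image_iff) (metis atLeastLessThan_iff lessThan_iff not_le)
  moreover have "(v ` {..<l} \<inter> P) \<inter> v ` {l..<i} = {}"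
    using is_seq_inj[OF v] i by (auto simp: inj_on_eq_iff)
  moreover have "inj_on v {l..<i}"
    by (rule inj_on_subset[OF is_seq_inj[OF v]]) (use i in auto)
  then have "card (v ` {l..<i}) = i - l" by (simp add: card_image)
  ultimately show ?thesis by (simp add: card_Un_disjoint)
next
  case False
  then obtain p where p: "l \<le> p" "p < i" "v p \<notin> P" by blast
  have "v q \<notin> P" if "p \<le> q" "q < h" for q
    using that
  proof (induction q rule: dec_induct)
    case (step q)
    then show ?case using sorted[of q] p by auto
  qed (use p in auto)
  then have "v ` {..<h} \<inter> P = v ` {..<i} \<inter> P"
    using p i by auto (metis (no_types, opaque_lifting) IntI imageI lessThan_iff less_le_trans not_le order_less_imp_le)
  then show ?thesis by simp
qed

lemma count_step_le:
  fixes u :: "nat \<Rightarrow> 'n::finite"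
  assumes "l \<le> i"
  shows "card (u ` {..<i} \<inter> P) \<le> card (u ` {..<l} \<inter> P) + (i - l)"
proof -
  have "u ` {..<i} \<inter> P \<subseteq> (u ` {..<l} \<inter> P) \<union> u ` {l..<i}"
    by (auto simp: image_iff) (metis atLeastLessThan_iff lessThan_iff not_le)
  then have "card (u ` {..<i} \<inter> P) \<le> card ((u ` {..<l} \<inter> P) \<union> u ` {l..<i})"
    by (intro card_mono) auto
  also have "\<dots> \<le> card (u ` {..<l} \<inter> P) + card (u ` {l..<i})" by (rule card_Un_le)
  finally show ?thesis using card_image_le[of "{l..<i}" u] by simp
qed

text \<open>Let P = [r, s) and let v' be increasing in the window. At level m the count of v' in P
  has either grown by m - l or reached its value at h. The count of u' agrees with it at both ends,
  grows by at most one per level and never exceeds its final value, so it is at most that of v'. The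
  tilt r gives the opposite inequality; equality means that s is a tilt at level m.\<close>

lemma retilt:
  fixes u v :: "nat \<Rightarrow> 'n::{finite,linorder}"
  assumes s: "is_seq u" "is_seq v" and h: "l \<le> h" "h \<le> CARD('n)" and k: "\<not> (l < k \<and> k < h)"
    and t: "common_tilt l h r u v"
    and ends: "tilt s (u ` {..<l}) (v ` {..<l})" "tilt s (u ` {..<h}) (v ` {..<h})"
  obtains u' v' where "reduces k l h u v u' v'" "common_tilt l h s u' v'"
proof -
  obtain u' v' where R: "reduces k l h u v u' v'" and t': "common_tilt l h r u' v'"
    and sorted: "\<And>i. l \<le> i \<Longrightarrow> Suc i < h \<Longrightarrow> v' i \<in> cyc_interval r (v' (Suc i))"
    by (rule sort_second[OF s h(2) k t]) blast
  let ?P = "cyc_interval r s"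
  have s': "is_seq u'" "is_seq v'" using R by (auto simp: reduces_def)
  have card: "card (u' ` {..<m}) = card (v' ` {..<m})" if "m \<le> h" for m
    using is_seq_card s' that h by (metis order_trans)
  have eq: "tilt s (u' ` {..<m}) (v' ` {..<m}) \<longleftrightarrow> card (v' ` {..<m} \<inter> ?P) = card (u' ` {..<m} \<inter> ?P)"
    if "l \<le> m" "m \<le> h" for m
    using tilt_eq_card[OF card] t' that by (simp add: common_tilt_def)
  have "u' ` {..<l} = u ` {..<l}" "v' ` {..<l} = v ` {..<l}" "u' ` {..<h} = u ` {..<h}" "v' ` {..<h} = v ` {..<h}"
    using R unfolding reduces_def by blast+
  then have e: "card (v' ` {..<l} \<inter> ?P) = card (u' ` {..<l} \<inter> ?P)" "card (v' ` {..<h} \<inter> ?P) = card (u' ` {..<h} \<inter> ?P)"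
    using eq[of l] eq[of h] ends h by simp_all
  have "tilt s (u' ` {..<m}) (v' ` {..<m})" if m: "l \<le> m" "m \<le> h" for m
  proof -
    have "card (v' ` {..<m} \<inter> ?P) \<le> card (u' ` {..<m} \<inter> ?P)"
      using t' m tilt_iff[OF card[OF m(2)]] unfolding common_tilt_def by blast
    moreover have "card (u' ` {..<m} \<inter> ?P) \<le> card (u' ` {..<l} \<inter> ?P) + (m - l)"
      by (rule count_step_le[OF m(1)])
    moreover have "card (u' ` {..<m} \<inter> ?P) \<le> card (u' ` {..<h} \<inter> ?P)"
      using m by (intro card_mono) auto
    moreover have "card (v' ` {..<m} \<inter> ?P) = card (v' ` {..<l} \<inter> ?P) + (m - l) \<or>
        card (v' ` {..<m} \<inter> ?P) = card (v' ` {..<h} \<inter> ?P)"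
      using sorted cyc_interval_trans by (intro prefix_count[OF s'(2) m h(2)]) blast
    ultimately show ?thesis using eq[OF m] e by linarith
  qed
  then show thesis using that[OF R] by (simp add: common_tilt_def)
qed

lemma ex_adjacent_tilt:
  fixes u v :: "nat \<Rightarrow> 'n::{finite,linorder}"
  assumes s: "is_seq u" "is_seq v" and m: "m < CARD('n)"
  obtains r where "tilt r (u ` {..<m}) (v ` {..<m})" "tilt r (u ` {..<Suc m}) (v ` {..<Suc m})"
proof -
  obtain r r' where "tilt r (u ` {..<m}) (v ` {..<m})" "tilt r' (u ` {..<Suc m}) (v ` {..<Suc m})"
    using ex_tilt by blast
  moreover have "card (u ` {..<m}) = card (v ` {..<m})" using is_seq_card s m by (metis less_imp_le)
  ultimately show thesis
    using tilt_adjacent[of "u ` {..<m}" "v ` {..<m}" "u m" "v m" r r'] is_seq_notin[OF s(1), of m m]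
      is_seq_notin[OF s(2), of m m] m that
    unfolding image_lessThan_Suc by blast
qed

text \<open>The window from 0 to j is retilted to a tilt r' shared by the levels j and j + 1. This
  is possible since r' is a tilt at both ends of the window, trivially so at level 0.\<close>

lemma ex_common_tilt_below:
  fixes u v :: "nat \<Rightarrow> 'n::{finite,linorder}"
  assumes s: "is_seq u" "is_seq v" and k: "k \<le> CARD('n)" and j: "j \<le> k"
  shows "\<exists>u' v' r. reduces k 0 j u v u' v' \<and> common_tilt 0 j r u' v'"
  using j
proof (induction j)
  case 0
  show ?case using reduces_refl[OF s] by (auto simp: common_tilt_def tilt_self intro!: exI)
next
  case (Suc j)
  then obtain u1 v1 r where R: "reduces k 0 j u v u1 v1" "common_tilt 0 j r u1 v1" by auto
  then have s1: "is_seq u1" "is_seq v1" by (auto simp: reduces_def)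
  obtain r' where r': "tilt r' (u1 ` {..<j}) (v1 ` {..<j})" "tilt r' (u1 ` {..<Suc j}) (v1 ` {..<Suc j})"
    using ex_adjacent_tilt[OF s1, of j] Suc.prems k by auto
  obtain u2 v2 where R2: "reduces k 0 j u1 v1 u2 v2" "common_tilt 0 j r' u2 v2"
    using retilt[OF s1 _ _ _ R(2), of k r'] r' tilt_self Suc.prems k by (auto simp: tilt_self)
  have "u2 ` {..<Suc j} = u1 ` {..<Suc j}" "v2 ` {..<Suc j} = v1 ` {..<Suc j}"
    using R2(1) by (simp_all add: reduces_def)
  then have "common_tilt 0 (Suc j) r' u2 v2"
    using R2(2) r'(2) by (auto simp: common_tilt_def le_Suc_eq)
  moreover have "reduces k 0 (Suc j) u v u2 v2"
    using reduces_trans[OF R(1) R2(1)] by auto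
  ultimately show ?case by blast
qed

text \<open>The mirror image of the induction from below, starting at the top level: there both
  prefixes are the full set, for which everything is a tilt.\<close>

lemma ex_common_tilt_above:
  fixes u v :: "nat \<Rightarrow> 'n::{finite,linorder}"
  assumes s: "is_seq u" "is_seq v" and j: "j \<le> CARD('n)" "k \<le> j"
  shows "\<exists>u' v' r. reduces k j CARD('n) u v u' v' \<and> common_tilt j CARD('n) r u' v'"
  using j
proof (induction j rule: inc_induct)
  case base
  show ?case using reduces_refl[OF s] s by (auto simp: common_tilt_def is_seq_UNIV tilt_self intro!: exI)
next
  case (step j)
  let ?N = "CARD('n)"
  obtain u1 v1 r where R: "reduces k (Suc j) ?N u v u1 v1" "common_tilt (Suc j) ?N r u1 v1"
    using step by auto
  then have s1: "is_seq u1" "is_seq v1" by (auto simp: reduces_def)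
  obtain r' where r': "tilt r' (u1 ` {..<j}) (v1 ` {..<j})" "tilt r' (u1 ` {..<Suc j}) (v1 ` {..<Suc j})"
    using ex_adjacent_tilt[OF s1, of j] step by auto
  obtain u2 v2 where R2: "reduces k (Suc j) ?N u1 v1 u2 v2" "common_tilt (Suc j) ?N r' u2 v2"
    using retilt[OF s1 _ _ _ R(2), of k r'] r' step s1 by (auto simp: tilt_self is_seq_UNIV)
  have "u2 ` {..<j} = u1 ` {..<j}" "v2 ` {..<j} = v1 ` {..<j}"
    using R2(1) by (simp_all add: reduces_def)
  then have "common_tilt j ?N r' u2 v2"
    using R2(2) r'(1) unfolding common_tilt_def by (metis Suc_leI le_neq_implies_less)
  moreover have "reduces k j ?N u v u2 v2"
    using reduces_trans[OF R(1) R2(1)] by auto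
  ultimately show ?case by blast
qed

lemma common_tilt_cong:
  assumes "common_tilt l h r u v"
    and "\<And>m. l \<le> m \<Longrightarrow> m \<le> h \<Longrightarrow> u' ` {..<m} = u ` {..<m} \<and> v' ` {..<m} = v ` {..<m}"
  shows "common_tilt l h r u' v'"
  using assms by (simp add: common_tilt_def)

lemma common_tilt_join:
  assumes "common_tilt l k r u v" "common_tilt k h r u v"
  shows "common_tilt l h r u v"
  using assms unfolding common_tilt_def by (metis nat_le_linear)

lemma ex_common_tilt:
  fixes u v :: "nat \<Rightarrow> 'n::{finite,linorder}"
  assumes s: "is_seq u" "is_seq v" and k: "k \<le> CARD('n)"
  obtains u' v' r where "is_seq u'" "is_seq v'" "level_image k u' v' = level_image k u v"
    "common_tilt 0 CARD('n) r u' v'"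
proof -
  let ?N = "CARD('n)"
  obtain u1 v1 r where R1: "reduces k 0 k u v u1 v1" "common_tilt 0 k r u1 v1"
    using ex_common_tilt_below[OF s k order_refl] by blast
  then have s1: "is_seq u1" "is_seq v1" by (auto simp: reduces_def)
  obtain u2 v2 r' where R2: "reduces k k ?N u1 v1 u2 v2" "common_tilt k ?N r' u2 v2"
    using ex_common_tilt_above[OF s1 k order_refl] by blast
  then have s2: "is_seq u2" "is_seq v2" by (auto simp: reduces_def)
  have t: "common_tilt 0 k r u2 v2"
    by (rule common_tilt_cong[OF R1(2)]) (use R2(1) in \<open>auto simp: reduces_def\<close>)
  have r': "tilt r' (u2 ` {..<k}) (v2 ` {..<k})" using R2(2) k by (auto simp: common_tilt_def)
  \<comment> \<open>The tilt of the upper window is also a tilt at level k, the upper end of the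
    lower window, which can therefore be retilted to it.\<close>
  obtain u3 v3 where R3: "reduces k 0 k u2 v2 u3 v3" "common_tilt 0 k r' u3 v3"
    using retilt[OF s2 _ k _ t, of k r'] r' by (auto simp: tilt_self)
  have "common_tilt k ?N r' u3 v3"
    by (rule common_tilt_cong[OF R2(2)]) (use R3(1) in \<open>auto simp: reduces_def\<close>)
  with R3 have "common_tilt 0 ?N r' u3 v3" by (blast intro: common_tilt_join)
  moreover have "level_image k u3 v3 = level_image k u v"
    using R1 R2 R3 by (simp add: reduces_def)
  ultimately show thesis using that R3(1) by (auto simp: reduces_def)
qed

section \<open>Lowering the common tilt to the least element\<close>

lemma tilted_redundant:
  fixes u v :: "nat \<Rightarrow> 'n::{finite,linorder}"
  assumes s: "is_seq u" "is_seq v" and i: "Suc i < CARD('n)"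
    and t: "tilt r (u ` {..<i}) (v ` {..<i})" "tilt r (u ` {..<Suc (Suc i)}) (v ` {..<Suc (Suc i)})"
    and n: "u (Suc i) \<notin> cyc_interval r (u i)" "v i \<notin> cyc_interval r (v (Suc i))"
    and G: "G \<in> nat_flags" "\<And>m. m \<le> CARD('n) \<Longrightarrow> m \<noteq> Suc i \<Longrightarrow> level_cond u v m (G m)"
  shows "G \<in> tilted u v"
proof -
  have "tilt r (u ` {..<Suc i}) (v ` {..<Suc i})" using tilt_middle[OF s i t] n by blast
  moreover have "cond r (u ` {..<Suc i}) (v ` {..<Suc i}) (G (Suc i))"
    unfolding image_lessThan_Suc[of _ i]
  proof (rule cond_redundant[where U = "G i" and W = "G (Suc (Suc i))", OF _ _ _ _ _ _ _ _ _ _ _ n])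
    show "u i \<notin> u ` {..<i}" "v i \<notin> v ` {..<i}" "u (Suc i) \<notin> insert (u i) (u ` {..<i})"
      "v (Suc i) \<notin> insert (v i) (v ` {..<i})"
      using s i is_seq_notin[OF s(1), of "Suc i" "Suc i"] is_seq_notin[OF s(2), of "Suc i" "Suc i"]
        is_seq_notin[OF s(1), of i i] is_seq_notin[OF s(2), of i i]
      by (simp_all add: image_lessThan_Suc)
    show "cond r (u ` {..<i}) (v ` {..<i}) (G i)"
      using G(2)[of i] t i by (simp add: level_cond_def)
    show "cond r (insert (u (Suc i)) (insert (u i) (u ` {..<i}))) (insert (v (Suc i)) (insert (v i) (v ` {..<i}))) (G (Suc (Suc i)))"
      using G(2)[of "Suc (Suc i)"] t i unfolding level_cond_def image_lessThan_Suc by simp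
  qed (use G(1) i in \<open>auto simp: nat_flags_def\<close>)
  ultimately have "level_cond u v (Suc i) (G (Suc i))"
    using G(1) i by (intro level_condI[OF s, of _ _ r]) (auto simp: nat_flags_def)
  then show ?thesis using G unfolding tilted_def by blast
qed

lemma ex_common_tilt_pred:
  fixes u v :: "nat \<Rightarrow> 'n::{finite,linorder}"
  assumes s: "is_seq u" "is_seq v" and k: "0 < k" "k \<le> CARD('n)"
    and t: "common_tilt 0 CARD('n) r u v" and c: "cyc_interval r c = - {c}"
  shows "\<exists>u' v'. is_seq u' \<and> is_seq v' \<and> level_image k u' v' = level_image k u v \<and>
    common_tilt 0 CARD('n) c u' v'"
proof -
  let ?N = "CARD('n)"
  have c_max: "c \<notin> cyc_interval r x" for x
    using cyc_interval_trans[of c r x c] cyc_interval_not_self[of c r] c by (cases "x = c") auto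
  have cc: "card (C \<inter> - {c}) + of_bool (c \<in> C) = card C" for C :: "'n set"
  proof -
    have "C - - {c} = (if c \<in> C then {c} else {})" by auto
    then show ?thesis using card_split[of C "- {c}"] by (simp split: if_splits)
  qed
  \<comment> \<open>The interval from r to c omits only c, which is the greatest element in the
    order shifted by r. Equal counts on this interval thus mean that c lies in both prefixes or in
    neither.\<close>
  have tc: "tilt c (x ` {..<m}) (y ` {..<m}) \<longleftrightarrow> (c \<in> x ` {..<m} \<longleftrightarrow> c \<in> y ` {..<m})"
    if "is_seq x" "is_seq y" "m \<le> ?N" "tilt r (x ` {..<m}) (y ` {..<m})" for x y :: "nat \<Rightarrow> 'n" and m
  proof -
    have card: "card (x ` {..<m}) = card (y ` {..<m})" using that by (simp add: is_seq_card)
    have "card (y ` {..<m} \<inter> - {c}) = card (x ` {..<m} \<inter> - {c}) \<longleftrightarrow>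
        (of_bool (c \<in> x ` {..<m}) :: nat) = of_bool (c \<in> y ` {..<m})"
      using cc[of "x ` {..<m}"] cc[of "y ` {..<m}"] card by linarith
    then show ?thesis unfolding tilt_eq_card[OF card that(4)] c of_bool_eq_iff by simp
  qed
  show ?thesis
  proof (cases "c \<in> u ` {..<k} \<longleftrightarrow> c \<in> v ` {..<k}")
    case True
    have tk: "tilt c (u ` {..<k}) (v ` {..<k})"
      using True tc[OF s k(2)] t k by (simp add: common_tilt_def)
    have t0: "common_tilt 0 k r u v" "common_tilt k ?N r u v"
      using t k by (auto simp: common_tilt_def)
    obtain u1 v1 where R1: "reduces k 0 k u v u1 v1" "common_tilt 0 k c u1 v1"
      using retilt[OF s _ k(2) _ t0(1), of k c] tk by (auto simp: tilt_self)
    then have s1: "is_seq u1" "is_seq v1" by (auto simp: reduces_def)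
    have t1: "common_tilt k ?N r u1 v1"
      by (rule common_tilt_cong[OF t0(2)]) (use R1(1) in \<open>auto simp: reduces_def\<close>)
    have "tilt c (u1 ` {..<k}) (v1 ` {..<k})" using R1(2) by (simp add: common_tilt_def)
    then obtain u2 v2 where R2: "reduces k k ?N u1 v1 u2 v2" "common_tilt k ?N c u2 v2"
      using retilt[OF s1 k(2) _ _ t1, of k c] s1 by (auto simp: tilt_self is_seq_UNIV)
    have "common_tilt 0 k c u2 v2"
      by (rule common_tilt_cong[OF R1(2)]) (use R2(1) in \<open>auto simp: reduces_def\<close>)
    with R2(2) have "common_tilt 0 ?N c u2 v2" by (blast intro: common_tilt_join)
    moreover have "level_image k u2 v2 = level_image k u v" using R1 R2 by (simp add: reduces_def)
    ultimately show ?thesis using R2(1) by (auto simp: reduces_def)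
  next
    case False
    \<comment> \<open>The tilt r at level k rules out that c lies in u[k] but not in v[k].\<close>
    have "card (v ` {..<k} \<inter> - {c}) \<le> card (u ` {..<k} \<inter> - {c})"
      using t k tilt_iff[of "u ` {..<k}" "v ` {..<k}" r] is_seq_card s c
      by (metis common_tilt_def le0)
    moreover from cc[of "u ` {..<k}"] cc[of "v ` {..<k}"]
    have "card (v ` {..<k} \<inter> - {c}) + of_bool (c \<in> v ` {..<k}) = card (u ` {..<k} \<inter> - {c}) + of_bool (c \<in> u ` {..<k})"
      using is_seq_card[OF s(1) k(2)] is_seq_card[OF s(2) k(2)] by linarith
    ultimately have ck: "c \<in> v ` {..<k}" "c \<notin> u ` {..<k}"
      using False by (auto split: if_splits)
    then have kN: "k < ?N" using is_seq_UNIV[OF s(1)] k by (metis UNIV_I le_neq_implies_less)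
    have t0: "common_tilt 0 k r u v" "common_tilt k ?N r u v"
      using t k by (auto simp: common_tilt_def)
    obtain u1 v1 where R1: "reduces k 0 k u v u1 v1" "common_tilt 0 k r u1 v1"
      and so1: "\<And>i. 0 \<le> i \<Longrightarrow> Suc i < k \<Longrightarrow> v1 i \<in> cyc_interval r (v1 (Suc i))"
      by (rule sort_second[OF s k(2) _ t0(1), of k]) auto
    then have s1: "is_seq u1" "is_seq v1" by (auto simp: reduces_def)
    have t1: "common_tilt k ?N r u1 v1"
      by (rule common_tilt_cong[OF t0(2)]) (use R1(1) in \<open>auto simp: reduces_def\<close>)
    obtain u2 v2 where R2: "reduces k k ?N u1 v1 u2 v2" "common_tilt k ?N r u2 v2"
      and so2: "\<And>i. k \<le> i \<Longrightarrow> Suc i < ?N \<Longrightarrow> u2 (Suc i) \<in> cyc_interval r (u2 i)"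
      by (rule sort_first[OF s1 order_refl _ t1, of k]) auto
    then have s2: "is_seq u2" "is_seq v2" by (auto simp: reduces_def)
    have e2: "u2 ` {..<m} = u1 ` {..<m} \<and> v2 ` {..<m} = v1 ` {..<m}" if "m \<le> k" for m
      using R2(1) that by (auto simp: reduces_def)
    have t2: "common_tilt 0 ?N r u2 v2"
      using common_tilt_join[OF common_tilt_cong[OF R1(2)] R2(2)] e2 by blast
    obtain i where i: "k = Suc i" using k by (cases k) auto
    have ck2: "c \<in> v2 ` {..<k}" "c \<notin> u2 ` {..<k}"
      using ck R1(1) e2[of k] by (auto simp: reduces_def)
    \<comment> \<open>Among the first k entries v1 is increasing, and the greatest element c can
      only stand last. In the same way c stands first in the decreasing part of u2 after position
      k.\<close>
    have v1i: "v1 p \<noteq> c" if "p < i" for p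
      using so1[of p] that i c_max by auto
    have ci: "c \<notin> v2 ` {..<i}" using e2[of i] v1i i by auto
    then have v2i: "v2 i = c" using ck2 i by (auto simp: image_lessThan_Suc)
    have u2p: "u2 p \<noteq> c" if p: "k < p" "p < ?N" for p
    proof -
      obtain q where "p = Suc q" "k \<le> q" using p(1) by (cases p) auto
      then show ?thesis using so2[of q] p(2) c_max[of "u2 q"] by auto
    qed
    have "c \<in> u2 ` {..<?N}" using is_seq_UNIV[OF s2(1)] by simp
    then obtain p where "p < ?N" "u2 p = c" by auto
    then have u2k: "u2 k = c" using u2p[of p] ck2(2) by (metis imageI lessThan_iff linorder_neqE_nat)
    have iN: "Suc i < ?N" using kN i by simp
    let ?u = "swap_adj u2 i" and ?v = "swap_adj v2 i"
    have s3: "is_seq ?u" "is_seq ?v" using is_seq_swap s2 iN by auto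
    have c3: "?u i = c" "?v (Suc i) = c" using u2k v2i i by simp_all
    have e3: "m \<noteq> Suc i \<Longrightarrow> ?u ` {..<m} = u2 ` {..<m}" "m \<noteq> Suc i \<Longrightarrow> ?v ` {..<m} = v2 ` {..<m}" for m
      by (simp_all add: swap_image)
    \<comment> \<open>Up to level i neither prefix contains c; from level k + 1 on both do. Level k
      = Suc i is the only one where they differ.\<close>
    have t3: "tilt c (u2 ` {..<m}) (v2 ` {..<m})" if "m \<le> ?N" "m \<noteq> Suc i" for m
    proof -
      have "c \<in> u2 ` {..<m} \<longleftrightarrow> c \<in> v2 ` {..<m}"
      proof (cases "m \<le> i")
        case True
        then have "{..<m} \<subseteq> {..<k}" "{..<m} \<subseteq> {..<i}" using i by auto
        then show ?thesis
          using ck2(2) ci image_mono[of "{..<m}" "{..<k}" u2] image_mono[of "{..<m}" "{..<i}" v2] by blast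
      next
        case False
        then have "k \<in> {..<m}" "i \<in> {..<m}" using that i by auto
        then show ?thesis using u2k v2i by (metis imageI)
      qed
      moreover have "tilt r (u2 ` {..<m}) (v2 ` {..<m})" using t2 that by (simp add: common_tilt_def)
      ultimately show ?thesis using tc[OF s2 that(1)] by blast
    qed
    have t2': "tilt r (u2 ` {..<i}) (v2 ` {..<i})" "tilt r (u2 ` {..<Suc (Suc i)}) (v2 ` {..<Suc (Suc i)})"
      using t2 iN by (auto simp: common_tilt_def)
    have t3': "tilt c (?u ` {..<i}) (?v ` {..<i})" "tilt c (?u ` {..<Suc (Suc i)}) (?v ` {..<Suc (Suc i)})"
      using t3[of i] t3[of "Suc (Suc i)"] iN e3 by simp_all
    have "tilt c (?u ` {..<Suc i}) (?v ` {..<Suc i})"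
      by (rule tilt_middle[OF s3 iN t3']) (unfold c3, simp)
    then have "common_tilt 0 ?N c ?u ?v"
      using t3 e3 unfolding common_tilt_def by metis
    moreover have lc: "level_cond ?u ?v m = level_cond u2 v2 m" if "m \<noteq> Suc i" for m
      unfolding level_cond_def e3[OF that] ..
    \<comment> \<open>The two varieties have the same conditions away from level k. At level k the
      condition is implied by the others on both sides: for u2, v2 because c is greatest in the
      order shifted by r, for the swapped sequences because c is least in the order shifted by
      c.\<close>
    have "tilted ?u ?v = tilted u2 v2"
    proof (intro equalityI subsetI)
      fix G assume G: "G \<in> tilted ?u ?v"
      show "G \<in> tilted u2 v2"
      proof (rule tilted_redundant[OF s2 iN t2'])
        show "u2 (Suc i) \<notin> cyc_interval r (u2 i)" "v2 i \<notin> cyc_interval r (v2 (Suc i))"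
          using u2k v2i c_max i by simp_all
        show "level_cond u2 v2 m (G m)" if "m \<le> ?N" "m \<noteq> Suc i" for m
        proof -
          have "level_cond ?u ?v m (G m)" using G that(1) by (simp add: tilted_def)
          then show ?thesis by (simp add: lc[OF that(2)])
        qed
      qed (use G in \<open>simp add: tilted_def\<close>)
    next
      fix G assume G: "G \<in> tilted u2 v2"
      show "G \<in> tilted ?u ?v"
      proof (rule tilted_redundant[OF s3 iN t3'])
        show "?u (Suc i) \<notin> cyc_interval c (?u i)" "?v i \<notin> cyc_interval c (?v (Suc i))"
          unfolding c3 by simp_all
        show "level_cond ?u ?v m (G m)" if "m \<le> ?N" "m \<noteq> Suc i" for m
        proof -
          have "level_cond u2 v2 m (G m)" using G that(1) by (simp add: tilted_def)
          then show ?thesis by (simp add: lc[OF that(2)])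
        qed
      qed (use G in \<open>simp add: tilted_def\<close>)
    qed
    then have "level_image k ?u ?v = level_image k u v"
      using R1(1) R2(1) by (simp add: reduces_def level_image_def)
    ultimately show ?thesis using s3 by blast
  qed
qed

lemma ex_common_tilt_Min:
  fixes u v :: "nat \<Rightarrow> 'n::{finite,linorder}"
  assumes s: "is_seq u" "is_seq v" and k: "0 < k" "k \<le> CARD('n)"
  obtains u' v' where "is_seq u'" "is_seq v'" "level_image k u' v' = level_image k u v"
    "common_tilt 0 CARD('n) (Min UNIV) u' v'"
proof -
  have "\<exists>u' v'. is_seq u' \<and> is_seq v' \<and> level_image k u' v' = level_image k u v \<and>
      common_tilt 0 CARD('n) (Min UNIV) u' v'"
    if "is_seq u" "is_seq v" "common_tilt 0 CARD('n) r u v" for r u and v :: "nat \<Rightarrow> 'n"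
    using that
  proof (induction "card {..<r}" arbitrary: r u v rule: less_induct)
    case less
    show ?case
    proof (cases "{..<r} = {}")
      case True
      then have "r = Min UNIV" by (intro Min_eqI[symmetric]) (auto, metis empty_iff lessThan_iff not_less)
      then show ?thesis using less.prems by blast
    next
      case False
      define c where "c = Max {..<r}"
      have cr: "c < r" "\<And>x. x < r \<Longrightarrow> x \<le> c" using False Max_in[of "{..<r}"] by (auto simp: c_def)
      have "x \<in> cyc_interval r c \<longleftrightarrow> x \<noteq> c" for x
        using cr(1) cr(2)[of x] by (cases "x < r") (auto simp: cyc_interval_def)
      then have "cyc_interval r c = - {c}" by blast
      then obtain u' v' where "is_seq u'" "is_seq v'" "level_image k u' v' = level_image k u v"
        "common_tilt 0 CARD('n) c u' v'"
        using ex_common_tilt_pred[OF less.prems(1,2) k less.prems(3)] by blast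
      moreover have "card {..<c} < card {..<r}"
        using cr(1) by (intro psubset_card_mono) (auto simp: psubset_eq)
      ultimately show ?thesis using less.hyps[of c u' v'] by metis
    qed
  qed
  then show thesis using ex_common_tilt[OF s k(2)] that by metis
qed

section \<open>Flags and matrices\<close>

lemma invertible_iff_inj: "invertible (M :: 'n::finite cmat) \<longleftrightarrow> inj ((*v) M)"
  by (simp add: invertible_left_inverse matrix_left_invertible_injective)

lemma invertible_iff_surj: "invertible (M :: 'n::finite cmat) \<longleftrightarrow> surj ((*v) M)"
  by (simp add: invertible_right_inverse matrix_right_invertible_surjective)

lemma dim_invertible_image:
  assumes "invertible (M :: 'n::finite cmat)"
  shows "vec.dim ((*v) M ` V) = vec.dim V"
  using assms unfolding invertible_iff_inj
  by (intro vec.dim_image_eq matrix_vector_mul_linear_gen) (auto intro: inj_on_subset)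

lemma subspace_matrix_image: "vec.subspace V \<Longrightarrow> vec.subspace ((*v) (M :: 'n::finite cmat) ` V)"
  by (rule vec.linear_subspace_image[OF matrix_vector_mul_linear_gen])

lemma subspace_eqI:
  assumes "vec.subspace S" "vec.subspace T" "S \<subseteq> T" "vec.dim T \<le> vec.dim (S :: 'n::finite cvec set)"
  shows "S = T"
  using vec.subspace_dim_equal[OF assms] .

lemma span_axes: "vec.span ((\<lambda>i. axis i 1) ` T) = (coord T :: 'n::finite cvec set)"
proof (intro equalityI)
  show "vec.span ((\<lambda>i. axis i 1) ` T) \<subseteq> (coord T :: 'n cvec set)"
    by (rule vec.span_minimal[OF _ subspace_coord]) (auto simp: coord_def axis_def)
  show "coord T \<subseteq> vec.span ((\<lambda>i. axis i 1) ` T :: 'n cvec set)"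
  proof
    fix x :: "'n cvec" assume x: "x \<in> coord T"
    have "(\<Sum>i\<in>UNIV. x $ i *s axis i 1) \<in> vec.span ((\<lambda>i. axis i 1) ` T)"
    proof (rule vec.span_sum)
      fix i
      show "x $ i *s axis i 1 \<in> vec.span ((\<lambda>i. axis i 1) ` T)"
      proof (cases "i \<in> T")
        case True
        then show ?thesis by (rule vec.span_scale[OF vec.span_base[OF imageI]])
      next
        case False
        then show ?thesis using x by (simp add: coord_def vec.span_zero)
      qed
    qed
    then show "x \<in> vec.span ((\<lambda>i. axis i 1) ` T)" by (simp add: basis_expansion)
  qed
qed

lemma flag_of_mult:
  fixes M g :: "'n::{finite,linorder} cmat"
  shows "flag_of (M ** g) k = (*v) M ` flag_of g k"
proof -
  have "column j (M ** g) = M *v column j g" for j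
    by (simp add: vec_eq_iff column_def matrix_matrix_mult_def matrix_vector_mult_def)
  then have "{column j (M ** g) |j. j \<le> k} = (*v) M ` {column j g |j. j \<le> k}" by auto
  then show ?thesis
    unfolding flag_of_def by (simp add: vec.linear_span_image[OF matrix_vector_mul_linear_gen])
qed

lemma flag_of_perm_matrix:
  fixes w :: "'n::{finite,linorder} \<Rightarrow> 'n"
  shows "flag_of (perm_matrix w) k = coord (w ` {..k})"
proof -
  have "column j (perm_matrix w) = axis (w j) 1" for j
    by (simp add: vec_eq_iff column_def perm_matrix_def axis_def)
  then have "{column j (perm_matrix w) |j. j \<le> k} = (\<lambda>i. axis i 1) ` w ` {..k}" by auto
  then show ?thesis unfolding flag_of_def by (simp add: span_axes)
qed

lemma flag_of_mat_1: "flag_of (mat 1) k = coord {..k :: 'n::{finite,linorder}}"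
proof -
  have "(mat 1 :: 'n cmat) = perm_matrix id" by (simp add: mat_def perm_matrix_def vec_eq_iff)
  then show ?thesis by (simp add: flag_of_perm_matrix)
qed

lemma flag_of_eq: "flag_of M k = (*v) M ` coord {..k :: 'n::{finite,linorder}}"
  using flag_of_mult[of M "mat 1" k] by (simp add: flag_of_mat_1)

lemma FlD:
  assumes "F \<in> Fl"
  shows "vec.subspace (F k)" "vec.dim (F k) = card {..k}" "j \<le> k \<Longrightarrow> F j \<subseteq> F k"
  using assms by (auto simp: Fl_def Grassmannian_def)

lemma flag_of_in_Fl: "invertible M \<Longrightarrow> flag_of M \<in> Fl"
  unfolding Fl_def Grassmannian_def
  by (auto simp: flag_of_eq dim_invertible_image dim_coord subspace_matrix_image subspace_coord)
    (meson atMost_subset_iff coord_mono image_mono imageI subsetD)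

lemma invertible_if_flag_of_UNIV: "flag_of M k = UNIV \<Longrightarrow> invertible M"
  unfolding invertible_iff_surj by (auto simp: flag_of_eq)

lemma invertible_perm_matrix:
  assumes "bij (w :: 'n::{finite,linorder} \<Rightarrow> 'n)"
  shows "invertible (perm_matrix w)"
proof (rule invertible_if_flag_of_UNIV[of _ "Max UNIV"])
  have "{..Max UNIV :: 'n} = UNIV" by auto
  then show "flag_of (perm_matrix w) (Max UNIV) = UNIV"
    using assms by (simp add: flag_of_perm_matrix coord_UNIV bij_is_surj)
qed

text \<open>The member of the flag one dimension lower. The zero space has no index of its own when
  levels are indexed by the elements of the type.\<close>

definition below :: "'n::{finite,linorder} flag \<Rightarrow> 'n \<Rightarrow> 'n cvec set"
  where "below F j = (if {..<j} = {} then {0} else F (Max {..<j}))"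

lemma atMost_Max_lessThan:
  assumes "{..<j} \<noteq> {}" shows "{..Max {..<j}} = {..<j :: 'n::{finite,linorder}}"
proof -
  have "Max {..<j} < j" using Max_in[OF _ assms] by simp
  then have "x \<le> Max {..<j} \<longleftrightarrow> x < j" for x
    using Max_ge[of "{..<j}" x] by (meson finite le_less_trans lessThan_iff)
  then show ?thesis by auto
qed

lemma card_atMost_Suc: "card {..j :: 'n::{finite,linorder}} = Suc (card {..<j})"
  by (simp add: lessThan_Suc_atMost[symmetric] ivl_disj_un_singleton(2)[symmetric] card_Un_disjoint)

lemma below:
  assumes "F \<in> Fl"
  shows "vec.subspace (below F j)" "vec.dim (below F j) = card {..<j}" "below F j \<subseteq> F j"
    "i < j \<Longrightarrow> F i \<subseteq> below F j"
proof -
  show "vec.subspace (below F j)" using FlD[OF assms] by (simp add: below_def)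
  show "vec.dim (below F j) = card {..<j}"
    using FlD[OF assms] atMost_Max_lessThan[of j] by (auto simp: below_def)
  show "below F j \<subseteq> F j"
  proof (cases "{..<j} = {}")
    case False
    then have "Max {..<j} \<le> j" using Max_in[of "{..<j}"] by auto
    then show ?thesis using FlD(3)[OF assms] False by (simp add: below_def)
  qed (use FlD(1)[OF assms] vec.subspace_0 in \<open>auto simp: below_def\<close>)
  show "F i \<subseteq> below F j" if "i < j"
    using FlD(3)[OF assms, of i "Max {..<j}"] that by (auto simp: below_def)
qed

text \<open>Column k is any vector of F k outside of the next smaller member; dimensions then force
  equality level by level.\<close>

lemma ex_flag_of:
  assumes F: "F \<in> Fl"
  obtains M :: "'n::{finite,linorder} cmat" where "invertible M" "flag_of M = F"
proof -
  have "\<exists>x. x \<in> F k \<and> x \<notin> below F k" for k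
  proof -
    have "\<not> F k \<subseteq> below F k"
      using vec.dim_subset[of "F k" "below F k"] below(2)[OF F] FlD(2)[OF F] by (auto simp: card_atMost_Suc)
    then show ?thesis by blast
  qed
  then obtain x where x: "\<And>k. x k \<in> F k" "\<And>k. x k \<notin> below F k" by metis
  define M :: "'n cmat" where "M = (\<chi> i j. x j $ i)"
  have col: "column j M = x j" for j by (simp add: M_def column_def vec_eq_iff)
  have sub: "vec.subspace (flag_of M k)" for k unfolding flag_of_def by simp
  have xM: "x j \<in> flag_of M k" if "j \<le> k" for j k
    unfolding flag_of_def using that by (auto simp: col intro!: vec.span_base)
  have eq: "flag_of M k = F k" for k
  proof (induction "card {..<k}" arbitrary: k rule: less_induct)
    case less
    have "below F k \<subseteq> flag_of M k"
    proof (cases "{..<k} = {}")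
      case False
      then have m: "Max {..<k} < k" using Max_in[of "{..<k}"] by auto
      then have "card {..<Max {..<k}} < card {..<k}"
        by (intro psubset_card_mono) (auto simp: psubset_eq)
      then have "below F k = flag_of M (Max {..<k})" using less False by (simp add: below_def)
      also have "\<dots> \<subseteq> flag_of M k"
        unfolding flag_of_eq using m by (intro image_mono coord_mono) auto
      finally show ?thesis .
    qed (use vec.subspace_0[OF sub] in \<open>auto simp: below_def\<close>)
    then have "insert (x k) (below F k) \<subseteq> flag_of M k" using xM by auto
    then have "vec.dim (insert (x k) (below F k)) \<le> vec.dim (flag_of M k)" by (rule vec.dim_subset)
    moreover have sp: "vec.span (below F k) = below F k" using below(1)[OF F] by simp
    then have "vec.dim (insert (x k) (below F k)) = card {..k}"
      using x(2)[of k] below(2)[OF F] unfolding vec.dim_insert sp by (simp add: card_atMost_Suc)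
    moreover have "flag_of M k \<subseteq> F k"
      unfolding flag_of_def using FlD(1)[OF F] subsetD[OF FlD(3)[OF F] x(1)]
      by (intro vec.span_minimal) (auto simp: col)
    ultimately show ?case
      using FlD[OF F] sub by (intro subspace_eqI) auto
  qed
  have "F (Max UNIV) = UNIV"
  proof (rule subspace_eqI)
    have "{..Max UNIV :: 'n} = UNIV" by auto
    then show "vec.dim (UNIV :: 'n cvec set) \<le> vec.dim (F (Max UNIV))"
      using FlD(2)[OF F, of "Max UNIV"] by (simp only: vec_dim_card)
  qed (use FlD[OF F] in auto)
  then have "invertible M" using invertible_if_flag_of_UNIV[of M "Max UNIV"] eq by simp
  then show thesis using that eq by blast
qed

section \<open>Polynomial functions\<close>

lemma poly_fun_sum: "finite A \<Longrightarrow> (\<And>a. a \<in> A \<Longrightarrow> f a \<in> poly_fun) \<Longrightarrow> (\<lambda>M. \<Sum>a\<in>A. f a M) \<in> poly_fun"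
  by (induction A rule: finite_induct) (auto intro: poly_fun.intros)

lemma poly_fun_prod: "finite A \<Longrightarrow> (\<And>a. a \<in> A \<Longrightarrow> f a \<in> poly_fun) \<Longrightarrow> (\<lambda>M. \<Prod>a\<in>A. f a M) \<in> poly_fun"
  by (induction A rule: finite_induct) (auto intro: poly_fun.intros)

lemma poly_fun_det:
  fixes A :: "'n::finite cmat \<Rightarrow> 'n cmat"
  assumes "\<And>i j. (\<lambda>M. A M $ i $ j) \<in> poly_fun"
  shows "(\<lambda>M. det (A M)) \<in> poly_fun"
  unfolding det_def
  by (intro poly_fun_sum poly_fun.mult poly_fun_prod poly_fun.const assms) (auto simp: finite_permutations)

lemma poly_fun_mult_right:
  assumes "p \<in> poly_fun" shows "(\<lambda>M. p (M ** g)) \<in> poly_fun"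
  using assms
proof induction
  case (entry i j)
  have "(\<lambda>M. \<Sum>k\<in>UNIV. M $ i $ k * g $ k $ j) \<in> poly_fun"
    by (intro poly_fun_sum poly_fun.mult poly_fun.const poly_fun.entry) auto
  then show ?case by (simp add: matrix_matrix_mult_def)
qed (auto intro: poly_fun.intros)

lemma continuous_poly_fun:
  fixes p :: "'n::finite cmat \<Rightarrow> complex"
  assumes "p \<in> poly_fun" shows "continuous_on UNIV p"
  using assms by induction (auto intro!: continuous_intros)

text \<open>Minors, written as determinants of square matrices in which arbitrary constant columns replace
  the columns outside of \<open>J\<close>.\<close>

lemma rank_le_iff_det:
  fixes A :: "'n::finite cmat"
  shows "rank A \<le> m \<longleftrightarrow>
    (\<forall>J (c :: 'n cmat). m < card J \<longrightarrow> det (\<chi> i j. if j \<in> J then A $ i $ j else c $ i $ j) = 0)"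
proof (intro iffI allI impI)
  fix J :: "'n set" and c :: "'n cmat" assume m: "rank A \<le> m" "m < card J"
  let ?D = "(\<chi> i j. if j \<in> J then A $ i $ j else c $ i $ j) :: 'n cmat"
  show "det ?D = 0"
  proof (rule ccontr)
    assume "det ?D \<noteq> 0"
    then have inv: "invertible ?D" by (simp add: invertible_det_nz)
    have "?D *v x = A *v x" if "x \<in> coord J" for x
      using that by (auto simp: vec_eq_iff matrix_vector_mult_def coord_def intro!: sum.cong)
    then have "(*v) ?D ` coord J \<subseteq> vec.span (columns A)"
      using matrix_vector_mult_in_columnspace_gen[of A] by auto
    then have "vec.dim ((*v) ?D ` coord J) \<le> vec.dim (columns A)" by (rule vec.dim_mono)
    then show False
      using m by (simp add: dim_invertible_image[OF inv] dim_coord rank_eq_dim_columns)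
  qed
next
  assume *: "\<forall>J (c :: 'n cmat). m < card J \<longrightarrow> det (\<chi> i j. if j \<in> J then A $ i $ j else c $ i $ j) = 0"
  show "rank A \<le> m"
  proof (rule ccontr)
    assume "\<not> rank A \<le> m"
    obtain B where B: "B \<subseteq> columns A" "vec.independent B" "columns A \<subseteq> vec.span B"
        "card B = vec.dim (columns A)"
      using vec.basis_exists by blast
    have fB: "finite B" using B(2) vec.independent_bound_general by blast
    have "\<exists>f. \<forall>b\<in>B. column (f b) A = b" using B(1) by (intro bchoice) (auto simp: columns_def)
    then obtain f where f: "\<And>b. b \<in> B \<Longrightarrow> column (f b) A = b" by blast
    have inj: "inj_on f B" by (metis f inj_onI)
    define J where "J = f ` B"
    have cJ: "card J = card B" unfolding J_def by (rule card_image[OF inj])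
    \<comment> \<open>The vectors that complete a basis of the column space to a basis of the whole
      space fill the columns outside of J, giving an invertible matrix.\<close>
    obtain B' where B': "B \<subseteq> B'" "vec.independent B'" "UNIV \<subseteq> vec.span B'"
      using vec.maximal_independent_subset_extend[of B UNIV] B(2) by auto
    have fB': "finite B'" using B'(2) vec.independent_bound_general by blast
    have "card B' = CARD('n)"
      using vec.basis_card_eq_dim[of B' UNIV] B' by (simp add: vec_dim_card del: vec.dim_UNIV)
    then have "card (B' - B) = card (- J)"
      using B'(1) fB cJ by (simp add: card_Diff_subset Compl_eq_Diff_UNIV)
    then obtain g where g: "bij_betw g (- J) (B' - B)"
      using fB' by (metis finite finite_Diff finite_same_card_bij)
    define D :: "'n cmat" where "D = (\<chi> i j. if j \<in> J then A $ i $ j else (\<chi> i j. g j $ i) $ i $ j)"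
    have col: "column j D = (if j \<in> J then column j A else g j)" for j
      by (simp add: D_def column_def vec_eq_iff)
    have "B' \<subseteq> columns D"
    proof
      fix b assume b: "b \<in> B'"
      show "b \<in> columns D"
      proof (cases "b \<in> B")
        case True
        then have "b = column (f b) D" using f col by (simp add: J_def)
        then show ?thesis unfolding columns_def by blast
      next
        case False
        then have "b \<in> g ` (- J)" using g b by (simp add: bij_betw_def)
        then obtain j where "j \<notin> J" "b = g j" by auto
        then have "b = column j D" using col by simp
        then show ?thesis unfolding columns_def by blast
      qed
    qed
    then have "vec.span (columns D) = UNIV" using B'(3) vec.span_mono by blast
    then have "invertible D"
      by (simp add: invertible_right_inverse matrix_right_invertible_span_columns)
    then show False
      using * \<open>\<not> rank A \<le> m\<close> cJ B(4) invertible_det_nz[of D] by (auto simp: rank_eq_dim_columns D_def)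
  qed
qed

section \<open>Closed sets of flags\<close>

lemma cdim_flag_of_ge_iff:
  fixes M :: "'n::{finite,linorder} cmat"
  assumes "invertible M" "a \<le> card {..k}"
  shows "a \<le> cdim (flag_of M k) T \<longleftrightarrow> rank (submat M (- T) {..k}) \<le> card {..k} - a"
proof -
  have "rank (submat M (- T) {..k}) + cdim (flag_of M k) T = card {..k}"
    using rank_plus_cdim[OF FlD(1)[OF flag_of_in_Fl[OF assms(1)]], of "- T" k] assms(1)
    by (simp add: rank_submat FlD(2)[OF flag_of_in_Fl])
  then show ?thesis using assms(2) by linarith
qed

text \<open>Lower bounds on intersection dimensions are upper bounds on ranks, hence vanishing of
  minors. The hypothesis on a keeps the subtraction of natural numbers exact.\<close>

lemma zariski_closed_cdim:
  fixes a :: "'n::{finite,linorder} \<Rightarrow> 'n set \<Rightarrow> nat"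
  assumes "\<And>k T. a k T \<le> card {..k}"
  shows "zariski_closed {F \<in> Fl. \<forall>k T. T \<in> C \<longrightarrow> a k T \<le> cdim (F k) T}"
proof -
  define P where "P = {(\<lambda>M. det (\<chi> i j. if j \<in> J then submat M (- T) {..k} $ i $ j else c $ i $ j)) | k T J c.
      T \<in> C \<and> card {..k} - a k T < card J}"
  have "(\<lambda>M :: 'n cmat. det (\<chi> i j. if j \<in> J then submat M S K $ i $ j else c $ i $ j)) \<in> poly_fun" for J S K and c :: "'n cmat"
  proof (rule poly_fun_det)
    show "(\<lambda>M. (\<chi> i j. if j \<in> J then submat M S K $ i $ j else c $ i $ j) $ i $ j) \<in> poly_fun" for i j
      by (cases "j \<in> J"; cases "i \<in> S \<and> j \<in> K") (auto simp: submat_def intro: poly_fun.intros)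
  qed
  then have "P \<subseteq> poly_fun" by (auto simp: P_def)
  moreover have "flag_of M \<in> {F \<in> Fl. \<forall>k T. T \<in> C \<longrightarrow> a k T \<le> cdim (F k) T} \<longleftrightarrow> (\<forall>p\<in>P. p M = 0)"
    if M: "invertible M" for M
    using flag_of_in_Fl[OF M] unfolding P_def
    by (simp add: cdim_flag_of_ge_iff[OF M assms] rank_le_iff_det) blast
  ultimately show ?thesis unfolding zariski_closed_def by blast
qed

text \<open>The flags that differ from the flag of M at most at level j are those of M g, where g
  runs through the parabolic subgroup S. For each fixed g the map M to M g is polynomial, so the set
  is cut out by the equations p (M g) = 0 for all g at once.\<close>

lemma zariski_closed_forget_level:
  fixes Z :: "'n::{finite,linorder} flag set"
  assumes "zariski_closed Z"
  shows "zariski_closed {F \<in> Fl. \<forall>F'\<in>Fl. (\<forall>k. k \<noteq> j \<longrightarrow> F' k = F k) \<longrightarrow> F' \<in> Z}" (is "zariski_closed ?Z")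
proof -
  obtain P where P: "P \<subseteq> poly_fun" "\<And>M. invertible M \<Longrightarrow> flag_of M \<in> Z \<longleftrightarrow> (\<forall>p\<in>P. p M = 0)"
    using assms by (auto simp: zariski_closed_def)
  define S :: "'n cmat set" where "S = {g. invertible g \<and> (\<forall>k. k \<noteq> j \<longrightarrow> flag_of g k = flag_of (mat 1) k)}"
  define Q where "Q = (\<lambda>(p, g) M. p (M ** g)) ` (P \<times> S)"
  have "Q \<subseteq> poly_fun" using P(1) poly_fun_mult_right by (auto simp: Q_def)
  moreover have "flag_of M \<in> ?Z \<longleftrightarrow> (\<forall>q\<in>Q. q M = 0)" if M: "invertible M" for M
  proof -
    have "flag_of M \<in> ?Z \<longleftrightarrow> (\<forall>g\<in>S. flag_of (M ** g) \<in> Z)"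
    proof (intro iffI ballI)
      fix g assume "flag_of M \<in> ?Z" "g \<in> S"
      moreover have "flag_of (M ** g) k = flag_of M k" if "k \<noteq> j" for k
        using \<open>g \<in> S\<close> that flag_of_mult[of M "mat 1" k] by (simp add: flag_of_mult S_def)
      ultimately show "flag_of (M ** g) \<in> Z"
        using M by (auto simp: S_def intro!: flag_of_in_Fl invertible_mult)
    next
      assume *: "\<forall>g\<in>S. flag_of (M ** g) \<in> Z"
      have "F \<in> Z" if F: "F \<in> Fl" "\<And>k. k \<noteq> j \<Longrightarrow> F k = flag_of M k" for F
      proof -
        obtain N where N: "invertible N" "flag_of N = F" using ex_flag_of[OF F(1)] .
        obtain M' where M': "M ** M' = mat 1" "M' ** M = mat 1" using M by (auto simp: invertible_def)
        then have "invertible M'" by (auto simp: invertible_def)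
        moreover have "flag_of (M' ** N) k = flag_of (mat 1) k" if "k \<noteq> j" for k
        proof -
          have "flag_of (M' ** N) k = (*v) M' ` flag_of M k"
            using N(2) F(2)[OF that] by (simp add: flag_of_mult)
          then show ?thesis by (simp add: flag_of_mult[symmetric] M')
        qed
        ultimately have "M' ** N \<in> S" using N(1) by (simp add: S_def invertible_mult)
        then have "flag_of (M ** (M' ** N)) \<in> Z" using * by blast
        then show "F \<in> Z" using N(2) by (simp add: matrix_mul_assoc M')
      qed
      then show "flag_of M \<in> ?Z" using flag_of_in_Fl[OF M] by blast
    qed
    also have "\<dots> \<longleftrightarrow> (\<forall>q\<in>Q. q M = 0)"
    proof -
      have "flag_of (M ** g) \<in> Z \<longleftrightarrow> (\<forall>p\<in>P. p (M ** g) = 0)" if "g \<in> S" for g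
        using that M by (intro P(2)) (auto simp: S_def intro: invertible_mult)
      then show ?thesis unfolding Q_def by auto
    qed
    finally show ?thesis .
  qed
  ultimately show ?thesis unfolding zariski_closed_def by blast
qed

section \<open>Closures of Schubert cells\<close>

text \<open>The identity plus t times the matrix unit at (a, b), written so that continuity in t is
  immediate.\<close>

definition shear :: "'n \<Rightarrow> 'n \<Rightarrow> complex \<Rightarrow> 'n::finite cmat"
  where "shear a b t = (\<chi> i l. (if i = l then 1 else 0) + t * (if i = a \<and> l = b then 1 else 0))"

lemma shear_mult: "shear a b t *v x = x + (t * x $ b) *s axis a 1"
proof -
  have "(\<Sum>l\<in>UNIV. ((if i = l then 1 else 0) + t * (if i = a \<and> l = b then 1 else 0)) * x $ l) =
      x $ i + (if i = a then t * x $ b else 0)" for i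
    by (cases "i = a") (simp_all add: distrib_right sum.distrib if_distrib[of "\<lambda>c. _ * c"]
      if_distrib[of "\<lambda>c. c * _"] cong: if_cong)
  then show ?thesis
    by (simp add: vec_eq_iff matrix_vector_mult_def shear_def axis_def)
qed

lemma invertible_mat_1: "invertible (mat 1 :: 'n::finite cmat)"
  by (simp add: invertible_iff_inj inj_on_def)

lemma shear_0: "shear a b 0 = mat 1"
  by (simp add: shear_def mat_def vec_eq_iff)

lemma invertible_shear:
  assumes "a \<noteq> b" shows "invertible (shear a b t)"
  unfolding invertible_iff_inj
proof (rule injI)
  fix x y assume e: "shear a b t *v x = shear a b t *v y"
  have "(shear a b t *v z) $ b = z $ b" for z
    using assms by (simp add: shear_mult axis_def)
  then have "x $ b = y $ b" using e by metis
  with e show "x = y" by (simp add: shear_mult)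
qed

lemma shear_coord_image:
  assumes "a \<noteq> b" "b \<in> T \<longrightarrow> a \<in> T"
  shows "(*v) (shear a b t) ` coord T = coord T"
proof (rule subspace_eqI)
  show "(*v) (shear a b t) ` coord T \<subseteq> coord T"
    using assms(2) by (auto simp: shear_mult coord_def axis_def)
qed (simp_all add: subspace_matrix_image subspace_coord dim_invertible_image[OF invertible_shear[OF assms(1)]])

text \<open>With L the order (<) or (>) on the rows, one argument treats Schubert cells and opposite
  Schubert cells; the order of the columns is fixed.\<close>

locale row_order =
  fixes L :: "'n::{finite,linorder} \<Rightarrow> 'n \<Rightarrow> bool"
  assumes L_trans: "L x y \<Longrightarrow> L y z \<Longrightarrow> L x z"
    and L_irrefl: "\<not> L x x"
    and L_total: "x \<noteq> y \<Longrightarrow> L x y \<or> L y x"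
begin

definition row_borel :: "'n cmat set"
  where "row_borel = {M. invertible M \<and> (\<forall>i j. L j i \<longrightarrow> M $ i $ j = 0)}"

definition row_cell :: "('n \<Rightarrow> 'n) \<Rightarrow> 'n flag set"
  where "row_cell w = {flag_of (b ** perm_matrix w ** c) | b c. b \<in> row_borel \<and> c \<in> borel_upper}"

definition down :: "'n set \<Rightarrow> bool"
  where "down T \<longleftrightarrow> (\<forall>x y. y \<in> T \<longrightarrow> L x y \<longrightarrow> x \<in> T)"

text \<open>Rank conditions with respect to the coordinate subspaces stable under
  \<open>row_borel\<close>, with the values taken at the coordinate flag of w.\<close>

definition row_variety :: "('n \<Rightarrow> 'n) \<Rightarrow> 'n flag set"
  where "row_variety w = {F \<in> Fl. \<forall>k T. down T \<longrightarrow> card (w ` {..k} \<inter> T) \<le> cdim (F k) T}"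

lemma down_chain:
  assumes "down S" "down T" shows "S \<subseteq> T \<or> T \<subseteq> S"
proof (rule ccontr)
  assume "\<not> ?thesis"
  then obtain x y where "x \<in> S" "x \<notin> T" "y \<in> T" "y \<notin> S" by blast
  moreover from this have "L x y \<or> L y x" by (metis L_total)
  ultimately show False using assms by (auto simp: down_def)
qed

lemma row_borel_coord_image:
  assumes "b \<in> row_borel" "down T"
  shows "(*v) b ` coord T = coord T"
proof (rule subspace_eqI)
  have b: "invertible b" "\<And>i j. L j i \<Longrightarrow> b $ i $ j = 0" using assms(1) by (auto simp: row_borel_def)
  show "(*v) b ` coord T \<subseteq> coord T"
  proof clarify
    fix x assume x: "x \<in> coord T"
    have "b $ i $ j * x $ j = 0" if "i \<notin> T" for i j
    proof (cases "j \<in> T")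
      case True
      then have "L j i" using that assms(2) L_total by (metis down_def)
      then show ?thesis using b by simp
    qed (use x in \<open>simp add: coord_def\<close>)
    then show "b *v x \<in> coord T"
      by (simp add: coord_def matrix_vector_mult_def sum.neutral)
  qed
  show "vec.dim (coord T) \<le> vec.dim ((*v) b ` coord T)" using b by (simp add: dim_invertible_image)
qed (simp_all add: subspace_matrix_image subspace_coord)

lemma mat_1_row_borel: "mat 1 \<in> row_borel"
  using L_irrefl invertible_mat_1 by (auto simp: row_borel_def mat_def[of 1])

lemma shear_row_borel:
  assumes "L a b" shows "shear a b t \<in> row_borel"
proof -
  have "a \<noteq> b" using assms L_irrefl by blast
  moreover have "shear a b t $ i $ j = 0" if "L j i" for i j
    using that assms L_irrefl L_trans by (auto simp: shear_def)
  ultimately show ?thesis by (simp add: row_borel_def invertible_shear)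
qed

lemma row_borel_mult:
  assumes "b \<in> row_borel" "c \<in> row_borel"
  shows "b ** c \<in> row_borel"
proof -
  have "b $ i $ l * c $ l $ j = 0" if "L j i" for i j l
  proof (rule ccontr)
    assume "b $ i $ l * c $ l $ j \<noteq> 0"
    then have "\<not> L l i" "\<not> L j l" using assms by (auto simp: row_borel_def)
    then show False using that L_trans L_total L_irrefl by metis
  qed
  then have "(b ** c) $ i $ j = 0" if "L j i" for i j
    using that unfolding matrix_matrix_mult_def by (simp add: sum.neutral)
  moreover have "invertible (b ** c)" using assms by (simp add: row_borel_def invertible_mult)
  ultimately show ?thesis by (simp add: row_borel_def)
qed

lemma flag_of_borel_upper:
  assumes "c \<in> borel_upper" shows "flag_of (M ** c) = flag_of M"
proof
  fix k
  have c: "invertible c" "\<And>i j. j < i \<Longrightarrow> c $ i $ j = 0" using assms by (auto simp: borel_upper_def)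
  have "(*v) c ` coord {..k} = coord {..k}"
  proof (rule subspace_eqI)
    show "(*v) c ` coord {..k} \<subseteq> coord {..k}"
    proof clarify
      fix x assume x: "x \<in> coord {..k}"
      have "c $ i $ j * x $ j = 0" if "i \<notin> {..k}" for i j
        using x c(2)[of j i] that by (cases "j \<le> k") (auto simp: coord_def)
      then show "c *v x \<in> coord {..k}"
        by (simp add: coord_def matrix_vector_mult_def sum.neutral)
    qed
  qed (simp_all add: subspace_matrix_image subspace_coord dim_invertible_image[OF c(1)])
  then have "flag_of c k = coord {..k}" using flag_of_eq[of c k] by simp
  then show "flag_of (M ** c) k = flag_of M k"
    using flag_of_mult[of M c k] flag_of_eq[of M k] by simp
qed

text \<open>The upper triangular factor on the right does not change the flag, so the cell is the
  orbit of the coordinate flag of w.\<close>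

lemma row_cell_eq: "row_cell w = {(\<lambda>k. (*v) b ` coord (w ` {..k})) | b. b \<in> row_borel}"
proof -
  have fl: "flag_of (b ** perm_matrix w ** c) = (\<lambda>k. (*v) b ` coord (w ` {..k}))" if "c \<in> borel_upper" for b c
    using that by (simp add: flag_of_borel_upper fun_eq_iff flag_of_mult flag_of_perm_matrix)
  have m: "mat 1 \<in> borel_upper"
    using invertible_mat_1 by (auto simp: borel_upper_def mat_def[of 1])
  show ?thesis
  proof (intro equalityI subsetI)
    fix F assume "F \<in> row_cell w"
    then show "F \<in> {(\<lambda>k. (*v) b ` coord (w ` {..k})) | b. b \<in> row_borel}"
      unfolding row_cell_def using fl by blast
  next
    fix F assume "F \<in> {(\<lambda>k. (*v) b ` coord (w ` {..k})) | b. b \<in> row_borel}"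
    then obtain b where "b \<in> row_borel" "F = flag_of (b ** perm_matrix w ** mat 1)"
      using fl[OF m] by auto
    then show "F \<in> row_cell w" unfolding row_cell_def using m by blast
  qed
qed

lemma image_flag_in_Fl:
  fixes w :: "'n \<Rightarrow> 'n"
  assumes "bij w" "invertible b"
  shows "(\<lambda>k. (*v) b ` coord (w ` {..k})) \<in> Fl"
proof -
  have "flag_of (b ** perm_matrix w) = (\<lambda>k. (*v) b ` coord (w ` {..k}))"
    by (simp add: fun_eq_iff flag_of_mult flag_of_perm_matrix)
  then show ?thesis
    using flag_of_in_Fl[of "b ** perm_matrix w"] assms by (simp add: invertible_mult invertible_perm_matrix)
qed

lemma row_cell_subset:
  assumes "bij w" shows "row_cell w \<subseteq> row_variety w"
proof
  fix F assume "F \<in> row_cell w"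
  then obtain b where b: "b \<in> row_borel" "F = (\<lambda>k. (*v) b ` coord (w ` {..k}))" by (auto simp: row_cell_eq)
  then have inv: "invertible b" by (simp add: row_borel_def)
  have "card (w ` {..k} \<inter> T) \<le> cdim (F k) T" if "down T" for k T
  proof -
    have "(*v) b ` coord (w ` {..k} \<inter> T) \<subseteq> F k \<inter> coord T"
      using row_borel_coord_image[OF b(1) that] coord_Int[of "w ` {..k}" T] unfolding b(2) by blast
    then have "vec.dim ((*v) b ` coord (w ` {..k} \<inter> T)) \<le> cdim (F k) T"
      unfolding cdim_def by (rule vec.dim_subset)
    then show ?thesis by (simp add: dim_invertible_image[OF inv] dim_coord)
  qed
  then show "F \<in> row_variety w"
    using image_flag_in_Fl[OF assms inv] b(2) by (simp add: row_variety_def)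
qed

lemma zariski_closed_row_variety: "zariski_closed (row_variety w)"
proof -
  have "card (w ` {..k} \<inter> T) \<le> card {..k}" for k T
    by (metis card_image_le card_mono finite finite_imageI inf_le1 order_trans)
  then show ?thesis
    using zariski_closed_cdim[of "\<lambda>k T. card (w ` {..k} \<inter> T)" "Collect down"] by (simp add: row_variety_def)
qed

section \<open>One level forgotten over a shorter cell\<close>

context
  fixes w :: "'n \<Rightarrow> 'n" and j j' :: 'n
  assumes w: "bij w" and jj': "j < j'" "{j<..<j'} = {}" and desc: "L (w j') (w j)"
begin

abbreviation "w_swapped \<equiv> w \<circ> Transposition.transpose j j'"

lemma level_cases: "k < j \<or> k = j \<or> j' \<le> k"
  using jj'(2) by (metis empty_iff greaterThanLessThan_iff linorder_neqE not_less)

lemma desc_values_neq: "w j \<noteq> w j'"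
  using desc L_irrefl by metis

lemma image_swap: "k \<noteq> j \<Longrightarrow> w_swapped ` {..k} = w ` {..k}"
proof -
  assume k: "k \<noteq> j"
  then have "k < j \<or> j' \<le> k" using level_cases by blast
  then have "Transposition.transpose j j' ` {..k} = {..k}"
    using jj'(1) by (intro transpose_image_eq) auto
  then show ?thesis by (metis image_comp)
qed

lemma image_parts:
  "w_swapped ` {..j} = insert (w j') (w ` {..<j})" "w ` {..j} = insert (w j) (w ` {..<j})"
  "w ` {..j'} = insert (w j) (insert (w j') (w ` {..<j}))"
  "w j \<notin> w ` {..<j}" "w j' \<notin> w ` {..<j}"
proof -
  have j: "{..j} = insert j {..<j}" by auto
  have j': "{..j'} = insert j (insert j' {..<j})"
    using jj' by (auto simp: not_less) (metis greaterThanLessThan_empty_iff greaterThanLessThan_iff empty_iff not_less order.not_eq_order_implies_strict)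
  have "w_swapped ` {..<j} = w ` {..<j}" using jj'(1) by (intro image_cong) (auto simp: Transposition.transpose_def)
  then show "w_swapped ` {..j} = insert (w j') (w ` {..<j})" unfolding j by simp
  show "w ` {..j} = insert (w j) (w ` {..<j})" unfolding j by simp
  show "w ` {..j'} = insert (w j) (insert (w j') (w ` {..<j}))" unfolding j' by simp
  have "inj w" using w by (rule bij_is_inj)
  then show "w j \<notin> w ` {..<j}" "w j' \<notin> w ` {..<j}" using jj' by (auto simp: inj_eq)
qed

lemma w_mem: "k \<noteq> j \<Longrightarrow> w j \<in> w ` {..k} \<longleftrightarrow> w j' \<in> w ` {..k}"
  using level_cases[of k] jj'(1) bij_is_inj[OF w] by (auto simp: inj_image_mem_iff)

text \<open>After subtracting its components in the smaller levels and rescaling, b y becomes b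
  applied to the axis vector at w j plus t times that at w j'. This is the effect of a shear, which
  lies in \<open>row_borel\<close> because of the descent. The shear preserves all other levels,
  since these contain both of w j and w j' or neither.\<close>

lemma line_in_cell:
  assumes b: "b \<in> row_borel" and F: "F \<in> Fl" "\<And>k. k \<noteq> j \<Longrightarrow> F k = (*v) b ` coord (w ` {..k})"
    and y: "b *v y \<in> F j" "y $ w j \<noteq> 0" "y \<in> coord (w ` {..j'})"
  shows "F \<in> row_cell w"
proof -
  let ?p = "w j" and ?q = "w j'" and ?A = "w ` {..<j}"
  have inv: "invertible b" using b by (simp add: row_borel_def)
  have A: "(*v) b ` coord ?A \<subseteq> F j"
  proof (cases "{..<j} = {}")
    case True
    then show ?thesis using vec.subspace_0[OF FlD(1)[OF F(1)]] by (auto simp: coord_empty)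
  next
    case False
    then have "Max {..<j} < j" using Max_in[OF _ False] by simp
    then have "F (Max {..<j}) = (*v) b ` coord ?A" using F(2) atMost_Max_lessThan[OF False] by simp
    then show ?thesis using FlD(3)[OF F(1), of "Max {..<j}" j] \<open>Max {..<j} < j\<close> by simp
  qed
  define t where "t = y $ ?q / y $ ?p"
  let ?s = "shear ?q ?p t"
  have e: "b *v (axis ?p 1 + t *s axis ?q 1) \<in> F j"
  proof -
    let ?z = "y - y $ ?p *s axis ?p 1 - y $ ?q *s axis ?q 1"
    have "?z \<in> coord ?A"
      using y(3) desc_values_neq unfolding image_parts by (auto simp: coord_def axis_def)
    then have "b *v ?z \<in> F j" using A by blast
    then have "b *v y - b *v ?z \<in> F j" using y(1) vec.subspace_diff[OF FlD(1)[OF F(1)]] by blast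
    then have "(1 / y $ ?p) *s (b *v y - b *v ?z) \<in> F j" using vec.subspace_scale[OF FlD(1)[OF F(1)]] by blast
    also have "(1 / y $ ?p) *s (b *v y - b *v ?z) = b *v ((1 / y $ ?p) *s (y - ?z))"
      by (simp only: matrix_vector_mult_diff_distrib vec.scale)
    also have "(1 / y $ ?p) *s (y - ?z) = axis ?p 1 + t *s axis ?q 1"
      using y(2) by (simp add: t_def vec_eq_iff axis_def field_simps)
    finally show ?thesis .
  qed
  have "F k = (*v) (b ** ?s) ` coord (w ` {..k})" for k
  proof (cases "k = j")
    case False
    then have "(*v) ?s ` coord (w ` {..k}) = coord (w ` {..k})"
      using w_mem desc_values_neq by (intro shear_coord_image) auto
    then show ?thesis using F(2)[OF False] by (simp add: matrix_vector_mul_assoc[symmetric] image_image[symmetric] image_comp[symmetric])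
  next
    case True
    have "(*v) (b ** ?s) ` coord (w ` {..j}) \<subseteq> F j"
    proof clarify
      fix x assume x: "x \<in> coord (w ` {..j})"
      have d: "?s *v x = (x - x $ ?p *s axis ?p 1) + x $ ?p *s (axis ?p 1 + t *s axis ?q 1)"
        by (simp add: shear_mult vec_eq_iff algebra_simps)
      have "b *v (?s *v x) = b *v (x - x $ ?p *s axis ?p 1) + x $ ?p *s (b *v (axis ?p 1 + t *s axis ?q 1))"
        by (simp only: d matrix_vector_right_distrib vec.scale)
      moreover have "x - x $ ?p *s axis ?p 1 \<in> coord ?A"
        using x unfolding image_parts by (auto simp: coord_def axis_def)
      then have "b *v (x - x $ ?p *s axis ?p 1) \<in> F j" using A by blast
      ultimately show "(b ** ?s) *v x \<in> F j"
        using e vec.subspace_add[OF FlD(1)[OF F(1)]] vec.subspace_scale[OF FlD(1)[OF F(1)]]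
        by (simp add: matrix_vector_mul_assoc[symmetric])
    qed
    moreover have "invertible (b ** ?s)" using inv desc_values_neq by (intro invertible_mult invertible_shear) auto
    then have "vec.dim ((*v) (b ** ?s) ` coord (w ` {..j})) = vec.dim (F j)"
      using bij_is_inj[OF w] FlD(2)[OF F(1)]
      by (simp add: dim_invertible_image dim_coord card_image inj_on_subset)
    ultimately show ?thesis
      using True FlD(1)[OF F(1)] by (metis order_refl subspace_coord subspace_eqI subspace_matrix_image)
  qed
  then have "F = (\<lambda>k. (*v) (b ** ?s) ` coord (w ` {..k}))" by blast
  moreover have "b ** ?s \<in> row_borel" using b shear_row_borel[OF desc] by (rule row_borel_mult)
  ultimately show ?thesis unfolding row_cell_eq by blast
qed

text \<open>A shear in the opposite direction, outside of \<open>row_borel\<close>, moves the flag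
  of the swapped permutation along a curve that lies in the cell of w for all nonzero t. Polynomials
  vanishing on the curve away from t = 0 vanish at t = 0 by continuity.\<close>

lemma swap_cell_limit:
  assumes b: "b \<in> row_borel" and Z: "zariski_closed Z" "row_cell w \<subseteq> Z"
  shows "(\<lambda>k. (*v) b ` coord (w_swapped ` {..k})) \<in> Z"
proof -
  have bij_swapped: "bij w_swapped" using w by (simp add: bij_comp)
  have inv: "invertible b" using b by (simp add: row_borel_def)
  define M where "M t = b ** (shear (w j) (w j') t ** perm_matrix w_swapped)" for t
  have fl: "flag_of (M t) k = (*v) b ` (*v) (shear (w j) (w j') t) ` coord (w_swapped ` {..k})" for t k
    by (simp add: M_def flag_of_mult flag_of_perm_matrix)
  have invM: "invertible (M t)" for t
    unfolding M_def using inv desc_values_neq bij_swapped by (intro invertible_mult invertible_shear invertible_perm_matrix) auto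
  have cell: "flag_of (M t) \<in> row_cell w" if "t \<noteq> 0" for t
  proof (rule line_in_cell[OF b flag_of_in_Fl[OF invM]])
    show "flag_of (M t) k = (*v) b ` coord (w ` {..k})" if "k \<noteq> j" for k
      using shear_coord_image[of "w j" "w j'" "w ` {..k}" t] desc_values_neq w_mem[OF that] image_swap[OF that] by (simp add: fl)
    let ?y = "shear (w j) (w j') t *v axis (w j') 1"
    have "axis (w j') 1 \<in> coord (w_swapped ` {..j})" unfolding image_parts by (auto simp: coord_def axis_def)
    then show "b *v ?y \<in> flag_of (M t) j" unfolding fl by blast
    show "?y $ w j \<noteq> 0" using that desc_values_neq by (simp add: shear_mult axis_def)
    show "?y \<in> coord (w ` {..j'})" unfolding image_parts by (auto simp: shear_mult coord_def axis_def)
  qed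
  obtain P where P: "P \<subseteq> poly_fun" "\<And>M. invertible M \<Longrightarrow> flag_of M \<in> Z \<longleftrightarrow> (\<forall>p\<in>P. p M = 0)"
    using Z(1) by (auto simp: zariski_closed_def)
  have "p (M 0) = 0" if "p \<in> P" for p
  proof -
    have cM: "continuous_on UNIV M"
      unfolding M_def matrix_matrix_mult_def shear_def
      by (intro continuous_intros)
    have "continuous_on UNIV (\<lambda>t. p (M t))"
      by (rule continuous_on_compose2[OF continuous_poly_fun cM]) (use that P in auto)
    then have "((\<lambda>t. p (M t)) \<longlongrightarrow> p (M 0)) (at 0)"
      by (simp add: continuous_on_def)
    moreover have "p (M t) = 0" if "t \<noteq> 0" for t
      using cell[OF that] Z(2) P(2)[OF invM] \<open>p \<in> P\<close> by blast
    then have "((\<lambda>t. p (M t)) \<longlongrightarrow> 0) (at 0)"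
      by (intro tendsto_eventually) (auto simp: eventually_at_filter)
    ultimately show ?thesis by (intro tendsto_unique[OF _ _ _]) (auto simp: trivial_limit_at)
  qed
  then have "flag_of (M 0) \<in> Z" using P(2)[OF invM] by blast
  moreover have "flag_of (M 0) = (\<lambda>k. (*v) b ` coord (w_swapped ` {..k}))"
    by (simp add: fun_eq_iff fl shear_0)
  ultimately show ?thesis by simp
qed

text \<open>The flags G sharing all levels but j with F form a projective line. Either G = F, which
  is a limit of points of the cell of w, or G j contains a vector with nonzero coordinate at w j,
  and G lies in that cell.\<close>

lemma swap_cell_line:
  assumes F: "F \<in> row_cell w_swapped" and Z: "zariski_closed Z" "row_cell w \<subseteq> Z"
    and G: "G \<in> Fl" "\<And>k. k \<noteq> j \<Longrightarrow> G k = F k"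
  shows "G \<in> Z"
proof -
  obtain b where b: "b \<in> row_borel" "F = (\<lambda>k. (*v) b ` coord (w_swapped ` {..k}))" using F by (auto simp: row_cell_eq)
  have inv: "invertible b" using b by (simp add: row_borel_def)
  have Gk: "G k = (*v) b ` coord (w ` {..k})" if "k \<noteq> j" for k
    using G(2)[OF that] b(2) image_swap[OF that] by simp
  show ?thesis
  proof (cases "G j \<subseteq> (*v) b ` coord (w_swapped ` {..j})")
    case True
    have "card (w_swapped ` {..j}) = card {..j}"
      using image_parts desc_values_neq by (simp add: card_insert_if card_atMost_Suc card_image inj_on_subset[OF bij_is_inj[OF w]])
    then have "G j = (*v) b ` coord (w_swapped ` {..j})"
      using True FlD[OF G(1)] by (intro subspace_eqI)
        (simp_all add: subspace_matrix_image subspace_coord dim_invertible_image[OF inv] dim_coord)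
    then have "G k = F k" for k using G(2)[of k] b(2) by (cases "k = j") auto
    then have "G = F" by blast
    then show ?thesis using swap_cell_limit[OF b(1) Z] b(2) by simp
  next
    case False
    moreover have "G j \<subseteq> (*v) b ` coord (w ` {..j'})"
      using Gk[of j'] FlD(3)[OF G(1), of j j'] jj'(1) by simp
    ultimately obtain y where y: "y \<in> coord (w ` {..j'})" "b *v y \<in> G j" "y \<notin> coord (w_swapped ` {..j})"
      by blast
    then have "y $ w j \<noteq> 0" unfolding image_parts by (auto simp: coord_def)
    then show ?thesis using line_in_cell[OF b(1) G(1) Gk y(2)] y(1) Z(2) by blast
  qed
qed

end

lemma ex_adjacent_descent:
  fixes w :: "'n \<Rightarrow> 'n"
  assumes "i < j" "L (w j) (w i)"
  shows "\<exists>i' j'. i' < j' \<and> {i'<..<j'} = {} \<and> L (w j') (w i')"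
  using assms
proof (induction "card {i<..<j}" arbitrary: i j rule: less_induct)
  case less
  show ?case
  proof (cases "{i<..<j} = {}")
    case False
    then obtain l where l: "i < l" "l < j" by auto
    have "l \<in> {i<..<j}" "l \<notin> {i<..<l}" "l \<notin> {l<..<j}" "{i<..<l} \<subseteq> {i<..<j}" "{l<..<j} \<subseteq> {i<..<j}"
      using l by auto
    then have "card {i<..<l} < card {i<..<j}" "card {l<..<j} < card {i<..<j}"
      by (metis finite psubsetI psubset_card_mono)+
    moreover have "L (w l) (w i) \<or> L (w j) (w l)"
      using less.prems(2) L_total L_trans by metis
    ultimately show ?thesis using less.hyps l by blast
  qed (use less.prems in blast)
qed

theorem row_variety_subset_closed:
  assumes "bij w" "F \<in> row_variety w" "zariski_closed Z" "row_cell w \<subseteq> Z"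
  shows "F \<in> Z"
  using assms
proof (induction "card (inv_set UNIV L w)" arbitrary: w F Z rule: less_induct)
  case less
  note w = less.prems(1) and F = less.prems(2) and Z = less.prems(3,4)
  have FFl: "F \<in> Fl" and Fc: "\<And>k T. down T \<Longrightarrow> card (w ` {..k} \<inter> T) \<le> cdim (F k) T"
    using F by (auto simp: row_variety_def)
  show ?case
  proof (cases "\<exists>i j. i < j \<and> L (w j) (w i)")
    case False
    \<comment> \<open>Without descents each prefix of w is an initial segment of L, and the rank
      conditions at these segments leave only the coordinate flag.\<close>
    have mono: "i < j \<Longrightarrow> L (w i) (w j)" for i j
      using False L_total[of "w i" "w j"] bij_is_inj[OF w] by (metis inj_eq order_less_irrefl)
    have "F k = (*v) (mat 1) ` coord (w ` {..k})" for k
    proof -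
      have "down (w ` {..k})"
        unfolding down_def
      proof (intro allI impI)
        fix x y assume "y \<in> w ` {..k}" "L x y"
        moreover obtain i where "x = w i" using bij_is_surj[OF w] by blast
        ultimately obtain l where "l \<le> k" "L (w i) (w l)" by auto
        then have "\<not> l < i" using mono L_trans L_irrefl by blast
        then show "x \<in> w ` {..k}" using \<open>l \<le> k\<close> \<open>x = w i\<close> by (intro image_eqI[of _ _ i]) auto
      qed
      then have "card (w ` {..k}) \<le> vec.dim (F k \<inter> coord (w ` {..k}))"
        using Fc[of "w ` {..k}" k] by (simp add: cdim_def)
      moreover have c: "card (w ` {..k}) = card {..k}"
        using bij_is_inj[OF w] by (simp add: card_image inj_on_subset)
      moreover have "vec.subspace (F k \<inter> coord (w ` {..k}))"
        using FlD(1)[OF FFl] subspace_coord by (rule vec.subspace_inter)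
      ultimately have "F k \<inter> coord (w ` {..k}) = F k" "F k \<inter> coord (w ` {..k}) = coord (w ` {..k})"
        using FlD[OF FFl] subspace_coord by (intro subspace_eqI; simp add: dim_coord)+
      then show ?thesis by simp
    qed
    then have "F \<in> row_cell w" using mat_1_row_borel unfolding row_cell_eq by blast
    then show ?thesis using Z by blast
  next
    case True
    then obtain j j' where jj': "j < j'" "{j<..<j'} = {}" "L (w j') (w j)"
      using ex_adjacent_descent by blast
    let ?w = "w \<circ> Transposition.transpose j j'"
    note parts = image_parts[OF w jj'] and sw = image_swap[OF w jj']
    have w': "bij ?w" using w by (simp add: bij_comp)
    have "card (inv_set UNIV L ?w) < card (inv_set UNIV L (?w \<circ> Transposition.transpose j j'))"
      by (rule card_inv_set_transpose) (use jj' L_trans L_irrefl in auto)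
    then have inv: "card (inv_set UNIV L ?w) < card (inv_set UNIV L w)"
      by (simp add: comp_assoc)
    let ?A = "w ` {..<j}"
    have cj': "card {..j'} = Suc (Suc (card {..<j}))"
    proof -
      have "card (w ` {..j'}) = Suc (Suc (card ?A))"
        using parts desc_values_neq[OF w jj'] by (simp add: card_insert_if)
      then show ?thesis using bij_is_inj[OF w] by (simp add: card_image inj_on_subset)
    qed
    have BF: "below F j \<subseteq> F j'" using below(3)[OF FFl, of j] FlD(3)[OF FFl, of j j'] jj'(1) by (meson less_imp_le order_trans)
    \<comment> \<open>The sets closed under L form a chain, so a single subspace meets all
      conditions of the shorter permutation at level j.\<close>
    obtain V where V: "vec.subspace V" "below F j \<subseteq> V" "V \<subseteq> F j'" "vec.dim V = Suc (vec.dim (below F j))"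
      "\<And>T. T \<in> Collect down \<Longrightarrow> Suc (cdim (below F j) T) \<le> cdim V T \<or> cdim (F j') T \<le> cdim V T"
      by (rule ex_intermediate_subspace[OF below(1)[OF FFl, of j] FlD(1)[OF FFl, of j'] BF, of "Collect down"])
        (use cj' down_chain in \<open>auto simp: below(2)[OF FFl] FlD(2)[OF FFl]\<close>)
    let ?F = "F(j := V)"
    have F'Fl: "?F \<in> Fl"
    proof -
      have "?F i \<subseteq> ?F k" if ik: "i \<le> k" for i k
      proof -
        consider "i = k" | "i = j" "j' \<le> k" | "i < j" "k = j" | "i \<noteq> j" "k \<noteq> j"
          using ik level_cases[OF w jj', of k] jj'(1) by (cases "k = j"; cases "i = j") auto
        then show ?thesis
        proof cases
          case 2
          then show ?thesis using V(3) FlD(3)[OF FFl, of j' k] jj'(1) by auto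
        next
          case 3
          then show ?thesis using V(2) below(4)[OF FFl, of i j] by auto
        next
          case 4
          then show ?thesis using FlD(3)[OF FFl ik] by simp
        qed simp
      qed
      then show ?thesis
        using V(1,4) FlD(1,2)[OF FFl] unfolding Fl_def Grassmannian_def
        by (auto simp: below(2)[OF FFl] card_atMost_Suc)
    qed
    have "card (?w ` {..k} \<inter> T) \<le> cdim (?F k) T" if T: "down T" for k T
    proof (cases "k = j")
      case False
      then show ?thesis using Fc[OF T, of k] sw[OF False] by simp
    next
      case True
      have "card (?A \<inter> T) \<le> cdim (below F j) T"
      proof (cases "{..<j} = {}")
        case False
        then show ?thesis
          using Fc[OF T, of "Max {..<j}"] unfolding below_def atMost_Max_lessThan[OF False] by simp
      next
        case True
        then have "?A = {}" by (simp only: image_empty)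
        then show ?thesis by (simp only: Int_empty_left card.empty zero_le)
      qed
      moreover have "card (insert (w j) (insert (w j') ?A) \<inter> T) \<le> cdim (F j') T"
        using Fc[OF T, of j'] parts(3) by simp
      ultimately have "card (insert (w j') ?A \<inter> T) \<le> cdim V T"
        using parts(4,5) desc_values_neq[OF w jj'] V(5)[of T] T by (intro cdim_ge_intermediate[of "w j'" ?A "w j" T "below F j" "F j'"]) auto
      then show ?thesis using True parts(1) by simp
    qed
    then have F': "?F \<in> row_variety ?w" using F'Fl by (simp add: row_variety_def)
    \<comment> \<open>The induction hypothesis is applied to this closed set instead of Z. It
      contains the shorter cell, hence the modified flag, and F is a modification of that flag at
      level j.\<close>
    let ?Z = "{F \<in> Fl. \<forall>F'\<in>Fl. (\<forall>k. k \<noteq> j \<longrightarrow> F' k = F k) \<longrightarrow> F' \<in> Z}"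
    have "row_cell ?w \<subseteq> ?Z"
      using swap_cell_line[OF w jj' _ Z] row_cell_subset[OF w'] by (auto simp: row_variety_def)
    then have "?F \<in> ?Z"
      by (intro less.hyps[OF inv w' F'] zariski_closed_forget_level Z)
    then show ?thesis using FFl by auto
  qed
qed

theorem zariski_closure_row_cell:
  assumes "bij w" shows "zariski_closure (row_cell w) = row_variety w"
  unfolding zariski_closure_def
  using row_variety_subset_closed[OF assms] row_cell_subset[OF assms] zariski_closed_row_variety by blast

end

section \<open>The tableau criterion for the Bruhat order\<close>

definition up_closed :: "'n::linorder set \<Rightarrow> bool"
  where "up_closed T \<longleftrightarrow> (\<forall>x y. x \<in> T \<longrightarrow> x \<le> y \<longrightarrow> y \<in> T)"

lemma inversions_eq: "inversions w = inv_set UNIV (<) w"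
  by (simp add: inversions_def inv_set_def)

text \<open>At the first position j of disagreement x j < y j. Exchanging x j with the first later
  entry whose value is above x j and at most y j is a Bruhat step upwards that keeps all the
  inequalities; the number of inversions is bounded, so this terminates.\<close>

lemma bruhat_le_if_counts:
  fixes x y :: "'n::{finite,linorder} \<Rightarrow> 'n"
  assumes "bij x" "bij y"
    and "\<And>k T. up_closed T \<Longrightarrow> card (x ` {..k} \<inter> T) \<le> card (y ` {..k} \<inter> T)"
  shows "bruhat_le x y"
  using assms
proof (induction "card (UNIV :: ('n \<times> 'n) set) - card (inversions x)" arbitrary: x rule: less_induct)
  case less
  note x = less.prems(1) and y = less.prems(2) and le = less.prems(3)
  show ?case
  proof (cases "x = y")
    case True
    then show ?thesis by (simp add: bruhat_le_def)
  next
    case False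
    define J where "J = {j. x j \<noteq> y j}"
    have "J \<noteq> {}" using False by (auto simp: J_def)
    define j where "j = Min J"
    have "j \<in> J" using Min_in[of J] \<open>J \<noteq> {}\<close> by (simp add: j_def)
    moreover have "i \<notin> J" if "i < j" for i using Min_le[of J i] that by (auto simp: j_def not_le[symmetric])
    ultimately have j: "x j \<noteq> y j" "\<And>i. i < j \<Longrightarrow> x i = y i" by (auto simp: J_def)
    let ?A = "y ` {..<j}"
    have xA: "x ` {..<j} = ?A" using j(2) by (intro image_cong) auto
    have atM: "{..j} = insert j {..<j}" by auto
    have "x j \<notin> x ` {..<j}" using bij_is_inj[OF x] by (auto simp: inj_eq)
    moreover have "y j \<notin> ?A" using bij_is_inj[OF y] by (auto simp: inj_eq)
    ultimately have nA: "x j \<notin> ?A" "y j \<notin> ?A" unfolding xA by blast+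
    have "up_closed {x j..}" by (auto simp: up_closed_def)
    then have "card (insert (x j) ?A \<inter> {x j..}) \<le> card (insert (y j) ?A \<inter> {x j..})"
      using le[of "{x j..}" j] xA unfolding atM by simp
    then have xy: "x j < y j"
      using j(1) unfolding card_insert_Int[OF nA(1)] card_insert_Int[OF nA(2)] by (auto simp: of_bool_def split: if_splits)
    define S where "S = {l. j < l \<and> x j < x l \<and> x l \<le> y j}"
    have "S \<noteq> {}"
    proof -
      obtain l where l: "x l = y j" using bij_is_surj[OF x] by (metis surjD)
      have "\<not> l < j" "l \<noteq> j" using l j bij_is_inj[OF y] by (auto simp: inj_eq)
      then have "l \<in> S" using l xy by (auto simp: S_def)
      then show ?thesis by blast
    qed
    define l where "l = Min S"
    have "l \<in> S" using Min_in[of S] \<open>S \<noteq> {}\<close> by (simp add: l_def)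
    then have l: "j < l" "x j < x l" "x l \<le> y j" by (auto simp: S_def)
    have lmin: "l \<le> p" if "p \<in> S" for p using Min_le[of S] that by (simp add: l_def)
    let ?x = "x \<circ> Transposition.transpose j l"
    have "bij ?x" using x by (simp add: bij_comp)
    have inv: "card (inversions x) < card (inversions ?x)"
      unfolding inversions_eq by (rule card_inv_set_transpose) (use l in auto)
    have "card (inversions ?x) \<le> card (UNIV :: ('n \<times> 'n) set)" by (rule card_mono) auto
    with inv have meas: "card (UNIV :: ('n \<times> 'n) set) - card (inversions ?x) < card (UNIV :: ('n \<times> 'n) set) - card (inversions x)"
      by linarith
    have "card (?x ` {..k} \<inter> T) \<le> card (y ` {..k} \<inter> T)" if T: "up_closed T" for k T
    proof (cases "j \<le> k \<and> k < l")
      case False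
      then have "Transposition.transpose j l ` {..k} = {..k}"
        using l(1) by (intro transpose_image_eq) auto
      then have "?x ` {..k} = x ` {..k}" by (metis image_comp)
      then show ?thesis using le[OF T] by simp
    next
      case True
      let ?B = "x ` ({..k} - {j})"
      have k: "{..k} = insert j ({..k} - {j})" using True by auto
      have B: "x j \<notin> ?B" "x l \<notin> ?B" using bij_is_inj[OF x] True by (auto simp: inj_eq)
      have xk: "x ` {..k} = insert (x j) ?B" by (metis image_insert k)
      have "?x ` ({..k} - {j}) = ?B"
        using True by (intro image_cong) (auto simp: Transposition.transpose_def)
      moreover have "?x ` {..k} = insert (?x j) (?x ` ({..k} - {j}))" by (metis image_insert k)
      ultimately have xk': "?x ` {..k} = insert (x l) ?B" by simp
      show ?thesis
      proof (cases "x l \<in> T \<and> x j \<notin> T")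
        case False
        then have "card (insert (x l) ?B \<inter> T) \<le> card (insert (x j) ?B \<inter> T)"
          unfolding card_insert_Int[OF B(1)] card_insert_Int[OF B(2)] by (auto simp: of_bool_def)
        then show ?thesis using le[OF T, of k] xk xk' by simp
      next
        case xT: True
        have yT: "y j \<in> T" using xT l(3) T by (auto simp: up_closed_def)
        \<comment> \<open>All elements of T exceed x j. By the choice of l no position after j and
          up to k has a value in the lower part of T, so x has there only entries from the prefix
          shared with y, whereas y has y j in addition. This leaves room for the one new element;
          the upper part is compared by hypothesis.\<close>
        let ?C = "T \<inter> {..y j}" and ?D = "T \<inter> {y j<..}"
        have CD: "T = ?C \<union> ?D" "?C \<inter> ?D = {}" by auto
        have D: "up_closed ?D" using T by (auto simp: up_closed_def)
        have split: "card (X \<inter> T) = card (X \<inter> ?C) + card (X \<inter> ?D)" for X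
          using card_Int_disjoint_Un[OF CD(2), of X] CD(1) by simp
        have "x ` {..k} \<inter> ?C \<subseteq> ?A \<inter> ?C"
        proof
          fix a assume a: "a \<in> x ` {..k} \<inter> ?C"
          then obtain p where p: "p \<le> k" "a = x p" "x p \<in> T" "x p \<le> y j" by auto
          have "\<not> j < p"
          proof
            assume "j < p"
            moreover have "x j < x p" using p(3) xT T by (meson up_closed_def not_le)
            ultimately have "p \<in> S" using p(4) by (simp add: S_def)
            then show False using lmin p(1) True by (meson not_le order_trans)
          qed
          moreover have "p \<noteq> j" using p(3) xT by auto
          ultimately have "p < j" by auto
          then show "a \<in> ?A \<inter> ?C" using p xA by auto
        qed
        then have "card (x ` {..k} \<inter> ?C) \<le> card (?A \<inter> ?C)" by (intro card_mono) auto
        moreover have "card (insert (y j) ?A \<inter> ?C) \<le> card (y ` {..k} \<inter> ?C)"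
          using True by (intro card_mono) auto
        then have "Suc (card (?A \<inter> ?C)) \<le> card (y ` {..k} \<inter> ?C)"
          using yT unfolding card_insert_Int[OF nA(2)] by simp
        moreover have "card (x ` {..k} \<inter> ?D) \<le> card (y ` {..k} \<inter> ?D)" by (rule le[OF D])
        ultimately have "Suc (card (x ` {..k} \<inter> T)) \<le> card (y ` {..k} \<inter> T)"
          using split[of "x ` {..k}"] split[of "y ` {..k}"] by linarith
        moreover have "card (x ` {..k} \<inter> T) = card (?B \<inter> T)"
          using xT unfolding xk card_insert_Int[OF B(1)] by simp
        ultimately show ?thesis
          using xT unfolding xk' card_insert_Int[OF B(2)] by simp
      qed
    qed
    then have "bruhat_le ?x y" by (rule less.hyps[OF meas \<open>bij ?x\<close> y])
    moreover have "bruhat_step x ?x"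
      unfolding bruhat_step_def using inv l(1) by (intro conjI exI[of _ j] exI[of _ l]) auto
    ultimately show ?thesis unfolding bruhat_le_def by (simp add: converse_rtranclp_into_rtranclp)
  qed
qed

section \<open>Positions as natural numbers\<close>

definition pos :: "'n::{finite,linorder} \<Rightarrow> nat"
  where "pos k = card {..<k}"

lemma pos_less: "j < k \<Longrightarrow> pos j < pos k"
  unfolding pos_def by (intro psubset_card_mono) auto

lemma pos_less_iff: "pos j < pos k \<longleftrightarrow> j < k"
  using pos_less by (metis less_asym linorder_neqE)

lemma card_atMost_pos: "card {..k} = Suc (pos k)"
  by (simp add: pos_def card_atMost_Suc)

lemma pos_bound: "pos (k :: 'n::{finite,linorder}) < CARD('n)"
  unfolding pos_def by (intro psubset_card_mono) auto

lemma bij_betw_pos: "bij_betw pos (UNIV :: 'n::{finite,linorder} set) {..<CARD('n)}"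
proof -
  have inj: "inj (pos :: 'n \<Rightarrow> nat)" by (metis injI less_irrefl linorder_neqE pos_less)
  moreover have "range (pos :: 'n \<Rightarrow> nat) = {..<CARD('n)}"
    using card_image[OF inj] pos_bound by (intro card_subset_eq) auto
  ultimately show ?thesis by (simp add: bij_betw_def)
qed

lemma pos_image: "pos ` {..k :: 'n::{finite,linorder}} = {..<Suc (pos k)}"
proof (rule card_subset_eq)
  have "pos j \<le> pos k" if "j \<le> k" for j using that pos_less_iff[of k j] by (meson not_le)
  then show "pos ` {..k} \<subseteq> {..<Suc (pos k)}" by (auto simp: less_Suc_eq_le)
  have "inj_on pos {..k}" using bij_betw_pos inj_on_subset unfolding bij_betw_def by blast
  then show "card (pos ` {..k}) = card {..<Suc (pos k)}" by (simp add: card_image card_atMost_pos)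
qed simp

definition at_pos :: "nat \<Rightarrow> 'n::{finite,linorder}"
  where "at_pos = inv_into UNIV pos"

lemma at_pos_pos [simp]: "at_pos (pos k) = k"
  unfolding at_pos_def by (rule inv_into_f_f) (use bij_betw_pos in \<open>auto simp: bij_betw_def\<close>)

lemma pos_at_pos: "m < CARD('n) \<Longrightarrow> pos (at_pos m :: 'n::{finite,linorder}) = m"
  unfolding at_pos_def using bij_betw_pos[where 'n = 'n] by (intro f_inv_into_f) (auto simp: bij_betw_def)

lemma is_seq_at_pos:
  fixes w :: "'n::{finite,linorder} \<Rightarrow> 'n"
  shows "bij w \<Longrightarrow> is_seq (w \<circ> at_pos)"
  unfolding is_seq_def at_pos_def
  by (rule bij_betw_trans[OF bij_betw_inv_into[OF bij_betw_pos]])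

lemma at_pos_image: "(w \<circ> at_pos) ` {..<Suc (pos k)} = w ` {..k}"
  unfolding pos_image[symmetric] by (simp add: image_image)

lemma bij_seq_pos:
  fixes w :: "nat \<Rightarrow> 'n::{finite,linorder}"
  shows "is_seq w \<Longrightarrow> bij (w \<circ> (pos :: 'n \<Rightarrow> nat))"
  unfolding is_seq_def by (rule bij_betw_trans[OF bij_betw_pos])

lemma seq_pos_image: "(w \<circ> pos) ` {..k} = w ` {..<Suc (pos k)}"
  unfolding pos_image[symmetric] by (simp add: image_image)

definition cond_flags ::
    "('n::{finite,linorder} \<Rightarrow> 'n) \<Rightarrow> ('n \<Rightarrow> 'n) \<Rightarrow> ('n \<Rightarrow> 'n) \<Rightarrow> 'n flag set"
  where "cond_flags a u v = {F \<in> Fl. \<forall>k. cond (a k) (u ` {..k}) (v ` {..k}) (F k)}"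

lemma nat_flags_mono:
  assumes "G \<in> nat_flags" "i \<le> j" "j \<le> CARD('n)" shows "G i \<subseteq> (G j :: 'n::finite cvec set)"
  using assms(2,3)
proof (induction j rule: dec_induct)
  case (step m)
  then have "G m \<subseteq> G (Suc m)" using assms(1) by (simp add: nat_flags_def)
  then show ?case using step by simp
qed simp

text \<open>The element k stands for level \<open>Suc (pos k)\<close>. One tilt per level on the
  right-hand side suffices, since \<open>level_condI\<close> extends the condition to all
  tilts.\<close>

lemma level_image_eq:
  fixes us vs :: "nat \<Rightarrow> 'n::{finite,linorder}"
  assumes s: "is_seq us" "is_seq vs"
    and e: "\<And>k. us ` {..<Suc (pos k)} = u ` {..k}" "\<And>k. vs ` {..<Suc (pos k)} = v ` {..k}"
    and t: "\<And>k. tilt (a k) (u ` {..k}) (v ` {..k})"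
  shows "level_image (Suc (pos k)) us vs = proj_Gr k ` cond_flags a u v"
proof (intro equalityI subsetI)
  fix X assume "X \<in> level_image (Suc (pos k)) us vs"
  then obtain G where G: "G \<in> tilted us vs" "X = G (Suc (pos k))" by (auto simp: level_image_def)
  then have Gf: "G \<in> nat_flags" by (simp add: tilted_def)
  define F where "F k = G (Suc (pos k))" for k :: 'n
  have N: "Suc (pos k) \<le> CARD('n)" for k :: 'n using pos_bound[of k] by simp
  have "F i \<subseteq> F j" if "i \<le> j" for i j
    unfolding F_def using that pos_less_iff[of j i] N by (intro nat_flags_mono[OF Gf]) (auto simp: not_less[symmetric])
  then have "F \<in> Fl"
    using Gf N unfolding F_def by (auto simp: Fl_def Grassmannian_def nat_flags_def card_atMost_pos)
  moreover have "cond (a k) (u ` {..k}) (v ` {..k}) (F k)" for k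
  proof -
    have "level_cond us vs (Suc (pos k)) (F k)" using G(1) N[of k] by (simp add: F_def tilted_def)
    then show ?thesis using t[of k] unfolding level_cond_def e by blast
  qed
  ultimately have "F \<in> cond_flags a u v" by (simp add: cond_flags_def)
  then show "X \<in> proj_Gr k ` cond_flags a u v"
    using G(2) by (intro image_eqI[of _ _ F]) (auto simp: proj_Gr_def F_def)
next
  fix X assume "X \<in> proj_Gr k ` cond_flags a u v"
  then obtain F where F: "F \<in> Fl" "\<And>k. cond (a k) (u ` {..k}) (v ` {..k}) (F k)" "X = F k"
    by (auto simp: proj_Gr_def cond_flags_def)
  \<comment> \<open>Positions start at 0, so level m is the one of position m - 1; the zero space is
    added as level 0.\<close>
  define G where "G m = (if m = 0 then {0} else F (at_pos (m - 1)))" for m :: nat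
  have G0: "G 0 = {0}" and GS: "G (Suc m) = F (at_pos m)" for m by (simp_all add: G_def)
  have sub: "vec.subspace (G m)" "vec.dim (G m) = m" if "m \<le> CARD('n)" for m
    using that FlD[OF F(1)] by (cases m; simp add: G0 GS card_atMost_pos pos_at_pos)+
  have "G m \<subseteq> G (Suc m)" if "m < CARD('n)" for m
  proof (cases m)
    case 0
    then show ?thesis using vec.subspace_0[OF FlD(1)[OF F(1)]] by (simp add: G0 GS)
  next
    case (Suc m')
    have "pos (at_pos m' :: 'n) < pos (at_pos (Suc m') :: 'n)" using that Suc by (simp add: pos_at_pos)
    then have "(at_pos m' :: 'n) < at_pos (Suc m')" by (simp add: pos_less_iff)
    then show ?thesis using Suc FlD(3)[OF F(1), of "at_pos m'" "at_pos (Suc m')"] by (simp add: GS)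
  qed
  then have Gf: "G \<in> nat_flags" using sub by (simp add: nat_flags_def)
  have "level_cond us vs m (G m)" if m: "m \<le> CARD('n)" for m
  proof (cases m)
    case 0
    then show ?thesis by (simp add: level_cond_def cond_def)
  next
    case (Suc m')
    let ?k = "at_pos m' :: 'n"
    have p: "m = Suc (pos ?k)" using Suc m by (simp add: pos_at_pos)
    have "tilt (a ?k) (us ` {..<m}) (vs ` {..<m})" "cond (a ?k) (us ` {..<m}) (vs ` {..<m}) (G m)"
      unfolding p e using t F(2) by (simp_all add: GS)
    then show ?thesis using sub m by (intro level_condI[OF s])
  qed
  then have "G \<in> tilted us vs" using Gf by (simp add: tilted_def)
  then show "X \<in> level_image (Suc (pos k)) us vs"
    unfolding level_image_def using F(3) by (intro image_eqI[of _ _ G]) (auto simp: GS)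
qed

section \<open>Tilted Richardson and Richardson varieties as sets defined by dimension
  bounds\<close>

lemma rank_submat_le_iff:
  fixes M :: "'n::{finite,linorder} cmat"
  assumes F: "flag_of M \<in> Fl" and A: "card A = card {..k}"
  shows "rank (submat M S {..k}) \<le> card (A \<inter> S) \<longleftrightarrow> card (A \<inter> - S) \<le> cdim (flag_of M k) (- S)"
proof -
  have "rank (submat M S {..k}) + cdim (flag_of M k) (- S) = card {..k}"
    using rank_plus_cdim[OF FlD(1)[OF F], of S k] by (simp add: rank_submat FlD(2)[OF F])
  moreover have "card {..k} = card (A \<inter> S) + card (A \<inter> - S)"
    using card_split[of A S] A by (simp add: Diff_eq)
  ultimately show ?thesis by linarith
qed

lemma tilted_richardson_eq:
  fixes u v a :: "'n::{finite,linorder} \<Rightarrow> 'n"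
  assumes "bij u" "bij v"
  shows "tilted_richardson a u v = cond_flags a u v"
proof -
  have "(\<forall>i. rank (submat M (cyc_interval r i) {..k}) \<le> card (initial_set u k \<inter> cyc_interval r i) \<and>
      rank (submat M (cyc_interval i r) {..k}) \<le> card (initial_set v k \<inter> cyc_interval i r)) \<longleftrightarrow>
      cond r (u ` {..k}) (v ` {..k}) (flag_of M k)" if F: "flag_of M \<in> Fl" for M r k
  proof -
    have c: "card (u ` {..k}) = card {..k}" "card (v ` {..k}) = card {..k}"
      using assms by (auto intro!: card_image inj_on_subset[OF bij_is_inj])
    have "card (u ` {..k} \<inter> - cyc_interval r i) \<le> cdim (flag_of M k) (- cyc_interval r i) \<and>
        card (v ` {..k} \<inter> - cyc_interval i r) \<le> cdim (flag_of M k) (- cyc_interval i r) \<longleftrightarrow>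
        card (v ` {..k} \<inter> cyc_interval r i) \<le> cdim (flag_of M k) (cyc_interval r i) \<and>
        card (u ` {..k} \<inter> cyc_interval i r) \<le> cdim (flag_of M k) (cyc_interval i r)" for i
    \<comment> \<open>For i = r the interval is empty and its complement is everything instead of an
      interval; both sides then hold by dimension alone.\<close>
    proof (cases "i = r")
      case True
      then show ?thesis using c FlD(2)[OF F, of k] by (simp add: cdim_UNIV cdim_empty)
    next
      case False
      then show ?thesis using cyc_interval_compl[of r i] cyc_interval_compl[of i r] by auto
    qed
    then show ?thesis
      unfolding cond_def initial_set_def rank_submat_le_iff[OF F c(1)] rank_submat_le_iff[OF F c(2)] by blast
  qed
  then have *: "(\<forall>i k. rank (submat M (cyc_interval (a k) i) {..k}) \<le> card (initial_set u k \<inter> cyc_interval (a k) i) \<and>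
      rank (submat M (cyc_interval i (a k)) {..k}) \<le> card (initial_set v k \<inter> cyc_interval i (a k))) \<longleftrightarrow>
      (\<forall>k. cond (a k) (u ` {..k}) (v ` {..k}) (flag_of M k))" if "flag_of M \<in> Fl" for M
    using that by blast
  show ?thesis
  proof (intro equalityI subsetI)
    fix F assume "F \<in> tilted_richardson a u v"
    then show "F \<in> cond_flags a u v"
      using * unfolding tilted_richardson_def cond_flags_def by blast
  next
    fix F assume F: "F \<in> cond_flags a u v"
    then obtain M where "flag_of M = F" using ex_flag_of[of F] unfolding cond_flags_def by blast
    then show "F \<in> tilted_richardson a u v"
      using F *[of M] unfolding tilted_richardson_def cond_flags_def by blast
  qed
qed

interpretation upper: row_order "(<) :: 'n::{finite,linorder} \<Rightarrow> 'n \<Rightarrow> bool"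
  by unfold_locales auto

interpretation lower: row_order "(>) :: 'n::{finite,linorder} \<Rightarrow> 'n \<Rightarrow> bool"
  by unfold_locales auto

lemma Min_UNIV_le: "Min UNIV \<le> (x :: 'n::{finite,linorder})"
  by simp

lemma cyc_interval_Min:
  "cyc_interval (Min UNIV) i = {..<i :: 'n::{finite,linorder}}"
  "cyc_interval i (Min UNIV) = (if i = Min UNIV then {} else {i..})"
proof -
  have m: "{..<Min UNIV :: 'n} = {}" using Min_UNIV_le by (auto simp: not_less[symmetric])
  have "{Min UNIV..<i} = {..<i}" using Min_UNIV_le by (auto simp del: Min_le_iff)
  then show "cyc_interval (Min UNIV) i = {..<i}" using Min_UNIV_le[of i] by (simp only: cyc_interval_def if_True)
  show "cyc_interval i (Min UNIV) = (if i = Min UNIV then {} else {i..})"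
  proof (cases "i = Min UNIV")
    case False
    then have "\<not> i \<le> Min UNIV" using Min_UNIV_le[of i] by (meson order_antisym)
    then show ?thesis using False m by (simp only: cyc_interval_def if_False Un_empty_right)
  qed simp
qed

lemma upper_down_iff: "upper.down T \<longleftrightarrow> T = UNIV \<or> (\<exists>i. T = {..<i :: 'n::{finite,linorder}})"
proof
  assume T: "upper.down T"
  show "T = UNIV \<or> (\<exists>i. T = {..<i})"
  proof (cases "T = UNIV")
    case False
    then have ne: "- T \<noteq> {}" by auto
    define i where "i = Min (- T)"
    have i: "i \<notin> T" "\<And>x. x \<notin> T \<Longrightarrow> i \<le> x" using Min_in[OF _ ne] Min_le[of "- T"] by (auto simp: i_def)
    then have "x \<in> T \<longleftrightarrow> x < i" for x
      using T unfolding upper.down_def by (metis linorder_neqE not_le)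
    then show ?thesis by (intro disjI2 exI[of _ i]) auto
  qed simp
qed (auto simp: upper.down_def)

lemma lower_down_iff: "lower.down T \<longleftrightarrow> T = {} \<or> (\<exists>i. T = {i :: 'n::{finite,linorder}..})"
proof
  assume T: "lower.down T"
  show "T = {} \<or> (\<exists>i. T = {i..})"
  proof (cases "T = {}")
    case False
    define i where "i = Min T"
    have i: "i \<in> T" "\<And>x. x \<in> T \<Longrightarrow> i \<le> x" using Min_in[OF _ False] Min_le[of T] by (auto simp: i_def)
    then have "x \<in> T \<longleftrightarrow> i \<le> x" for x
      using T unfolding lower.down_def by (metis order_le_less)
    then show ?thesis by (intro disjI2 exI[of _ i]) auto
  qed simp
qed (auto simp: lower.down_def)

text \<open>The closure of the Schubert cell of y contributes the bounds on initial segments of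
  rows, that of the opposite cell of x the bounds on final segments. With the least element as tilt
  these are the two families in \<open>cond\<close>.\<close>

lemma richardson_eq:
  fixes x y :: "'n::{finite,linorder} \<Rightarrow> 'n"
  assumes "bij x" "bij y"
  shows "richardson x y = cond_flags (\<lambda>_. Min UNIV) x y"
proof -
  have "schubert_cell y = upper.row_cell y"
    by (simp add: schubert_cell_def upper.row_cell_def upper.row_borel_def borel_upper_def)
  moreover have "opposite_schubert_cell x = lower.row_cell x"
    by (simp add: opposite_schubert_cell_def lower.row_cell_def lower.row_borel_def borel_lower_def)
  ultimately have "richardson x y = upper.row_variety y \<inter> lower.row_variety x"
    using assms by (simp add: richardson_def upper.zariski_closure_row_cell lower.zariski_closure_row_cell)
  also have "\<dots> = cond_flags (\<lambda>_. Min UNIV) x y"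
  proof -
    have "(\<forall>T. upper.down T \<longrightarrow> card (y ` {..k} \<inter> T) \<le> cdim (F k) T) \<and>
        (\<forall>T. lower.down T \<longrightarrow> card (x ` {..k} \<inter> T) \<le> cdim (F k) T) \<longleftrightarrow>
        cond (Min UNIV) (x ` {..k}) (y ` {..k}) (F k)" if F: "F \<in> Fl" for F k
    proof -
      have c: "card (x ` {..k}) = vec.dim (F k)" "card (y ` {..k}) = vec.dim (F k)"
        using assms by (auto simp: FlD(2)[OF F] intro!: card_image inj_on_subset[OF bij_is_inj])
      have "(\<forall>T. upper.down T \<longrightarrow> card (y ` {..k} \<inter> T) \<le> cdim (F k) T) \<longleftrightarrow>
          (\<forall>i. card (y ` {..k} \<inter> {..<i}) \<le> cdim (F k) {..<i})"
        unfolding upper_down_iff using c(2) by (auto simp: cdim_UNIV)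
      moreover have "(\<forall>T. lower.down T \<longrightarrow> card (x ` {..k} \<inter> T) \<le> cdim (F k) T) \<longleftrightarrow>
          (\<forall>i. card (x ` {..k} \<inter> {i..}) \<le> cdim (F k) {i..})"
        unfolding lower_down_iff by (auto simp: cdim_empty)
      \<comment> \<open>At the least element the final segment is everything but the cyclic interval
        is empty; the bound missing from \<open>cond\<close> is supplied by the dimension of F
        k.\<close>
      moreover have "card (x ` {..k} \<inter> {Min UNIV..}) \<le> cdim (F k) {Min UNIV..}"
      proof -
        have "{Min UNIV..} = (UNIV :: 'n set)" by auto
        then show ?thesis using c(1) by (simp add: cdim_UNIV)
      qed
      ultimately show ?thesis
        unfolding cond_def cyc_interval_Min by (auto simp: cdim_empty)
    qed
    then show ?thesis
      unfolding upper.row_variety_def lower.row_variety_def cond_flags_def by blast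
  qed
  finally show ?thesis .
qed

text \<open>A tilt at the least element compares initial segments; taking complements in prefixes of
  equal size compares final segments, which is the tableau criterion.\<close>

lemma bruhat_le_if_tilt_Min:
  fixes x y :: "'n::{finite,linorder} \<Rightarrow> 'n"
  assumes "bij x" "bij y" and t: "\<And>k. tilt (Min UNIV) (x ` {..k}) (y ` {..k})"
  shows "bruhat_le x y"
proof (rule bruhat_le_if_counts[OF assms(1,2)])
  fix k and T :: "'n set" assume T: "up_closed T"
  have c: "card (x ` {..k}) = card {..k}" "card (y ` {..k}) = card {..k}"
    using assms by (auto intro!: card_image inj_on_subset[OF bij_is_inj])
  have "lower.down T" using T by (auto simp: up_closed_def lower.down_def intro: less_imp_le)
  then consider "T = {}" | i where "T = {i..}" unfolding lower_down_iff by blast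
  then show "card (x ` {..k} \<inter> T) \<le> card (y ` {..k} \<inter> T)"
  proof cases
    case (2 i)
    have "card (y ` {..k} \<inter> {..<i}) \<le> card (x ` {..k} \<inter> {..<i})"
      using t[of k] tilt_iff[of "x ` {..k}" "y ` {..k}" "Min UNIV"] c unfolding cyc_interval_Min by simp
    moreover have "C - {..<i} = C \<inter> T" for C using 2 by auto
    ultimately show ?thesis
      using card_split[of "x ` {..k}" "{..<i}"] card_split[of "y ` {..k}" "{..<i}"] c by simp
  qed simp
qed

theorem theorem8p5:
  fixes u v a :: "'n::{finite,linorder} \<Rightarrow> 'n" and k :: 'n
  assumes "u permutes UNIV" and "v permutes UNIV"
    and "admissible_tilt u v a"
  shows "positroid_variety k (proj_Gr k ` tilted_richardson a u v)"
proof -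
  have uv: "bij u" "bij v" using assms permutes_bij by blast+
  have "card (u ` {..k}) = card (v ` {..k})" for k
    using uv by (simp add: card_image inj_on_subset[OF bij_is_inj])
  then have t: "tilt (a k) (u ` {..k}) (v ` {..k})" for k
    using assms(3) by (intro gale_le_imp_tilt) (auto simp: admissible_tilt_def initial_set_def)
  let ?us = "u \<circ> at_pos" and ?vs = "v \<circ> at_pos"
  have s: "is_seq ?us" "is_seq ?vs" using uv is_seq_at_pos by blast+
  have "proj_Gr k ` tilted_richardson a u v = level_image (Suc (pos k)) ?us ?vs"
    using level_image_eq[OF s at_pos_image at_pos_image t] tilted_richardson_eq[OF uv] by simp
  moreover obtain u' v' where s': "is_seq u'" "is_seq v'"
    and e: "level_image (Suc (pos k)) u' v' = level_image (Suc (pos k)) ?us ?vs"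
    and t': "common_tilt 0 CARD('n) (Min UNIV) u' v'"
    using ex_common_tilt_Min[OF s, of "Suc (pos k)"] pos_bound[of k] by auto
  let ?x = "u' \<circ> (pos :: 'n \<Rightarrow> nat)" and ?y = "v' \<circ> (pos :: 'n \<Rightarrow> nat)"
  have xy: "bij ?x" "bij ?y" using bij_seq_pos[OF s'(1)] bij_seq_pos[OF s'(2)] .
  \<comment> \<open>This single fact serves twice: it identifies the tilted variety of the new pair
    with a Richardson variety, and it gives the Bruhat relation between x and y.\<close>
  have t'': "tilt (Min UNIV) (?x ` {..k}) (?y ` {..k})" for k :: 'n
    unfolding seq_pos_image using t' pos_bound[of k] by (simp add: common_tilt_def)
  have "level_image (Suc (pos k)) u' v' = proj_Gr k ` richardson ?x ?y"
    using level_image_eq[OF s' seq_pos_image[symmetric] seq_pos_image[symmetric] t''] richardson_eq[OF xy] by simp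
  ultimately have "proj_Gr k ` tilted_richardson a u v = proj_Gr k ` richardson ?x ?y"
    using e by simp
  moreover have "?x permutes UNIV" "?y permutes UNIV" using xy by (auto intro: bij_imp_permutes)
  moreover have "bruhat_le ?x ?y" by (rule bruhat_le_if_tilt_Min[OF xy t''])
  ultimately show ?thesis unfolding positroid_variety_def by blast
qed

end
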